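(* Let $1\leq p,q\leq\infty$ and $0\leq r<\frac{1}{p}$, and let $b\geq 2$ be an integer. Let $\mathcal{V}_b^{\mathrm{sym}}$ denote the symmetrized van der Corput sequence in base $b$. Then there is a constant $C>0$ independent of $N$ such that for all integers $N\geq 2$: if $r=0$, $$\left\|D_N(\mathcal{V}_b^{\mathrm{sym}},\cdot)\mid S_{p,q}^rB([0,1))\right\|\leq C\, N^{-1}(\log N)^{\frac{1}{q}},$$ and if $0<r<\frac{1}{p}$, $$\left\|D_N(\mathcal{V}_b^{\mathrm{sym}},\cdot)\mid S_{p,q}^rB([0,1))\right\|\leq C\, N^{r-1}.$$
   Context: For an integer $b\geq 2$ and $n\in\mathbb{N}_0$ with base-$b$ expansion $n=\sum_{i=0}^k n_i b^i$, the radical inverse is $\varphi_b(n)=\sum_{i=0}^k n_i b^{-i-1}$. The symmetrized van der Corput sequence in base $b$ is $\mathcal{V}_b^{\mathrm{sym}}=(z_n)_{n\geq 0}$ with $z_{2m}=\varphi_b(m)$ and $z_{2m+1}=1-\varphi_b(m)$. For a sequence $(x_n)_{n\ge0}$ in $[0,1)^s$, the local discrepancy of its first $N$ elements is $D_N(t)=\frac{1}{N}\sum_{n=0}^{N-1}\mathbf{1}_{[\mathbf{0},\mathbf{t})}(x_n)-\prod_{i=1}^s t_i$ for $\mathbf{t}\in[0,1]^s$, where $[\mathbf 0,\mathbf t)=[0,t_1)\times\cdots\times[0,t_s)$; $\log$ is the natural logarithm and $(\log N)^{1/q}=1$ when $q=\infty$. Besov space of dominating mixed smoothness: fix $\phi_0$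 in the Schwartz space $\mathcal{S}(\mathbb{R})$ with $\phi_0(t)=1$ for $|t|\leq1$ and $\phi_0(t)=0$ for $|t|>3/2$; set $\phi_d(t)=\phi_0(2^{-d}t)-\phi_0(2^{-d+1}t)$ for $d\in\mathbb{N}$ and $\phi_{\mathbf d}(\mathbf t)=\prod_{i=1}^s\phi_{d_i}(t_i)$ for $\mathbf d\in\mathbb{N}_0^s$. For $0<p,q\leq\infty$, $r\in\mathbb{R}$, $S_{p,q}^rB(\mathbb{R}^s)$ is the set of tempered distributions $f$ with finite quasi-norm $\left(\sum_{\mathbf d\in\mathbb{N}_0^s}2^{r(d_1+\dots+d_s)q}\|\mathcal{F}^{-1}(\phi_{\mathbf d}\mathcal{F}f)\mid L_p(\mathbb{R}^s)\|^q\right)^{1/q}$ (with the supremum if $q=\infty$), $\mathcal F$ the Fourier transform. $S_{p,q}^rB([0,1)^s)$ consists of distributions $f$ on the interior of $[0,1)^s$ with finite quasi-norm $\|f\mid S_{p,q}^rB([0,1)^s)\|=\inf\{\|g\mid S_{p,q}^rB(\mathbb{R}^s)\|: g\in S_{p,q}^rB(\mathbb{R}^s),\ g|_{[0,1)^s}=f\}$. *)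

theory Defs
  imports "HOL-Analysis.Analysis" "HOL-Probability.Essential_Supremum"
begin

subsection \<open>Schwartz functions and test functions\<close>

definition nth_deriv :: "nat \<Rightarrow> (real \<Rightarrow> complex) \<Rightarrow> real \<Rightarrow> complex" where
  "nth_deriv m f = ((\<lambda>g x. vector_derivative g (at x)) ^^ m) f"

definition smooth :: "(real \<Rightarrow> complex) \<Rightarrow> bool" where
  "smooth f \<longleftrightarrow> (\<forall>m x. nth_deriv m f differentiable (at x))"

definition schwartz :: "(real \<Rightarrow> complex) set" where
  "schwartz = {f. smooth f \<and> (\<forall>k m. bounded (range (\<lambda>x. x ^ k *\<^sub>R nth_deriv m f x)))}"

definition schwartz_seminorm :: "nat \<Rightarrow> nat \<Rightarrow> (real \<Rightarrow> complex) \<Rightarrow> real" where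
  "schwartz_seminorm k m f = (SUP x. norm (x ^ k *\<^sub>R nth_deriv m f x))"

text \<open>Smooth functions with compact support contained in the open set \<open>U\<close>, extended by
  zero to the whole line.\<close>

definition test_fun :: "real set \<Rightarrow> (real \<Rightarrow> complex) set" where
  "test_fun U = {f. smooth f \<and> compact (closure {x. f x \<noteq> 0}) \<and> closure {x. f x \<noteq> 0} \<subseteq> U}"


subsection \<open>Tempered distributions\<close>

text \<open>Distributions are represented by functionals on all functions of type
  \<open>real \<Rightarrow> complex\<close>. Only the values on Schwartz functions (for tempered distributions) or
  on test functions (for distributions on an open set) carry meaning; the other values are
  arbitrary and are never used.\<close>

type_synonym distr = "(real \<Rightarrow> complex) \<Rightarrow> complex"

text \<open>The last conjunct is continuity with respect to the Frechet topology generated by the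
  seminorms.\<close>

definition tempered :: "distr \<Rightarrow> bool" where
  "tempered T \<longleftrightarrow>
     (\<forall>f\<in>schwartz. \<forall>g\<in>schwartz. T (\<lambda>x. f x + g x) = T f + T g) \<and>
     (\<forall>c. \<forall>f\<in>schwartz. T (\<lambda>x. c * f x) = c * T f) \<and>
     (\<exists>C n. \<forall>f\<in>schwartz. norm (T f) \<le> C * (\<Sum>k\<le>n. \<Sum>m\<le>n. schwartz_seminorm k m f))"

definition fourier :: "(real \<Rightarrow> complex) \<Rightarrow> real \<Rightarrow> complex" where
  "fourier f \<xi> = complex_of_real (1 / sqrt (2 * pi)) *
     (LINT x|lborel. exp (- (\<i> * complex_of_real (x * \<xi>))) * f x)"

definition inv_fourier :: "(real \<Rightarrow> complex) \<Rightarrow> real \<Rightarrow> complex" where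
  "inv_fourier f x = complex_of_real (1 / sqrt (2 * pi)) *
     (LINT \<xi>|lborel. exp (\<i> * complex_of_real (x * \<xi>)) * f \<xi>)"

definition fourier_distr :: "distr \<Rightarrow> distr" where
  "fourier_distr T = (\<lambda>f. T (fourier f))"

definition inv_fourier_distr :: "distr \<Rightarrow> distr" where
  "inv_fourier_distr T = (\<lambda>f. T (inv_fourier f))"

definition mult_distr :: "(real \<Rightarrow> complex) \<Rightarrow> distr \<Rightarrow> distr" where
  "mult_distr h T = (\<lambda>f. T (\<lambda>x. h x * f x))"


subsection \<open>Lebesgue quasi-norms\<close>

text \<open>Powers with positive real exponent on the extended nonnegative reals.\<close>

definition ennpowr :: "ennreal \<Rightarrow> real \<Rightarrow> ennreal" where
  "ennpowr x a = (if x = \<infinity> then \<infinity> else ennreal (enn2real x powr a))"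

definition Lp_norm :: "ereal \<Rightarrow> (real \<Rightarrow> complex) \<Rightarrow> ennreal" where
  "Lp_norm p g =
     (if p = \<infinity> then esssup lborel (\<lambda>x. ennreal (cmod (g x)))
      else ennpowr (\<integral>\<^sup>+x. ennreal (cmod (g x) powr real_of_ereal p) \<partial>lborel)
             (1 / real_of_ereal p))"

text \<open>The quasi-norm of a tempered distribution is that of the function representing it. This
  function is unique up to null sets, so the infimum ranges over at most one value; it is
  \<open>\<infinity>\<close> if there is no representing function.\<close>

definition Lp_norm_distr :: "ereal \<Rightarrow> distr \<Rightarrow> ennreal" where
  "Lp_norm_distr p T = Inf {Lp_norm p g | g. g \<in> borel_measurable lborel \<and>
     (\<forall>f\<in>schwartz. integrable lborel (\<lambda>x. g x * f x) \<and> T f = (LINT x|lborel. g x * f x))}"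


subsection \<open>Besov spaces of dominating mixed smoothness in dimension one\<close>

definition resolution_generator :: "(real \<Rightarrow> complex) \<Rightarrow> bool" where
  "resolution_generator \<phi>0 \<longleftrightarrow> \<phi>0 \<in> schwartz \<and>
     (\<forall>t. \<bar>t\<bar> \<le> 1 \<longrightarrow> \<phi>0 t = 1) \<and> (\<forall>t. \<bar>t\<bar> > 3/2 \<longrightarrow> \<phi>0 t = 0)"

definition resolution :: "(real \<Rightarrow> complex) \<Rightarrow> nat \<Rightarrow> real \<Rightarrow> complex" where
  "resolution \<phi>0 d t =
     (if d = 0 then \<phi>0 t
      else \<phi>0 (2 powr (- real d) * t) - \<phi>0 (2 powr (- real d + 1) * t))"

definition besov_norm ::
    "(real \<Rightarrow> complex) \<Rightarrow> ereal \<Rightarrow> ereal \<Rightarrow> real \<Rightarrow> distr \<Rightarrow> ennreal" where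
  "besov_norm \<phi>0 p q r T =
     (let L = (\<lambda>d. Lp_norm_distr p
                 (inv_fourier_distr (mult_distr (resolution \<phi>0 d) (fourier_distr T)))) in
      if q = \<infinity> then (SUP d. ennreal (2 powr (r * real d)) * L d)
      else ennpowr (\<Sum>d. ennreal (2 powr (r * real d * real_of_ereal q)) *
                          ennpowr (L d) (real_of_ereal q))
             (1 / real_of_ereal q))"

definition besov_space ::
    "(real \<Rightarrow> complex) \<Rightarrow> ereal \<Rightarrow> ereal \<Rightarrow> real \<Rightarrow> distr set" where
  "besov_space \<phi>0 p q r = {T. tempered T \<and> besov_norm \<phi>0 p q r T < \<infinity>}"

text \<open>Quasi-norm on the unit interval of a distribution on its interior; it is \<open>\<infinity>\<close> exactly
  when there is no extension in the Besov space on the line.\<close>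

definition besov_norm_unit ::
    "(real \<Rightarrow> complex) \<Rightarrow> ereal \<Rightarrow> ereal \<Rightarrow> real \<Rightarrow> distr \<Rightarrow> ennreal" where
  "besov_norm_unit \<phi>0 p q r f =
     Inf {besov_norm \<phi>0 p q r g | g.
            g \<in> besov_space \<phi>0 p q r \<and> (\<forall>\<psi>\<in>test_fun {0<..<1}. g \<psi> = f \<psi>)}"

text \<open>The regular distribution on the open unit interval induced by a function.\<close>

definition distr_unit :: "(real \<Rightarrow> real) \<Rightarrow> distr" where
  "distr_unit h = (\<lambda>\<psi>. LINT t:{0<..<1}|lborel. complex_of_real (h t) * \<psi> t)"


subsection \<open>The symmetrized van der Corput sequence and its local discrepancy\<close>

definition radical_inverse :: "nat \<Rightarrow> nat \<Rightarrow> real" where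
  "radical_inverse b n = (\<Sum>i | b ^ i \<le> n. real (n div b ^ i mod b) / real b ^ (i + 1))"

definition sym_van_der_Corput :: "nat \<Rightarrow> nat \<Rightarrow> real" where
  "sym_van_der_Corput b n =
     (if even n then radical_inverse b (n div 2) else 1 - radical_inverse b (n div 2))"

text \<open>The first odd-indexed term of the symmetrized sequence is 1, which lies in none of the
  half-open intervals counted below.\<close>

definition local_discrepancy :: "nat \<Rightarrow> (nat \<Rightarrow> real) \<Rightarrow> real \<Rightarrow> real" where
  "local_discrepancy N x t = (1 / real N) * (\<Sum>n<N. indicator {0..<t} (x n)) - t"

end

theory Submission
  imports Defs "HOL-Probability.Sinc_Integral"
begin

text \<open>
  Since \<open>r < 1/p\<close>, the local discrepancy may be extended by zero to the whole line. Its
  Littlewood-Paley pieces are convolutions with kernels \<open>K\<^sub>d\<close> that live at scale \<open>2\<^sup>-\<^sup>d\<close>; for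
  \<open>d \<ge> 1\<close> such a kernel is a difference of two dilates of \<open>K\<^sub>0\<close> and hence has mean zero.

  The digits of \<open>N div 2\<close> in base \<open>b\<close> split the symmetrized sequence into at most \<open>b - 1\<close> blocks of
  \<open>b\<^sup>j\<close> points and their reflections for each \<open>j\<close>. Each block consists of two shifted grids of mesh
  \<open>b\<^sup>-\<^sup>j\<close>, the shifts being symmetric to each other, so its unnormalized discrepancy is bounded and
  has a primitive of size \<open>b\<^sup>-\<^sup>j\<close> that vanishes at both ends of the unit interval. Moving the derivative to
  the kernel gives \<open>L\<^sub>p\<close> norm \<open>O(2\<^sup>d b\<^sup>-\<^sup>j)\<close> for the convolution of a block with \<open>K\<^sub>d\<close>. On the other
  hand the mean-zero property gives an \<open>L\<^sub>1\<close> norm \<open>O(b\<^sup>j 2\<^sup>-\<^sup>d)\<close>, and interpolation with the sup norm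
  yields \<open>O((b\<^sup>j 2\<^sup>-\<^sup>d)\<^bsup>1/p\<^esup>)\<close>. Summing the better bound over \<open>j\<close>, the \<open>d\<close>-th piece of the discrepancy is
  \<open>O(N\<^sup>-\<^sup>1 min 1 ((N 2\<^sup>-\<^sup>d)\<^bsup>1/p\<^esup>))\<close>, and the Besov norm is a weighted sum of these over \<open>d\<close>.
\<close>

subsection \<open>The radical inverse on blocks of indices\<close>

text \<open>Symmetrization matters at low frequencies. The primitive of the discrepancy of a single
  point \<open>a\<close>, started at 0, reaches the height \<open>1/2 - a\<close> at 1, and
  integration by parts leaves this height as a boundary term. Over one grid
  \<open>(k + \<sigma>) / n\<close> with \<open>k < n\<close> the heights add up to
  \<open>1/2 - \<sigma>\<close>, which is of order one however fine the mesh, so every digit could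
  contribute that much. A point and its mirror image have opposite heights, so the terms cancel in
  pairs. The final rates come from the weights \<open>2^(r d)\<close>. For \<open>r = 0\<close> each
  of the roughly \<open>log N\<close> levels with \<open>2^d <= N\<close> contributes the same
  amount \<open>1/N\<close>, and their l_q sum yields \<open>(log N)^(1/q)\<close>. For
  \<open>r > 0\<close> the weights grow geometrically and the level \<open>2^d ~ N\<close>
  dominates. Above that level the terms behave like \<open>2^(d (r - 1/p))\<close>, and
  \<open>r < 1/p\<close> makes them summable. Of the kernel \<open>K_0\<close> only three integrals
  have to be finite: those of \<open>|K_0|\<close>, \<open>|z K_0|\<close> and
  \<open>|K_0'|\<close>. All other levels follow by dilation.\<close>

lemma sum_lessThan_mult:
  fixes f :: "nat \<Rightarrow> 'a::comm_monoid_add"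
  shows "(\<Sum>i<k*m. f i) = (\<Sum>i<k. \<Sum>c<m. f (i * m + c))"
proof -
  have "(\<Sum>c<m. f (i * m + c)) = sum f {i * m..<i * m + m}" for i
    using sum.shift_bounds_nat_ivl[of f 0 "i*m" m] by (simp add: atLeast0LessThan add.commute)
  then show ?thesis
    by (simp add: sum.nat_group)
qed

text \<open>Positions above the leading digit contribute zero, so any sufficient number
  \<open>m\<close> of digits may be summed. This puts \<open>n\<close> and \<open>n div b\<close> on
  index ranges that differ by a shift.\<close>

lemma radical_inverse_eq_sum:
  assumes "b \<ge> 2" "n < b ^ m"
  shows "radical_inverse b n = (\<Sum>i<m. real (n div b ^ i mod b) / real b ^ (i + 1))"
  unfolding radical_inverse_def
proof (rule sum.mono_neutral_left)
  show "{i. b ^ i \<le> n} \<subseteq> {..<m}"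
  proof safe
    fix i assume "b ^ i \<le> n"
    then have "b ^ i < b ^ m" using assms by linarith
    then show "i < m" using assms by (simp add: power_strict_increasing_iff)
  qed
qed auto

text \<open>The last digit of \<open>n\<close> is the first one after the radix point of the radical
  inverse; the remaining digits move one place further.\<close>

lemma radical_inverse_rec:
  assumes b: "b \<ge> 2"
  shows "radical_inverse b n = (real (n mod b) + radical_inverse b (n div b)) / real b"
proof -
  have n: "n < b ^ n" using b by (intro less_exp[THEN order.strict_trans2] power_mono) auto
  then have 1: "n < b ^ Suc n" using b by (simp add: less_le_trans)
  have "n div b \<le> n" by simp
  then have 2: "n div b < b ^ n" using n by linarith
  show ?thesis
    unfolding radical_inverse_eq_sum[OF b 1] radical_inverse_eq_sum[OF b 2]
    by (simp add: sum.lessThan_Suc_shift div_mult2_eq add_divide_distrib sum_divide_distrib mult.commute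
        del: sum.lessThan_Suc)
qed

lemma radical_inverse_bounds:
  assumes b: "b \<ge> 2"
  shows "0 \<le> radical_inverse b n \<and> radical_inverse b n < 1"
proof (induction n rule: less_induct)
  case (less n)
  show ?case
  proof (cases "n = 0")
    case True
    have "{i. b ^ i \<le> 0} = {}" using b by auto
    then show ?thesis using True by (simp add: radical_inverse_def)
  next
    case False
    then have "n div b < n" using b by simp
    from less[OF this] have IH: "0 \<le> radical_inverse b (n div b)" "radical_inverse b (n div b) < 1" by auto
    have "n mod b < b" using b by simp
    then have "real (n mod b) + 1 \<le> real b" by linarith
    with IH b show ?thesis
      by (simp add: radical_inverse_rec[OF b, of n])
  qed
qed

text \<open>The last \<open>j\<close> digits of the index take all values while \<open>a\<close> is
  frozen. Mirrored at the radix point they become the leading \<open>j\<close> digits and produce a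
  full grid of mesh \<open>1 / b ^ j\<close>; the digits of \<open>a\<close> follow behind and
  merely shift it.\<close>

lemma sum_radical_inverse_block:
  fixes f :: "real \<Rightarrow> 'a::comm_monoid_add"
  assumes b: "b \<ge> 2"
  shows "(\<Sum>i<b ^ j. f (radical_inverse b (a * b ^ j + i))) =
         (\<Sum>k<b ^ j. f ((real k + radical_inverse b a) / real (b ^ j)))"
proof (induction j arbitrary: f)
  case 0
  then show ?case by simp
next
  case (Suc j)
  have "(\<Sum>i<b ^ Suc j. f (radical_inverse b (a * b ^ Suc j + i))) =
        (\<Sum>i<b ^ j. \<Sum>c<b. f (radical_inverse b (a * b ^ Suc j + (i * b + c))))"
    using sum_lessThan_mult[of "\<lambda>i. f (radical_inverse b (a * b ^ Suc j + i))" "b^j" b]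
    by (simp add: mult.commute)
  also have "\<dots> = (\<Sum>i<b ^ j. \<Sum>c<b. f ((real c + radical_inverse b (a * b ^ j + i)) / b))"
  proof (intro sum.cong refl arg_cong[where f = f])
    fix i c assume "c \<in> {..<b}"
    then have c: "c < b" by simp
    have e: "a * b ^ Suc j + (i * b + c) = c + b * (a * b ^ j + i)" by (simp add: algebra_simps)
    have "(a * b ^ Suc j + (i * b + c)) mod b = c"
      unfolding e mod_mult_self2 using c by simp
    moreover have "(a * b ^ Suc j + (i * b + c)) div b = a * b ^ j + i"
      unfolding e using c by simp
    ultimately show "radical_inverse b (a * b ^ Suc j + (i * b + c)) =
        (real c + radical_inverse b (a * b ^ j + i)) / b"
      using radical_inverse_rec[OF b] by metis
  qed
  \<comment> \<open>The induction hypothesis is applied to the function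
    \<open>\<lambda>u. \<Sum>c<b. f ((c + u) / b)\<close>, which is why \<open>f\<close> is
    arbitrary in the induction.\<close>
  also have "\<dots> = (\<Sum>k<b ^ j. \<Sum>c<b. f ((real c + (real k + radical_inverse b a) / real (b ^ j)) / b))"
    by (rule Suc.IH)
  also have "\<dots> = (\<Sum>c<b. \<Sum>k<b ^ j. f ((real (c * b ^ j + k) + radical_inverse b a) / real (b ^ Suc j)))"
  proof (subst sum.swap, intro sum.cong refl arg_cong[where f = f])
    fix c k
    show "(real c + (real k + radical_inverse b a) / real (b ^ j)) / b =
        (real (c * b ^ j + k) + radical_inverse b a) / real (b ^ Suc j)"
      using b by (simp add: field_simps)
  qed
  also have "\<dots> = (\<Sum>k<b ^ Suc j. f ((real k + radical_inverse b a) / real (b ^ Suc j)))"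
    using sum_lessThan_mult[of "\<lambda>k. f ((real k + radical_inverse b a) / real (b ^ Suc j))" b "b^j"]
    by simp
  finally show ?case .
qed

lemma sum_lessThan_add:
  fixes f :: "nat \<Rightarrow> 'a::comm_monoid_add"
  shows "(\<Sum>i<m+k. f i) = (\<Sum>i<m. f i) + (\<Sum>i<k. f (m + i))"
  by (induction k) (simp_all add: add.assoc)

text \<open>The range is cut from its upper end: digit \<open>j\<close> of \<open>M\<close> supplies
  that many consecutive intervals of length \<open>b ^ j\<close>, each starting at a multiple of
  \<open>b ^ j\<close>. What remains is \<open>M\<close> with its last \<open>J\<close> digits
  replaced by zeros, hence nothing once \<open>J\<close> exceeds the number of digits.\<close>

lemma sum_digit_blocks:
  fixes f :: "nat \<Rightarrow> 'a::comm_monoid_add"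
  shows "(\<Sum>m<M. f m) =
    (\<Sum>j<J. \<Sum>c<M div b ^ j mod b. \<Sum>i<b ^ j. f ((M div b ^ Suc j * b + c) * b ^ j + i))
    + (\<Sum>m<M div b ^ J * b ^ J. f m)"
proof (induction J)
  case 0
  then show ?case by simp
next
  case (Suc J)
  define Q where "Q = M div b ^ J"
  have Q: "M div b ^ Suc J = Q div b" by (simp add: Q_def div_mult2_eq power_Suc2 del: power_Suc)
  have "(\<Sum>m<Q * b ^ J. f m) = (\<Sum>c<Q. \<Sum>i<b ^ J. f (c * b ^ J + i))"
    by (rule sum_lessThan_mult)
  also have "\<dots> = (\<Sum>c<Q div b * b + Q mod b. \<Sum>i<b ^ J. f (c * b ^ J + i))" by simp
  also have "\<dots> = (\<Sum>c<Q div b * b. \<Sum>i<b ^ J. f (c * b ^ J + i)) +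
      (\<Sum>c<Q mod b. \<Sum>i<b ^ J. f ((Q div b * b + c) * b ^ J + i))"
    by (rule sum_lessThan_add)
  also have "(\<Sum>c<Q div b * b. \<Sum>i<b ^ J. f (c * b ^ J + i)) = (\<Sum>m<Q div b * b ^ Suc J. f m)"
    using sum_lessThan_mult[of f "Q div b * b" "b ^ J"] by (simp add: mult.assoc)
  finally have *: "(\<Sum>m<Q * b ^ J. f m) = (\<Sum>m<Q div b * b ^ Suc J. f m) +
      (\<Sum>c<Q mod b. \<Sum>i<b ^ J. f ((Q div b * b + c) * b ^ J + i))" .
  show ?case
    using Suc * unfolding sum.lessThan_Suc Q Q_def[symmetric] by (simp add: ac_simps)
qed

section \<open>Counting and ramp errors of two grids with complementary shifts\<close>

lemma grid_split:
  fixes n :: nat and y :: real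
  assumes n: "n > 0" and y: "0 < y" "y \<le> 1"
  obtains m where "m < n" "real m < n * y" "n * y \<le> real m + 1"
proof
  \<comment> \<open>The cell of \<open>y\<close> is open on the left and closed on the right, which
    fits the strict comparison with \<open>y\<close> in the counting function.\<close>
  let ?m = "nat (\<lceil>n * y\<rceil> - 1)"
  have pos: "0 < n * y" using n y by simp
  then have "1 \<le> \<lceil>n * y\<rceil>" by linarith
  then have m: "real ?m = of_int \<lceil>n * y\<rceil> - 1" by simp
  show "real ?m < n * y" "n * y \<le> real ?m + 1" unfolding m by linarith+
  have "n * y \<le> n" using n y by (simp add: mult_left_le)
  then show "?m < n" using \<open>real ?m < n * y\<close> by linarith
qed

lemma sum_split_at:
  fixes f :: "nat \<Rightarrow> real"
  assumes "m < n" "\<And>k. m < k \<Longrightarrow> f k = 0"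
  shows "(\<Sum>k<n. f k) = (\<Sum>k<m. f k) + f m"
proof -
  have "(\<Sum>k<n. f k) = (\<Sum>k<Suc m. f k)"
    by (rule sum.mono_neutral_right) (use assms in auto)
  then show ?thesis by simp
qed

text \<open>Each full cell to the left of \<open>y\<close> contains one point of either grid, as
  expected. Only the cell of \<open>y\<close> is uncertain: it has between 0 and 2 points below
  \<open>y\<close>, against an expected number that also lies between 0 and 2.\<close>

lemma grid_count_bound:
  fixes n :: nat and \<sigma> y :: real
  assumes n: "n > 0" and s: "0 \<le> \<sigma>" "\<sigma> \<le> 1" and y: "0 < y" "y \<le> 1"
  shows "\<bar>\<Sum>k<n. (of_bool ((real k + \<sigma>) / n < y) + of_bool ((real k + (1 - \<sigma>)) / n < y) - 2 * y)\<bar> \<le> 2"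
proof -
  obtain m where m: "m < n" "real m < n * y" "n * y \<le> real m + 1"
    using grid_split[OF n y] .
  define f :: "nat \<Rightarrow> real" where
    "f k = of_bool ((real k + \<sigma>) / n < y) + of_bool ((real k + (1 - \<sigma>)) / n < y)" for k
  have le: "(x / n < y) = (x < n * y)" for x using n by (simp add: field_simps)
  have "f k = 0" if "m < k" for k
  proof -
    have "real m + 1 \<le> real k" using that by linarith
    then show ?thesis using m s unfolding f_def le by (simp add: not_less)
  qed
  then have "(\<Sum>k<n. f k) = (\<Sum>k<m. f k) + f m" using m(1) by (intro sum_split_at)
  also have "(\<Sum>k<m. f k) = (\<Sum>k<m. 2)"
  proof (intro sum.cong refl)
    fix k assume "k \<in> {..<m}"
    then have "real k + 1 \<le> real m" by simp
    then have "real k + \<sigma> < n * y" "real k + (1 - \<sigma>) < n * y" using m s by linarith+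
    then show "f k = 2" unfolding f_def le by simp
  qed
  finally have "(\<Sum>k<n. f k) = 2 * real m + f m" by simp
  moreover have "0 \<le> f m" "f m \<le> 2" by (simp_all add: f_def)
  ultimately have "\<bar>(\<Sum>k<n. f k) - 2 * (n * y)\<bar> \<le> 2" using m by linarith
  then show ?thesis by (simp add: f_def sum_subtractf mult.commute mult.left_commute)
qed

text \<open>A ramp \<open>max 0 (y - a)\<close> is the primitive of the counting function of
  \<open>a\<close>, so this is the primitive of the preceding error. In the scale
  \<open>Y = n * y\<close> the two ramps of a full cell add up to \<open>2 * Y - 1 - 2 * k\<close>:
  the shifts sum to 1 and \<open>\<sigma>\<close> drops out. A single shift \<open>\<sigma>\<close>
  would instead leave a term \<open>m * (1/2 - \<sigma>)\<close>.\<close>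

lemma grid_ramp_bound:
  fixes n :: nat and \<sigma> y :: real
  assumes n: "n > 0" and s: "0 \<le> \<sigma>" "\<sigma> \<le> 1" and y: "0 \<le> y" "y \<le> 1"
  shows "\<bar>\<Sum>k<n. (max 0 (y - (real k + \<sigma>) / n) + max 0 (y - (real k + (1 - \<sigma>)) / n) - y\<^sup>2)\<bar> \<le> 2 / n"
proof (cases "y = 0")
  case True
  then have "(\<Sum>k<n. (max 0 (y - (real k + \<sigma>) / n) + max 0 (y - (real k + (1 - \<sigma>)) / n) - y\<^sup>2)) = (\<Sum>k<n. 0)"
    using s by (intro sum.cong refl) (simp add: max_absorb1)
  then show ?thesis by simp
next
  case False
  then obtain m where m: "m < n" "real m < n * y" "n * y \<le> real m + 1"
    using grid_split[OF n, of y] y by auto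
  define Y where "Y = n * y"
  define f :: "nat \<Rightarrow> real" where
    "f k = max 0 (Y - (real k + \<sigma>)) + max 0 (Y - (real k + (1 - \<sigma>)))" for k
  have mx: "n * max 0 (y - x / n) = max 0 (Y - x)" for x
    using n by (auto simp: max_def Y_def field_simps)
  have "f k = 0" if "m < k" for k
  proof -
    have "real m + 1 \<le> real k" using that by linarith
    then show ?thesis using m s unfolding f_def Y_def by (simp add: max_def)
  qed
  then have "(\<Sum>k<n. f k) = (\<Sum>k<m. f k) + f m" using m(1) by (intro sum_split_at)
  also have "(\<Sum>k<m. f k) = (\<Sum>k<m. (2 * Y - 1) - 2 * real k)"
  proof (intro sum.cong refl)
    fix k assume "k \<in> {..<m}"
    then have "real k + 1 \<le> real m" by simp
    then have "real k + \<sigma> < Y" "real k + (1 - \<sigma>) < Y" using m s unfolding Y_def by linarith+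
    then show "f k = (2 * Y - 1) - 2 * real k" unfolding f_def by simp
  qed
  \<comment> \<open>The first \<open>m\<close> odd numbers add up to the square of \<open>m\<close>;
    subtracting the square of \<open>Y\<close> then completes the square.\<close>
  also have "\<dots> = 2 * Y * m - (real m)\<^sup>2"
    by (induction m) (simp_all add: algebra_simps power2_eq_square)
  finally have sm: "(\<Sum>k<n. f k) - Y\<^sup>2 = f m - (Y - m)\<^sup>2"
    by (simp add: power2_eq_square algebra_simps)
  have "0 \<le> Y - m" "Y - m \<le> 1" using m by (simp_all add: Y_def)
  then have "0 \<le> (Y - m)\<^sup>2" "(Y - m)\<^sup>2 \<le> 1" by (simp_all add: power_le_one)
  moreover have "0 \<le> f m" "f m \<le> 2"
    using \<open>0 \<le> Y - m\<close> \<open>Y - m \<le> 1\<close> s unfolding f_def by (simp_all add: max_def)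
  ultimately have "\<bar>(\<Sum>k<n. f k) - Y\<^sup>2\<bar> \<le> 2" unfolding sm by linarith
  moreover have "(\<Sum>k<n. f k) - Y\<^sup>2 =
      n * (\<Sum>k<n. (max 0 (y - (real k + \<sigma>) / n) + max 0 (y - (real k + (1 - \<sigma>)) / n) - y\<^sup>2))"
    unfolding f_def mx[symmetric]
    by (simp add: sum_subtractf sum.distrib sum_distrib_left Y_def power2_eq_square algebra_simps)
  ultimately show ?thesis using n by (simp add: abs_mult field_simps)
qed

subsection \<open>Bounds for \<open>L\<^sub>p\<close> norms\<close>

text \<open>The bound \<open>||u||_p <= A\<close> is stated for p-th powers and includes
  measurability, so that sums and multiples can be estimated without taking roots of extended
  numbers.\<close>

definition Lp_le :: "real \<Rightarrow> (real \<Rightarrow> complex) \<Rightarrow> real \<Rightarrow> bool" where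
  "Lp_le p u A \<longleftrightarrow> u \<in> borel_measurable borel \<and>
     (\<integral>\<^sup>+x. ennreal (cmod (u x) powr p) \<partial>lborel) \<le> ennreal (A powr p)"

text \<open>Convexity of the p-th power: \<open>(x + y) / (A + B)\<close> is the mean of
  \<open>x / A\<close> and \<open>y / B\<close> with weights \<open>A / (A + B)\<close> and
  \<open>B / (A + B)\<close>. The weights are chosen so that integration gives the triangle
  inequality directly.\<close>

lemma powr_add_le_weighted:
  fixes x y A B p :: real
  assumes p: "p \<ge> 1" and AB: "A > 0" "B > 0" and xy: "x \<ge> 0" "y \<ge> 0"
  shows "(x + y) powr p \<le> (A + B) powr (p - 1) * (A powr (1 - p) * x powr p + B powr (1 - p) * y powr p)"
proof -
  \<comment> \<open>A vanishing summand is treated by hand; convexity is applied to positive numbers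
    only.\<close>
  have edge: "z powr p \<le> (A' + B') powr (p - 1) * (B' powr (1 - p) * z powr p)"
    if "A' > 0" "B' > 0" for A' B' z :: real
  proof -
    have "1 = B' powr (p - 1) * B' powr (1 - p)"
      using that by (simp add: powr_add[symmetric])
    also have "\<dots> \<le> (A' + B') powr (p - 1) * B' powr (1 - p)"
      using that p by (intro mult_right_mono powr_mono2) auto
    finally show ?thesis
      by (metis mult.assoc mult_right_mono mult_1 powr_ge_zero)
  qed
  consider "x = 0" | "y = 0" | "x > 0" "y > 0" using xy by linarith
  then show ?thesis
  proof cases
    case 1
    then show ?thesis using edge[of A B y] AB p by simp
  next
    case 2
    then show ?thesis using edge[of B A x] AB p by (simp add: add.commute)
  next
    case 3
    define t where "t = B / (A + B)"
    have t: "0 \<le> t" "t \<le> 1" "1 - t = A / (A + B)" using AB by (simp_all add: t_def field_simps)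
    have e: "(1 - t) * (x / A) + t * (y / B) = (x + y) / (A + B)"
      using AB unfolding t(3) by (simp add: t_def add_divide_distrib)
    have "((x + y) / (A + B)) powr p \<le> (1 - t) * (x / A) powr p + t * (y / B) powr p"
      using convex_onD[OF powr_convex[OF p] t(1,2), of "x / A" "y / B"] 3 AB
      unfolding real_scaleR_def e by simp
    then have "(x + y) powr p \<le> (A + B) powr p * ((A / (A + B)) * (x powr p / A powr p) + (B / (A + B)) * (y powr p / B powr p))"
      using 3 AB unfolding t(3) unfolding t_def
      by (simp only: powr_divide pos_divide_le_eq powr_gt_zero) (simp add: powr_divide pos_divide_le_eq mult.commute)
    also have "\<dots> = (A + B) powr (p - 1) * (A powr (1 - p) * x powr p + B powr (1 - p) * y powr p)"
    proof -
      have 1: "(A + B) powr p = (A + B) powr (p - 1) * (A + B)"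
        and 2: "A powr (1 - p) = A / A powr p" "B powr (1 - p) = B / B powr p"
        using AB by (simp_all add: powr_diff)
      have "c * (A + B) * ((A / (A + B)) * X + (B / (A + B)) * Y) = c * (A * X + B * Y)" for c X Y
        using AB by (simp add: field_simps add_pos_pos add_nonneg_eq_0_iff)
      from this[of "(A + B) powr (p - 1)" "x powr p / A powr p" "y powr p / B powr p"]
      show ?thesis unfolding 1 2 by (simp only: times_divide_eq_left times_divide_eq_right)
    qed
    finally show ?thesis .
  qed
qed

text \<open>Minkowski's inequality, by integrating the weighted pointwise bound:
  \<open>A^(1-p) * A^p + B^(1-p) * B^p = A + B\<close>.\<close>

lemma Lp_le_add:
  assumes p: "p \<ge> 1" and AB: "A > 0" "B > 0" and u: "Lp_le p u A" and v: "Lp_le p v B"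
  shows "Lp_le p (\<lambda>x. u x + v x) (A + B)"
proof -
  have [measurable]: "u \<in> borel_measurable borel" "v \<in> borel_measurable borel"
    using u v by (auto simp: Lp_le_def)
  define c where "c = (A + B) powr (p - 1)"
  have "(\<integral>\<^sup>+x. ennreal (cmod (u x + v x) powr p) \<partial>lborel) \<le>
    (\<integral>\<^sup>+x. ennreal c * (ennreal (A powr (1 - p)) * ennreal (cmod (u x) powr p) +
      ennreal (B powr (1 - p)) * ennreal (cmod (v x) powr p)) \<partial>lborel)"
  proof (intro nn_integral_mono)
    fix x
    have "cmod (u x + v x) powr p \<le> (cmod (u x) + cmod (v x)) powr p"
      using p by (intro powr_mono2 norm_triangle_ineq) auto
    also have "\<dots> \<le> c * (A powr (1 - p) * cmod (u x) powr p + B powr (1 - p) * cmod (v x) powr p)"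
      unfolding c_def by (rule powr_add_le_weighted) (use p AB in auto)
    finally show "ennreal (cmod (u x + v x) powr p) \<le> ennreal c * (ennreal (A powr (1 - p)) * ennreal (cmod (u x) powr p) +
      ennreal (B powr (1 - p)) * ennreal (cmod (v x) powr p))"
      by (simp add: ennreal_mult[symmetric] ennreal_plus[symmetric] c_def ennreal_leI del: ennreal_plus)
  qed
  also have "\<dots> = ennreal c * (ennreal (A powr (1 - p)) * (\<integral>\<^sup>+x. ennreal (cmod (u x) powr p) \<partial>lborel) +
      ennreal (B powr (1 - p)) * (\<integral>\<^sup>+x. ennreal (cmod (v x) powr p) \<partial>lborel))"
    by (simp add: nn_integral_cmult nn_integral_add)
  also have "\<dots> \<le> ennreal c * (ennreal (A powr (1 - p)) * ennreal (A powr p) + ennreal (B powr (1 - p)) * ennreal (B powr p))"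
    using u v by (intro mult_left_mono add_mono) (auto simp: Lp_le_def)
  also have "\<dots> = ennreal (c * (A + B))"
    using AB by (simp add: ennreal_mult[symmetric] powr_add[symmetric] ennreal_plus[symmetric] c_def del: ennreal_plus)
  also have "c * (A + B) = (A + B) powr p"
    using AB by (simp add: c_def powr_diff)
  finally show ?thesis by (simp add: Lp_le_def)
qed

lemma Lp_le_sum:
  assumes p: "p \<ge> 1" and I: "finite I" and A: "\<And>i. i \<in> I \<Longrightarrow> A i > 0" and u: "\<And>i. i \<in> I \<Longrightarrow> Lp_le p (u i) (A i)"
  shows "Lp_le p (\<lambda>x. \<Sum>i\<in>I. u i x) (\<Sum>i\<in>I. A i)"
  using I A u
proof (induction I rule: finite_induct)
  case empty
  then show ?case by (simp add: Lp_le_def)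
next
  case (insert i F)
  show ?case
  \<comment> \<open>The empty sum has bound 0, whereas \<open>Lp_le_add\<close> requires positive
    bounds.\<close>
  proof (cases "F = {}")
    case True
    then show ?thesis using insert.prems(2)[of i] by (simp add: Lp_le_def)
  next
    case False
    then have "(\<Sum>i\<in>F. A i) > 0" using insert by (intro sum_pos) auto
    moreover have "Lp_le p (\<lambda>x. \<Sum>i\<in>F. u i x) (\<Sum>i\<in>F. A i)" using insert by simp
    ultimately have "Lp_le p (\<lambda>x. u i x + (\<Sum>i\<in>F. u i x)) (A i + (\<Sum>i\<in>F. A i))"
      using insert.prems by (intro Lp_le_add p) auto
    then show ?thesis using insert.hyps by simp
  qed
qed

lemma Lp_le_mono:
  assumes "Lp_le p u A" "0 \<le> A" "A \<le> B" "0 \<le> p"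
  shows "Lp_le p u B"
  using assms unfolding Lp_le_def
  by (meson ennreal_leI order_trans powr_mono2)

lemma Lp_le_cmult:
  assumes "Lp_le p u A" "0 \<le> A"
  shows "Lp_le p (\<lambda>x. c * u x) (cmod c * A)"
proof -
  have [measurable]: "u \<in> borel_measurable borel" using assms by (auto simp: Lp_le_def)
  have "(\<integral>\<^sup>+x. ennreal (cmod (c * u x) powr p) \<partial>lborel) =
        ennreal (cmod c powr p) * (\<integral>\<^sup>+x. ennreal (cmod (u x) powr p) \<partial>lborel)"
    by (simp add: norm_mult powr_mult ennreal_mult nn_integral_cmult)
  also have "\<dots> \<le> ennreal (cmod c powr p) * ennreal (A powr p)"
    using assms by (intro mult_left_mono) (auto simp: Lp_le_def)
  finally show ?thesis using assms by (simp add: Lp_le_def powr_mult ennreal_mult)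
qed

text \<open>Pointwise \<open>|u|^p <= A^(p-1) * |u|\<close>. All estimates of convolutions are
  therefore made only in the sup norm and in \<open>L_1\<close>.\<close>

lemma Lp_le_interpolate:
  assumes p: "p \<ge> 1" and u: "u \<in> borel_measurable borel" and A: "A > 0" "\<And>x. cmod (u x) \<le> A"
    and B: "B \<ge> 0" "(\<integral>\<^sup>+x. ennreal (cmod (u x)) \<partial>lborel) \<le> ennreal B"
  shows "Lp_le p u (A powr (1 - 1 / p) * B powr (1 / p))"
proof -
  note [measurable] = u
  have "(\<integral>\<^sup>+x. ennreal (cmod (u x) powr p) \<partial>lborel) \<le> (\<integral>\<^sup>+x. ennreal (A powr (p - 1)) * ennreal (cmod (u x)) \<partial>lborel)"
  proof (intro nn_integral_mono)
    fix x
    have "cmod (u x) powr p = cmod (u x) powr (p - 1) * cmod (u x)"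
      by (cases "u x = 0") (auto simp: powr_diff)
    also have "\<dots> \<le> A powr (p - 1) * cmod (u x)"
      using p A by (intro mult_right_mono powr_mono2) auto
    finally show "ennreal (cmod (u x) powr p) \<le> ennreal (A powr (p - 1)) * ennreal (cmod (u x))"
      by (simp add: ennreal_mult[symmetric] ennreal_leI)
  qed
  also have "\<dots> \<le> ennreal (A powr (p - 1)) * ennreal B"
    using B by (subst nn_integral_cmult) (auto intro!: mult_left_mono)
  also have "\<dots> = ennreal ((A powr (1 - 1 / p) * B powr (1 / p)) powr p)"
    using A B p by (simp add: ennreal_mult powr_mult powr_powr algebra_simps)
  finally show ?thesis by (simp add: Lp_le_def)
qed

lemma Lp_norm_le:
  assumes "Lp_le p u A" "0 \<le> A" "p > 0"
  shows "Lp_norm (ereal p) u \<le> ennreal A"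
proof -
  define I where "I = (\<integral>\<^sup>+x. ennreal (cmod (u x) powr p) \<partial>lborel)"
  have le: "I \<le> ennreal (A powr p)" using assms by (simp add: Lp_le_def I_def)
  then have fin: "I \<noteq> \<infinity>" by (auto simp: top_unique)
  have "enn2real I \<le> A powr p" using le by (simp add: enn2real_leI)
  then have "enn2real I powr (1 / p) \<le> (A powr p) powr (1 / p)"
    using assms by (intro powr_mono2) auto
  also have "\<dots> = A" using assms by (simp add: powr_powr)
  finally show ?thesis using fin by (simp add: Lp_norm_def ennpowr_def I_def ennreal_leI)
qed

subsection \<open>Convolution with a kernel of given scale\<close>

definition conv :: "(real \<Rightarrow> complex) \<Rightarrow> (real \<Rightarrow> real) \<Rightarrow> real \<Rightarrow> complex" where
  "conv K g x = (LINT y|lborel. complex_of_real (g y) * K (x - y))"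

text \<open>The unnormalized discrepancy caused by the single point \<open>a\<close>, set to zero
  outside the open unit interval. The point \<open>a = 1\<close> needs no special treatment, since
  \<open>a < y\<close> fails there throughout.\<close>

definition point_disc :: "real \<Rightarrow> real \<Rightarrow> real" where
  "point_disc a y = indicator {0<..<1} y * (of_bool (a < y) - y)"

lemma point_disc_measurable [measurable]: "point_disc a \<in> borel_measurable borel"
  unfolding point_disc_def by measurable

lemma point_disc_bound: "\<bar>point_disc a y\<bar> \<le> indicator {0..1} y"
  by (auto simp: point_disc_def indicator_def)

lemma nn_integral_reflect:
  fixes f :: "real \<Rightarrow> ennreal"
  assumes [measurable]: "f \<in> borel_measurable borel"
  shows "(\<integral>\<^sup>+y. f (x - y) \<partial>lborel) = (\<integral>\<^sup>+y. f y \<partial>lborel)"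
  using nn_integral_real_affine[of f "-1" x] by simp

lemma nn_integral_translate:
  fixes f :: "real \<Rightarrow> ennreal"
  assumes [measurable]: "f \<in> borel_measurable borel"
  shows "(\<integral>\<^sup>+x. f (x - y) \<partial>lborel) = (\<integral>\<^sup>+x. f x \<partial>lborel)"
  using nn_integral_real_affine[of f 1 "-y"] by simp

text \<open>The function jumps at \<open>a\<close>, 0 and 1 and has slope -1 in between. Each jump,
  of height at most 1, and the slope cost \<open>\<bar>y\<bar>\<close> apiece, which explains the
  factor 4.\<close>

lemma point_disc_translate:
  assumes a: "0 \<le> a" "a \<le> 1"
  shows "(\<integral>\<^sup>+x. ennreal \<bar>point_disc a (x - y) - point_disc a x\<bar> \<partial>lborel) \<le> ennreal (4 * \<bar>y\<bar>)"
proof -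
  \<comment> \<open>\<open>c e x\<close> marks those \<open>x\<close> for which \<open>e\<close>
    lies between \<open>x - y\<close> and \<open>x\<close>, that is, for which the translation
    crosses the jump at \<open>e\<close>.\<close>
  define c :: "real \<Rightarrow> real \<Rightarrow> real" where "c e = indicator {min e (e + y)..max e (e + y)}" for e
  have c0: "c e x \<ge> 0" for e x by (simp add: c_def)
  have cI: "c e x = 1" if "(x - y \<le> e) \<noteq> (x \<le> e) \<or> (x - y < e) \<noteq> (x < e)" for e x
    using that by (auto simp: c_def indicator_def min_def max_def)
  have "\<bar>point_disc a (x - y) - point_disc a x\<bar> \<le> c a x + c 0 x + c 1 x + \<bar>y\<bar> * indicator {0..1} x" for x
  proof (cases "x \<in> {0<..<1} \<longleftrightarrow> x - y \<in> {0<..<1}")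
    case True
    show ?thesis
    proof (cases "x \<in> {0<..<1}")
      case x: True
      have "\<bar>point_disc a (x - y) - point_disc a x\<bar> = \<bar>of_bool (a < x - y) - of_bool (a < x) + y\<bar>"
        using True x by (auto simp: point_disc_def)
      also have "\<dots> \<le> c a x + \<bar>y\<bar>"
        using cI[of x a] c0[of a x] by (cases "a < x - y"; cases "a < x") auto
      finally show ?thesis using c0[of 0 x] c0[of 1 x] x by simp
    next
      case False
      then have "x - y \<notin> {0<..<1}" using True by blast
      with False have "point_disc a (x - y) = 0" "point_disc a x = 0" by (simp_all add: point_disc_def)
      then show ?thesis using c0[of 0 x] c0[of 1 x] c0[of a x] by simp
    qed
  next
    case False
    then have "c 0 x = 1 \<or> c 1 x = 1" using cI[of x 0] cI[of x 1] by fastforce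
    moreover have "\<bar>point_disc a (x - y) - point_disc a x\<bar> \<le> 1"
      using False by (auto simp: point_disc_def indicator_def)
    ultimately show ?thesis using c0[of 0 x] c0[of 1 x] c0[of a x]
      by (smt (verit) abs_ge_zero indicator_pos_le mult_nonneg_nonneg)
  qed
  then have "(\<integral>\<^sup>+x. ennreal \<bar>point_disc a (x - y) - point_disc a x\<bar> \<partial>lborel) \<le>
    (\<integral>\<^sup>+x. ennreal (c a x) + ennreal (c 0 x) + ennreal (c 1 x) + ennreal \<bar>y\<bar> * ennreal (indicator {0..1} x) \<partial>lborel)"
    by (intro nn_integral_mono) (simp add: ennreal_plus[symmetric] ennreal_mult[symmetric] c0 ennreal_leI del: ennreal_plus)
  also have "\<dots> = ennreal (4 * \<bar>y\<bar>)"
  proof -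
    have ce: "(\<integral>\<^sup>+x. ennreal (c e x) \<partial>lborel) = ennreal \<bar>y\<bar>" for e
      by (simp add: c_def ennreal_indicator max_def min_def)
    have [measurable]: "c e \<in> borel_measurable borel" for e by (simp add: c_def)
    show ?thesis
      by (simp add: nn_integral_add nn_integral_cmult ce ennreal_indicator ennreal_plus[symmetric] del: ennreal_plus)
  qed
  finally show ?thesis .
qed

lemma nn_integral_abs_point_disc: "(\<integral>\<^sup>+y. ennreal \<bar>point_disc a y\<bar> \<partial>lborel) \<le> 1"
proof -
  have "(\<integral>\<^sup>+y. ennreal \<bar>point_disc a y\<bar> \<partial>lborel) \<le> (\<integral>\<^sup>+y. ennreal (indicator {0..1} (y::real)) \<partial>lborel)"
    using point_disc_bound by (intro nn_integral_mono ennreal_leI)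
  then show ?thesis by (simp add: ennreal_indicator)
qed

text \<open>Here \<open>K\<close> lives at scale \<open>1 / D\<close>, with \<open>D = 2 ^ d\<close>
  in the application, and \<open>C\<close> is common to all levels. The alternative
  \<open>D = 1\<close> accommodates the lowest level, whose kernel does not have mean zero.\<close>

locale kernel =
  fixes K K' :: "real \<Rightarrow> complex" and C D :: real
  assumes C_pos: "0 < C" and D_ge_1: "1 \<le> D"
    and deriv: "(K has_vector_derivative K' z) (at z)"
    and cont': "continuous_on UNIV K'"
    and nn_K: "(\<integral>\<^sup>+z. ennreal (cmod (K z)) \<partial>lborel) \<le> ennreal C"
    and nn_K': "(\<integral>\<^sup>+z. ennreal (cmod (K' z)) \<partial>lborel) \<le> ennreal (C * D)"
    and moments: "D = 1 \<or> (LINT z|lborel. K z) = 0 \<and>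
      (\<integral>\<^sup>+z. ennreal (\<bar>z\<bar> * cmod (K z)) \<partial>lborel) \<le> ennreal (C / D)"
begin

lemma cont: "continuous_on A K"
  using deriv by (intro continuous_at_imp_continuous_on ballI)
    (auto intro: has_vector_derivative_continuous)

lemma K_measurable [measurable]: "K \<in> borel_measurable borel"
  by (intro borel_measurable_continuous_onI cont)

lemma K'_measurable [measurable]: "K' \<in> borel_measurable borel"
  by (intro borel_measurable_continuous_onI cont')

lemma integrable_K: "integrable lborel K"
  using nn_K by (intro integrableI_bounded) (auto simp: less_top[symmetric] top_unique)

lemma integrable_K': "integrable lborel K'"
  using nn_K' by (intro integrableI_bounded) (auto simp: less_top[symmetric] top_unique)

lemma integrable_reflect:
  fixes f :: "real \<Rightarrow> complex"
  assumes "integrable lborel f" shows "integrable lborel (\<lambda>y. f (x - y))"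
  using lborel_integrable_real_affine[OF assms, of "-1" x] by simp

lemma integrable_conv:
  assumes [measurable]: "g \<in> borel_measurable borel" and B: "\<And>y. \<bar>g y\<bar> \<le> B"
  shows "integrable lborel (\<lambda>y. complex_of_real (g y) * K (x - y))"
proof (rule Bochner_Integration.integrable_bound)
  show "integrable lborel (\<lambda>y. complex_of_real B * K (x - y))"
    by (intro integrable_mult_right integrable_reflect integrable_K)
  show "AE y in lborel. norm (complex_of_real (g y) * K (x - y)) \<le> norm (complex_of_real B * K (x - y))"
    using B by (intro always_eventually allI) (simp add: norm_mult mult_right_mono order_trans[OF B abs_ge_self])
qed measurable

lemma conv_measurable [measurable]:
  assumes [measurable]: "g \<in> borel_measurable borel"
  shows "conv K g \<in> borel_measurable borel"
  unfolding conv_def by measurable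

lemma conv_sum:
  assumes "\<And>i. i \<in> I \<Longrightarrow> g i \<in> borel_measurable borel" "\<And>i y. i \<in> I \<Longrightarrow> \<bar>g i y\<bar> \<le> B i"
  shows "conv K (\<lambda>y. \<Sum>i\<in>I. g i y) x = (\<Sum>i\<in>I. conv K (g i) x)"
  unfolding conv_def
  by (simp add: sum_distrib_right Bochner_Integration.integral_sum integrable_conv[OF assms])

lemma norm_conv_le:
  assumes [measurable]: "g \<in> borel_measurable borel" and B: "\<And>y. \<bar>g y\<bar> \<le> B"
  shows "cmod (conv K g x) \<le> B * C"
proof -
  have B0: "B \<ge> 0" using B[of 0] by linarith
  have "ennreal (cmod (conv K g x)) \<le> (\<integral>\<^sup>+y. ennreal (cmod (complex_of_real (g y) * K (x - y))) \<partial>lborel)"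
    unfolding conv_def using integrable_conv[OF assms] by (intro integral_norm_bound_ennreal)
  also have "\<dots> \<le> (\<integral>\<^sup>+y. ennreal B * ennreal (cmod (K (x - y))) \<partial>lborel)"
    using B0 B by (intro nn_integral_mono) (auto simp: norm_mult ennreal_mult[symmetric] intro!: ennreal_leI mult_right_mono)
  also have "\<dots> = ennreal B * (\<integral>\<^sup>+y. ennreal (cmod (K y)) \<partial>lborel)"
    by (simp add: nn_integral_cmult nn_integral_reflect[of "\<lambda>y. ennreal (cmod (K y))"])
  also have "\<dots> \<le> ennreal B * ennreal C" by (intro mult_left_mono nn_K) auto
  finally show ?thesis using B0 C_pos by (simp add: ennreal_mult[symmetric])
qed

text \<open>Young's inequality for \<open>L_1\<close>, by Tonelli.\<close>

lemma nn_conv_le: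
  assumes [measurable]: "g \<in> borel_measurable borel" and B: "\<And>y. \<bar>g y\<bar> \<le> B"
  shows "(\<integral>\<^sup>+x. ennreal (cmod (conv K g x)) \<partial>lborel) \<le> (\<integral>\<^sup>+y. ennreal \<bar>g y\<bar> \<partial>lborel) * ennreal C"
proof -
  have "(\<integral>\<^sup>+x. ennreal (cmod (conv K g x)) \<partial>lborel) \<le>
     (\<integral>\<^sup>+x. \<integral>\<^sup>+y. ennreal \<bar>g y\<bar> * ennreal (cmod (K (x - y))) \<partial>lborel \<partial>lborel)"
  proof (intro nn_integral_mono)
    fix x
    have "ennreal (cmod (conv K g x)) \<le> (\<integral>\<^sup>+y. ennreal (cmod (complex_of_real (g y) * K (x - y))) \<partial>lborel)"
      unfolding conv_def using integrable_conv[OF assms] by (intro integral_norm_bound_ennreal)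
    then show "ennreal (cmod (conv K g x)) \<le> (\<integral>\<^sup>+y. ennreal \<bar>g y\<bar> * ennreal (cmod (K (x - y))) \<partial>lborel)"
      by (simp add: norm_mult ennreal_mult)
  qed
  also have "\<dots> = (\<integral>\<^sup>+y. \<integral>\<^sup>+x. ennreal \<bar>g y\<bar> * ennreal (cmod (K (x - y))) \<partial>lborel \<partial>lborel)"
    by (rule lborel_pair.Fubini') measurable
  also have "\<dots> = (\<integral>\<^sup>+y. ennreal \<bar>g y\<bar> * (\<integral>\<^sup>+x. ennreal (cmod (K x)) \<partial>lborel) \<partial>lborel)"
    by (simp add: nn_integral_cmult nn_integral_translate[of "\<lambda>y. ennreal (cmod (K y))"])
  also have "\<dots> = (\<integral>\<^sup>+y. ennreal \<bar>g y\<bar> \<partial>lborel) * (\<integral>\<^sup>+x. ennreal (cmod (K x)) \<partial>lborel)"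
    by (simp add: nn_integral_multc)
  also have "\<dots> \<le> (\<integral>\<^sup>+y. ennreal \<bar>g y\<bar> \<partial>lborel) * ennreal C"
    by (intro mult_left_mono nn_K) auto
  finally show ?thesis .
qed

text \<open>Mean zero allows \<open>g x\<close> to be subtracted from \<open>g (x - y)\<close> under
  the integral. Integrating over \<open>x\<close> first leaves the \<open>L_1\<close> modulus of
  continuity of \<open>g\<close>, weighted by \<open>K\<close>; its linear growth turns into the
  first absolute moment.\<close>

lemma nn_conv_mean_zero_le:
  assumes [measurable]: "g \<in> borel_measurable borel" and B: "\<And>y. \<bar>g y\<bar> \<le> B"
    and V: "V \<ge> 0" "\<And>y. (\<integral>\<^sup>+x. ennreal \<bar>g (x - y) - g x\<bar> \<partial>lborel) \<le> ennreal (V * \<bar>y\<bar>)"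
    and mz: "(LINT z|lborel. K z) = 0"
  shows "(\<integral>\<^sup>+x. ennreal (cmod (conv K g x)) \<partial>lborel) \<le> ennreal V * (\<integral>\<^sup>+z. ennreal (\<bar>z\<bar> * cmod (K z)) \<partial>lborel)"
proof -
  have "(\<integral>\<^sup>+x. ennreal (cmod (conv K g x)) \<partial>lborel) \<le>
     (\<integral>\<^sup>+x. \<integral>\<^sup>+y. ennreal \<bar>g (x - y) - g x\<bar> * ennreal (cmod (K y)) \<partial>lborel \<partial>lborel)"
  proof (intro nn_integral_mono)
    fix x
    have int: "integrable lborel (\<lambda>y. complex_of_real (g (x - y)) * K y)"
      using integrable_reflect[OF integrable_conv[OF assms(1,2), of x], of x] by simp
    have int2: "integrable lborel (\<lambda>y. complex_of_real (g x) * K y)"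
      by (intro integrable_mult_right integrable_K)
    have "conv K g x = (LINT y|lborel. complex_of_real (g (x - y)) * K y)"
      unfolding conv_def
      using lborel_integral_real_affine[of "-1" "\<lambda>y. complex_of_real (g y) * K (x - y)" x] by simp
    also have "\<dots> = (LINT y|lborel. complex_of_real (g (x - y) - g x) * K y)"
      using int int2 mz by (simp add: left_diff_distrib)
    finally have "conv K g x = (LINT y|lborel. complex_of_real (g (x - y) - g x) * K y)" .
    also have "ennreal (cmod \<dots>) \<le> (\<integral>\<^sup>+y. ennreal (cmod (complex_of_real (g (x - y) - g x) * K y)) \<partial>lborel)"
      using Bochner_Integration.integrable_diff[OF int int2]
      by (intro integral_norm_bound_ennreal) (simp add: left_diff_distrib)
    finally show "ennreal (cmod (conv K g x)) \<le> (\<integral>\<^sup>+y. ennreal \<bar>g (x - y) - g x\<bar> * ennreal (cmod (K y)) \<partial>lborel)"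
      by (simp add: norm_mult ennreal_mult del: of_real_diff)
  qed
  also have "\<dots> = (\<integral>\<^sup>+y. \<integral>\<^sup>+x. ennreal \<bar>g (x - y) - g x\<bar> * ennreal (cmod (K y)) \<partial>lborel \<partial>lborel)"
    by (rule lborel_pair.Fubini') measurable
  also have "\<dots> = (\<integral>\<^sup>+y. (\<integral>\<^sup>+x. ennreal \<bar>g (x - y) - g x\<bar> \<partial>lborel) * ennreal (cmod (K y)) \<partial>lborel)"
    by (simp add: nn_integral_multc)
  also have "\<dots> \<le> (\<integral>\<^sup>+y. ennreal (V * \<bar>y\<bar>) * ennreal (cmod (K y)) \<partial>lborel)"
    by (intro nn_integral_mono mult_right_mono V) auto
  also have "\<dots> = (\<integral>\<^sup>+y. ennreal V * ennreal (\<bar>y\<bar> * cmod (K y)) \<partial>lborel)"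
    using V(1) by (simp add: ennreal_mult mult.assoc)
  also have "\<dots> = ennreal V * (\<integral>\<^sup>+z. ennreal (\<bar>z\<bar> * cmod (K z)) \<partial>lborel)"
    by (simp add: nn_integral_cmult)
  finally show ?thesis .
qed

text \<open>The gain \<open>1 / D\<close> comes from the moment; at \<open>D = 1\<close> there is
  nothing to gain and Young's inequality suffices.\<close>

lemma nn_conv_point_disc_le:
  assumes a: "0 \<le> a" "a \<le> 1"
  shows "(\<integral>\<^sup>+x. ennreal (cmod (conv K (point_disc a) x)) \<partial>lborel) \<le> ennreal (4 * C / D)"
proof (cases "D = 1")
  case True
  have "(\<integral>\<^sup>+x. ennreal (cmod (conv K (point_disc a) x)) \<partial>lborel) \<le> (\<integral>\<^sup>+y. ennreal \<bar>point_disc a y\<bar> \<partial>lborel) * ennreal C"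
    by (rule nn_conv_le[where B = 1]) (auto intro: order_trans[OF point_disc_bound] simp: indicator_le_1)
  also have "\<dots> \<le> 1 * ennreal C" by (intro mult_right_mono nn_integral_abs_point_disc) auto
  also have "\<dots> \<le> ennreal (4 * C / D)" using True C_pos by (simp add: ennreal_leI)
  finally show ?thesis .
next
  case False
  then have m: "(LINT z|lborel. K z) = 0" "(\<integral>\<^sup>+z. ennreal (\<bar>z\<bar> * cmod (K z)) \<partial>lborel) \<le> ennreal (C / D)"
    using moments by auto
  have "(\<integral>\<^sup>+x. ennreal (cmod (conv K (point_disc a) x)) \<partial>lborel) \<le> ennreal 4 * (\<integral>\<^sup>+z. ennreal (\<bar>z\<bar> * cmod (K z)) \<partial>lborel)"
    by (rule nn_conv_mean_zero_le[where B = 1, OF _ _ _ point_disc_translate[OF a] m(1)])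
      (auto intro: order_trans[OF point_disc_bound] simp: indicator_le_1)
  also have "\<dots> \<le> ennreal 4 * ennreal (C / D)" by (intro mult_left_mono m) auto
  also have "\<dots> = ennreal (4 * C / D)" using C_pos D_ge_1 by (simp add: ennreal_mult[symmetric] del: ennreal_numeral)
  finally show ?thesis .
qed

text \<open>This serves the one point that has no mirror image when \<open>N\<close> is odd. The sup
  bound \<open>C\<close> is relaxed to \<open>4 * C\<close> so that the constant factors out of the
  interpolation.\<close>

lemma Lp_le_conv_point_disc:
  assumes a: "0 \<le> a" "a \<le> 1" and p: "p \<ge> 1"
  shows "Lp_le p (conv K (point_disc a)) (4 * C * (1 / D) powr (1 / p))"
proof -
  have "Lp_le p (conv K (point_disc a)) ((4 * C) powr (1 - 1 / p) * (4 * C / D) powr (1 / p))"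
  proof (rule Lp_le_interpolate[OF p _ _ _ _ nn_conv_point_disc_le[OF a]])
    fix x
    have "cmod (conv K (point_disc a) x) \<le> 1 * C"
      by (rule norm_conv_le) (auto intro: order_trans[OF point_disc_bound] simp: indicator_le_1)
    then show "cmod (conv K (point_disc a) x) \<le> 4 * C" using C_pos by simp
  qed (use C_pos D_ge_1 in auto)
  also have "(4 * C) powr (1 - 1 / p) * (4 * C / D) powr (1 / p) = 4 * C * (1 / D) powr (1 / p)"
  proof -
    have "(4 * C / D) powr (1 / p) = (4 * C) powr (1 / p) * (1 / D) powr (1 / p)"
      using C_pos D_ge_1 by (simp add: powr_mult[symmetric] del: powr_one_eq_one)
    then show ?thesis using C_pos by (simp add: powr_diff)
  qed
  finally show ?thesis .
qed

text \<open>\<open>G\<close> is the primitive of \<open>point_disc a\<close> on the unit interval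
  with \<open>G 0 = 0\<close>. Its value \<open>1 / 2 - a\<close> at 1 survives as the boundary
  term, and the sign of the integral is positive because \<open>K (x - y)\<close> has derivative
  \<open>- K' (x - y)\<close> in \<open>y\<close>.\<close>

lemma conv_point_disc_parts:
  assumes a: "0 \<le> a" "a \<le> 1"
  defines "G \<equiv> \<lambda>y::real. max 0 (y - a) - y\<^sup>2 / 2"
  shows "conv K (point_disc a) x = complex_of_real (1 / 2 - a) * K (x - 1) +
     (LINT y|lborel. complex_of_real (indicator {0..1} y * G y) * K' (x - y))"
    and "integrable lborel (\<lambda>y. complex_of_real (indicator {0..1} y * G y) * K' (x - y))"
proof -
  have G: "\<bar>indicator {0..1} y * G y\<bar> \<le> 2" for y
  proof (cases "y \<in> {0..1}")
    case True
    then have "0 \<le> y\<^sup>2" "y\<^sup>2 \<le> 1" by (auto simp: power_le_one)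
    moreover have "0 \<le> max 0 (y - a)" "max 0 (y - a) \<le> 1" using True a by auto
    ultimately have "\<bar>G y\<bar> \<le> 2" unfolding G_def by linarith
    then show ?thesis using True by simp
  qed auto
  have [measurable]: "G \<in> borel_measurable borel" unfolding G_def by measurable
  show int': "integrable lborel (\<lambda>y. complex_of_real (indicator {0..1} y * G y) * K' (x - y))"
  proof (rule Bochner_Integration.integrable_bound)
    show "integrable lborel (\<lambda>y. complex_of_real 2 * K' (x - y))"
      by (intro integrable_mult_right integrable_reflect integrable_K')
    show "AE y in lborel. norm (complex_of_real (indicator {0..1} y * G y) * K' (x - y)) \<le> norm (complex_of_real 2 * K' (x - y))"
      using G by (intro always_eventually allI) (auto simp: norm_mult simp del: of_real_mult intro!: mult_right_mono)
  qed measurable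
  have int: "integrable lborel (\<lambda>y. complex_of_real (point_disc a y) * K (x - y))"
    by (rule integrable_conv[where B = 1]) (auto intro: order_trans[OF point_disc_bound] simp: indicator_le_1)
  define H where "H y = (complex_of_real (of_bool (a < y) - y) * K (x - y)) - complex_of_real (G y) * K' (x - y)" for y
  have "(H has_integral complex_of_real (G 1) * K (x - 1) - complex_of_real (G 0) * K (x - 0)) {0..1}"
  \<comment> \<open>\<open>G\<close> is continuous but has a kink at \<open>a\<close>, so this point
    is exempted.\<close>
  proof (rule fundamental_theorem_of_calculus_interior_strong[of "{a}"])
    show "continuous_on {0..1} (\<lambda>y. complex_of_real (G y) * K (x - y))"
      unfolding G_def by (intro continuous_intros continuous_on_compose2[OF cont[of UNIV]]) auto
    fix y assume y: "y \<in> {0<..<1} - {a}"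
    have dK: "((\<lambda>y. K (x - y)) has_vector_derivative - K' (x - y)) (at y)"
    proof -
      have "((\<lambda>y. x - y) has_vector_derivative - 1) (at y)"
        by (auto intro!: derivative_eq_intros simp: has_real_derivative_iff_has_vector_derivative[symmetric])
      from vector_diff_chain_at[OF this deriv] show ?thesis by (simp add: o_def)
    qed
    have dm: "((\<lambda>y. max 0 (y - a)) has_real_derivative of_bool (a < y)) (at y)"
    proof (cases "a < y")
      case True
      have "((\<lambda>y. y - a) has_real_derivative 1) (at y)" by (auto intro!: derivative_eq_intros)
      then have "((\<lambda>y. max 0 (y - a)) has_real_derivative 1) (at y)"
        by (rule has_field_derivative_transform_within_open[where S = "{a<..}"]) (use True in auto)
      then show ?thesis using True by simp
    next
      case False
      then have "y < a" using y by auto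
      have "((\<lambda>y. 0) has_real_derivative 0) (at y)" by simp
      then have "((\<lambda>y. max 0 (y - a)) has_real_derivative 0) (at y)"
        by (rule has_field_derivative_transform_within_open[where S = "{..<a}"]) (use \<open>y < a\<close> in auto)
      then show ?thesis using False by simp
    qed
    have "(G has_real_derivative (of_bool (a < y) - y)) (at y)"
      unfolding G_def using dm by (auto intro!: derivative_eq_intros)
    then have "((\<lambda>y. complex_of_real (G y)) has_vector_derivative complex_of_real (of_bool (a < y) - y)) (at y)"
      by (intro has_vector_derivative_of_real) (simp add: has_real_derivative_iff_has_vector_derivative)
    from has_vector_derivative_mult[OF this dK]
    show "((\<lambda>y. complex_of_real (G y) * K (x - y)) has_vector_derivative H y) (at y)"
      unfolding H_def by (simp add: algebra_simps)
  qed auto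
  moreover have "G 0 = 0" "G 1 = 1 / 2 - a" using a by (auto simp: G_def max_def)
  ultimately have "(H has_integral complex_of_real (1 / 2 - a) * K (x - 1)) {0..1}" by simp
  then have 1: "((\<lambda>y. if y \<in> {0..1} then H y else 0) has_integral complex_of_real (1 / 2 - a) * K (x - 1)) UNIV"
    by (subst has_integral_restrict_UNIV)
  define H2 where "H2 y = complex_of_real (point_disc a y) * K (x - y) - complex_of_real (indicator {0..1} y * G y) * K' (x - y)" for y
  have 2: "(H2 has_integral complex_of_real (1 / 2 - a) * K (x - 1)) UNIV"
  \<comment> \<open>\<open>point_disc\<close> uses the open interval and the indicator in front of
    \<open>G\<close> the closed one; they differ at the two endpoints.\<close>
  proof (rule has_integral_spike[OF _ _ 1])
    show "negligible {0, 1::real}" by simp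
    fix y :: real assume "y \<in> UNIV - {0, 1}"
    then show "H2 y = (if y \<in> {0..1} then H y else 0)"
      by (auto simp: H2_def H_def point_disc_def indicator_def)
  qed
  have "integrable lborel H2"
    unfolding H2_def by (intro Bochner_Integration.integrable_diff int int')
  then have "(H2 has_integral (LINT y|lborel. H2 y)) UNIV"
    by (rule has_integral_integral_lborel)
  then have "(LINT y|lborel. H2 y) = complex_of_real (1 / 2 - a) * K (x - 1)"
    using 2 has_integral_unique by blast
  then show "conv K (point_disc a) x = complex_of_real (1 / 2 - a) * K (x - 1) +
     (LINT y|lborel. complex_of_real (indicator {0..1} y * G y) * K' (x - y))"
    unfolding H2_def conv_def using int int' by (simp add: diff_eq_eq del: of_real_mult)
qed

end

section \<open>Blocks: a shifted grid together with its mirror image\<close>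

definition block_disc :: "nat \<Rightarrow> real \<Rightarrow> real \<Rightarrow> real" where
  "block_disc n \<sigma> y = (\<Sum>k<n. point_disc ((real k + \<sigma>) / n) y + point_disc (1 - (real k + \<sigma>) / n) y)"

lemma block_disc_measurable [measurable]: "block_disc n \<sigma> \<in> borel_measurable borel"
  unfolding block_disc_def by measurable

text \<open>Reversing the order of the cells, \<open>k\<close> to \<open>n - 1 - k\<close>, turns
  the mirror image of the grid with shift \<open>\<sigma>\<close> into the grid with shift
  \<open>1 - \<sigma>\<close>.\<close>

lemma sum_grid_reflect:
  assumes "n > 0"
  shows "(\<Sum>k<n. f (1 - (real k + \<sigma>) / n)) = (\<Sum>k<n. f ((real k + (1 - \<sigma>)) / n))"
proof -
  have "(\<Sum>k<n. f (1 - (real k + \<sigma>) / n)) = (\<Sum>k<n. f ((real (n - Suc k) + (1 - \<sigma>)) / n))"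
  proof (intro sum.cong refl arg_cong[where f = f])
    fix k assume "k \<in> {..<n}"
    then have "real (n - Suc k) = real n - real k - 1" by (simp add: of_nat_diff)
    then show "1 - (real k + \<sigma>) / n = (real (n - Suc k) + (1 - \<sigma>)) / n"
      using assms by (simp add: field_simps)
  qed
  also have "\<dots> = (\<Sum>k<n. f ((real k + (1 - \<sigma>)) / n))"
    by (rule sum.nat_diff_reindex)
  finally show ?thesis .
qed

text \<open>A bound independent of \<open>n\<close>: it provides the sup norm side of the
  interpolation at high frequencies.\<close>

lemma block_disc_bound:
  assumes n: "n > 0" and s: "0 \<le> \<sigma>" "\<sigma> \<le> 1"
  shows "\<bar>block_disc n \<sigma> y\<bar> \<le> 2 * indicator {0..1} y"
proof (cases "0 < y \<and> y < 1")
  case True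
  have "block_disc n \<sigma> y = (\<Sum>k<n. point_disc ((real k + \<sigma>) / n) y + point_disc ((real k + (1 - \<sigma>)) / n) y)"
    unfolding block_disc_def sum.distrib using sum_grid_reflect[OF n, of "\<lambda>a. point_disc a y"] by simp
  also have "\<dots> = (\<Sum>k<n. (of_bool ((real k + \<sigma>) / n < y) + of_bool ((real k + (1 - \<sigma>)) / n < y) - 2 * y))"
    using True by (intro sum.cong refl) (simp add: point_disc_def)
  finally show ?thesis using grid_count_bound[OF n s, of y] True by simp
next
  case False
  then have "point_disc a y = 0" for a by (auto simp: point_disc_def)
  then show ?thesis by (simp add: block_disc_def)
qed

context kernel
begin

lemma grid_in_unit:
  assumes "k < n" "0 \<le> \<sigma>" "\<sigma> \<le> 1"
  shows "0 \<le> (real k + \<sigma>) / real n \<and> (real k + \<sigma>) / real n \<le> 1"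
proof -
  have "real k + 1 \<le> real n" using assms by linarith
  then show ?thesis using assms by simp
qed

lemma conv_block_disc:
  "conv K (block_disc n \<sigma>) x =
    (\<Sum>k<n. conv K (point_disc ((real k + \<sigma>) / n)) x + conv K (point_disc (1 - (real k + \<sigma>) / n)) x)"
proof -
  have pd: "\<bar>point_disc a y\<bar> \<le> 1" for a y
    by (rule order_trans[OF point_disc_bound]) (simp add: indicator_le_1)
  have "conv K (block_disc n \<sigma>) x =
     (\<Sum>k<n. conv K (\<lambda>y. point_disc ((real k + \<sigma>) / n) y + point_disc (1 - (real k + \<sigma>) / n) y) x)"
    unfolding block_disc_def[abs_def]
    by (rule conv_sum[where B = "\<lambda>_. 2"])
      (auto intro!: order_trans[OF abs_triangle_ineq] order_trans[OF add_mono[OF pd pd]])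
  also have "\<dots> = (\<Sum>k<n. conv K (point_disc ((real k + \<sigma>) / n)) x + conv K (point_disc (1 - (real k + \<sigma>) / n)) x)"
    unfolding conv_def
    by (simp add: distrib_right Bochner_Integration.integral_add integrable_conv[OF point_disc_measurable pd])
  finally show ?thesis .
qed

text \<open>After integration by parts \<open>K'\<close> is paired with the primitive of the block,
  which is at most \<open>2 / n\<close> by \<open>grid_ramp_bound\<close>. The majorant is kept as
  an integral because both the sup bound and the \<open>L_1\<close> bound are read off from
  it.\<close>

lemma norm_conv_block_disc_le:
  assumes n: "n > 0" and s: "0 \<le> \<sigma>" "\<sigma> \<le> 1"
  shows "ennreal (cmod (conv K (block_disc n \<sigma>) x)) \<le>
    (\<integral>\<^sup>+y. ennreal (2 / n) * (indicator {0..1} y * ennreal (cmod (K' (x - y)))) \<partial>lborel)"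
proof -
  define G :: "real \<Rightarrow> real \<Rightarrow> real" where "G a y = max 0 (y - a) - y\<^sup>2 / 2" for a y
  define I where "I a y = complex_of_real (indicator {0..1} y * G a y) * K' (x - y)" for a y
  define a where "a k = (real k + \<sigma>) / n" for k
  have a: "0 \<le> a k \<and> a k \<le> 1" if "k < n" for k using grid_in_unit[OF that s] by (simp add: a_def)
  have int: "integrable lborel (I c)" if "0 \<le> c" "c \<le> 1" for c
    using conv_point_disc_parts(2)[OF that, of x] by (simp add: I_def[abs_def] G_def)
  have parts: "conv K (point_disc c) x = complex_of_real (1 / 2 - c) * K (x - 1) + (LINT y|lborel. I c y)"
    if "0 \<le> c" "c \<le> 1" for c
    using conv_point_disc_parts(1)[OF that, of x] by (simp add: I_def[abs_def] G_def)
  have int2: "integrable lborel (\<lambda>y. I (a k) y + I (1 - a k) y)" if "k < n" for k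
    using a[OF that] by (intro Bochner_Integration.integrable_add int) auto
  \<comment> \<open>The boundary terms of the integrations by parts cancel between a point and its reflection.\<close>
  have "conv K (block_disc n \<sigma>) x = (\<Sum>k<n. LINT y|lborel. I (a k) y + I (1 - a k) y)"
    unfolding conv_block_disc a_def[symmetric]
  proof (intro sum.cong refl)
    fix k assume "k \<in> {..<n}"
    then have k: "0 \<le> a k" "a k \<le> 1" using a by auto
    then have k': "0 \<le> 1 - a k" "1 - a k \<le> 1" by auto
    have "complex_of_real (1 / 2 - (1 - a k)) = - complex_of_real (1 / 2 - a k)" by simp
    then show "conv K (point_disc (a k)) x + conv K (point_disc (1 - a k)) x = (LINT y|lborel. I (a k) y + I (1 - a k) y)"
      unfolding parts[OF k] parts[OF k'] Bochner_Integration.integral_add[OF int[OF k] int[OF k']]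
      by (simp add: algebra_simps)
  qed
  also have "\<dots> = (LINT y|lborel. (\<Sum>k<n. I (a k) y + I (1 - a k) y))"
    by (rule Bochner_Integration.integral_sum[symmetric]) (use int2 in auto)
  finally have "conv K (block_disc n \<sigma>) x = (LINT y|lborel. (\<Sum>k<n. I (a k) y + I (1 - a k) y))" .
  also have "ennreal (cmod \<dots>) \<le> (\<integral>\<^sup>+y. ennreal (cmod (\<Sum>k<n. I (a k) y + I (1 - a k) y)) \<partial>lborel)"
    by (intro integral_norm_bound_ennreal Bochner_Integration.integrable_sum) (use int2 in auto)
  also have "\<dots> \<le> (\<integral>\<^sup>+y. ennreal (2 / n) * (indicator {0..1} y * ennreal (cmod (K' (x - y)))) \<partial>lborel)"
  proof (intro nn_integral_mono)
    fix y
    define S where "S = (\<Sum>k<n. G (a k) y + G (1 - a k) y)"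
    have e: "(\<Sum>k<n. I (a k) y + I (1 - a k) y) = complex_of_real (indicator {0..1} y * S) * K' (x - y)"
      unfolding S_def of_real_mult of_real_sum sum_distrib_left sum_distrib_right
      by (intro sum.cong refl) (simp add: I_def algebra_simps)
    show "ennreal (cmod (\<Sum>k<n. I (a k) y + I (1 - a k) y)) \<le> ennreal (2 / n) * (indicator {0..1} y * ennreal (cmod (K' (x - y))))"
    proof (cases "y \<in> {0..1}")
      case True
      have "S = (\<Sum>k<n. G (a k) y + G ((real k + (1 - \<sigma>)) / n) y)"
        unfolding S_def a_def sum.distrib using sum_grid_reflect[OF n, of "\<lambda>a. G a y"] by simp
      also have "\<dots> = (\<Sum>k<n. (max 0 (y - (real k + \<sigma>) / n) + max 0 (y - (real k + (1 - \<sigma>)) / n) - y\<^sup>2))"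
        unfolding G_def a_def by (intro sum.cong refl) simp
      finally have "\<bar>S\<bar> \<le> 2 / n" using grid_ramp_bound[OF n s, of y] True by simp
      then have "\<bar>S\<bar> * cmod (K' (x - y)) \<le> 2 / n * cmod (K' (x - y))" by (intro mult_right_mono) auto
      then show ?thesis unfolding e using True
        by (simp add: norm_mult ennreal_mult[symmetric] ennreal_leI del: of_real_mult)
    qed (simp add: e)
  qed
  finally show ?thesis .
qed

lemma norm_conv_block_disc_le':
  assumes n: "n > 0" and s: "0 \<le> \<sigma>" "\<sigma> \<le> 1"
  shows "cmod (conv K (block_disc n \<sigma>) x) \<le> 2 * C * D / n"
proof -
  have "ennreal (cmod (conv K (block_disc n \<sigma>) x)) \<le> (\<integral>\<^sup>+y. ennreal (2 / n) * ennreal (cmod (K' (x - y))) \<partial>lborel)"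
    by (rule order_trans[OF norm_conv_block_disc_le[OF assms]])
      (auto intro!: nn_integral_mono mult_left_mono simp: indicator_def)
  also have "\<dots> = ennreal (2 / n) * (\<integral>\<^sup>+y. ennreal (cmod (K' y)) \<partial>lborel)"
    by (simp add: nn_integral_cmult nn_integral_reflect[of "\<lambda>y. ennreal (cmod (K' y))"])
  also have "\<dots> \<le> ennreal (2 / n) * ennreal (C * D)" by (intro mult_left_mono nn_K') auto
  also have "\<dots> = ennreal (2 * C * D / n)" using C_pos D_ge_1 by (simp add: ennreal_mult[symmetric])
  finally show ?thesis using C_pos D_ge_1 by simp
qed

text \<open>Integration over \<open>x\<close> first yields the full integral of \<open>K'\<close>;
  the remaining indicator has integral 1. Hence the bound equals the sup bound.\<close>

lemma nn_conv_block_disc_le: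
  assumes n: "n > 0" and s: "0 \<le> \<sigma>" "\<sigma> \<le> 1"
  shows "(\<integral>\<^sup>+x. ennreal (cmod (conv K (block_disc n \<sigma>) x)) \<partial>lborel) \<le> ennreal (2 * C * D / n)"
proof -
  have "(\<integral>\<^sup>+x. ennreal (cmod (conv K (block_disc n \<sigma>) x)) \<partial>lborel) \<le>
    (\<integral>\<^sup>+x. \<integral>\<^sup>+y. ennreal (2 / n) * (indicator {0..1} y * ennreal (cmod (K' (x - y)))) \<partial>lborel \<partial>lborel)"
    by (intro nn_integral_mono norm_conv_block_disc_le assms)
  also have "\<dots> = (\<integral>\<^sup>+y. \<integral>\<^sup>+x. ennreal (2 / n) * (indicator {0..1} y * ennreal (cmod (K' (x - y)))) \<partial>lborel \<partial>lborel)"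
    by (rule lborel_pair.Fubini') measurable
  also have "\<dots> = (\<integral>\<^sup>+y. ennreal (2 / n) * (indicator {0..1} (y::real) * (\<integral>\<^sup>+x. ennreal (cmod (K' x)) \<partial>lborel)) \<partial>lborel)"
    by (intro nn_integral_cong) (simp add: nn_integral_cmult nn_integral_translate[of "\<lambda>y. ennreal (cmod (K' y))"])
  also have "\<dots> = ennreal (2 / n) * (\<integral>\<^sup>+x. ennreal (cmod (K' x)) \<partial>lborel)"
    by (simp add: nn_integral_cmult nn_integral_multc)
  also have "\<dots> \<le> ennreal (2 / n) * ennreal (C * D)" by (intro mult_left_mono nn_K') auto
  also have "\<dots> = ennreal (2 * C * D / n)" using C_pos D_ge_1 by (simp add: ennreal_mult[symmetric])
  finally show ?thesis .
qed

text \<open>At high frequency no cancellation between points is used: each of the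
  \<open>2 * n\<close> points costs \<open>4 * C / D\<close>.\<close>

lemma nn_conv_block_disc_le':
  assumes n: "n > 0" and s: "0 \<le> \<sigma>" "\<sigma> \<le> 1"
  shows "(\<integral>\<^sup>+x. ennreal (cmod (conv K (block_disc n \<sigma>) x)) \<partial>lborel) \<le> ennreal (8 * C * n / D)"
proof -
  define a where "a k = (real k + \<sigma>) / n" for k
  have a: "0 \<le> a k \<and> a k \<le> 1" if "k < n" for k using grid_in_unit[OF that s] by (simp add: a_def)
  have "(\<integral>\<^sup>+x. ennreal (cmod (conv K (block_disc n \<sigma>) x)) \<partial>lborel) \<le>
    (\<integral>\<^sup>+x. (\<Sum>k<n. ennreal (cmod (conv K (point_disc (a k)) x)) + ennreal (cmod (conv K (point_disc (1 - a k)) x))) \<partial>lborel)"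
  proof (intro nn_integral_mono)
    fix x
    have "cmod (conv K (block_disc n \<sigma>) x) \<le> (\<Sum>k<n. cmod (conv K (point_disc (a k)) x) + cmod (conv K (point_disc (1 - a k)) x))"
      unfolding conv_block_disc a_def[symmetric] by (intro sum_norm_le norm_triangle_ineq)
    then show "ennreal (cmod (conv K (block_disc n \<sigma>) x)) \<le>
      (\<Sum>k<n. ennreal (cmod (conv K (point_disc (a k)) x)) + ennreal (cmod (conv K (point_disc (1 - a k)) x)))"
      by (simp add: ennreal_plus[symmetric] sum_ennreal ennreal_leI del: ennreal_plus)
  qed
  also have "\<dots> = (\<Sum>k<n. (\<integral>\<^sup>+x. ennreal (cmod (conv K (point_disc (a k)) x)) \<partial>lborel) +
      (\<integral>\<^sup>+x. ennreal (cmod (conv K (point_disc (1 - a k)) x)) \<partial>lborel))"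
    by (simp add: nn_integral_sum nn_integral_add)
  also have "\<dots> \<le> (\<Sum>k<n. ennreal (4 * C / D) + ennreal (4 * C / D))"
    using a by (intro sum_mono add_mono nn_conv_point_disc_le) auto
  also have "\<dots> = (\<Sum>k<n. ennreal (8 * C / D))"
    using C_pos D_ge_1 by (simp add: ennreal_plus[symmetric] del: ennreal_plus sum_constant)
  also have "\<dots> = ennreal (\<Sum>k<n. 8 * C / D)"
    using C_pos D_ge_1 by (intro sum_ennreal) auto
  also have "(\<Sum>k<n. 8 * C / D) = 8 * C * n / D" by simp
  finally show ?thesis .
qed

text \<open>The case distinction compares the mesh \<open>1 / n\<close> with the scale
  \<open>1 / D\<close> of the kernel. A kernel wider than the mesh sees the small primitive, in both
  endpoint norms; a narrower one sees the separate jumps, in \<open>L_1\<close>, and a bounded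
  function, in the sup norm.\<close>

lemma Lp_le_conv_block_disc:
  assumes n: "n > 0" and s: "0 \<le> \<sigma>" "\<sigma> \<le> 1" and p: "p \<ge> 1"
  shows "Lp_le p (conv K (block_disc n \<sigma>)) (8 * C * (if D \<le> n then D / n else (n / D) powr (1 / p)))"
proof (cases "D \<le> n")
  case True
  have "Lp_le p (conv K (block_disc n \<sigma>)) ((2 * C * D / n) powr (1 - 1 / p) * (2 * C * D / n) powr (1 / p))"
    by (rule Lp_le_interpolate[OF p _ _ norm_conv_block_disc_le'[OF n s] _ nn_conv_block_disc_le[OF n s]])
      (use C_pos D_ge_1 n in auto)
  also have "(2 * C * D / n) powr (1 - 1 / p) * (2 * C * D / n) powr (1 / p) = 2 * C * D / n"
    using C_pos D_ge_1 n by (simp add: powr_add[symmetric])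
  finally have "Lp_le p (conv K (block_disc n \<sigma>)) (2 * C * D / n)" .
  then have "Lp_le p (conv K (block_disc n \<sigma>)) (8 * C * (D / n))"
    by (rule Lp_le_mono) (use C_pos D_ge_1 n p in \<open>auto simp: field_simps\<close>)
  then show ?thesis using True by simp
next
  case False
  have "Lp_le p (conv K (block_disc n \<sigma>)) ((8 * C) powr (1 - 1 / p) * (8 * C * n / D) powr (1 / p))"
  proof (rule Lp_le_interpolate[OF p _ _ _ _ nn_conv_block_disc_le'[OF n s]])
    fix x
    have "cmod (conv K (block_disc n \<sigma>) x) \<le> 2 * C"
      by (rule norm_conv_le) (auto intro!: order_trans[OF block_disc_bound[OF n s]] simp: indicator_le_1)
    then show "cmod (conv K (block_disc n \<sigma>) x) \<le> 8 * C" using C_pos by simp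
  qed (use C_pos D_ge_1 in auto)
  also have "(8 * C) powr (1 - 1 / p) * (8 * C * n / D) powr (1 / p) = 8 * C * (n / D) powr (1 / p)"
  proof -
    have "(8 * C * n / D) powr (1 / p) = (8 * C) powr (1 / p) * (n / D) powr (1 / p)"
      using C_pos D_ge_1 by (simp add: powr_mult[symmetric] del: powr_one_eq_one)
    then show ?thesis using C_pos by (simp add: powr_diff)
  qed
  finally show ?thesis using False by simp
qed

end

subsection \<open>Decay of the dyadic kernels\<close>

definition osc :: "real \<Rightarrow> real \<Rightarrow> complex" where
  "osc z \<xi> = exp (\<i> * complex_of_real (z * \<xi>))"

lemma norm_osc [simp]: "cmod (osc z \<xi>) = 1"
  by (simp add: osc_def)

lemma osc_measurable [measurable]: "(\<lambda>x. osc (f x) (g x)) \<in> borel_measurable M"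
  if [measurable]: "f \<in> borel_measurable M" "g \<in> borel_measurable M"
  unfolding osc_def by measurable

lemma continuous_on_osc [continuous_intros]:
  "continuous_on A f \<Longrightarrow> continuous_on A g \<Longrightarrow> continuous_on A (\<lambda>x. osc (f x) (g x))"
  unfolding osc_def by (intro continuous_intros)

lemma osc_has_vector_derivative:
  "((\<lambda>\<xi>. osc z \<xi>) has_vector_derivative \<i> * complex_of_real z * osc z \<xi>) (at \<xi> within S)"
proof -
  have "((\<lambda>\<xi>. complex_of_real (z * \<xi>)) has_vector_derivative complex_of_real z) (at \<xi> within S)"
    by (intro has_vector_derivative_of_real) (auto intro!: derivative_eq_intros)
  then have "((\<lambda>\<xi>. \<i> * complex_of_real (z * \<xi>)) has_vector_derivative \<i> * complex_of_real z) (at \<xi> within S)"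
    by (rule has_vector_derivative_mult_right)
  from field_vector_diff_chain_within[OF this DERIV_subset[OF DERIV_exp subset_UNIV]]
  show ?thesis by (simp add: osc_def o_def)
qed

lemma osc_commute: "osc z \<xi> = osc \<xi> z"
  by (simp add: osc_def mult.commute)

text \<open>The inverse Fourier transform without its normalizing factor.\<close>

definition osc_int :: "(real \<Rightarrow> complex) \<Rightarrow> real \<Rightarrow> complex" where
  "osc_int h z = (LINT \<xi>|lborel. osc z \<xi> * h \<xi>)"

lemma integrable_compact_support:
  fixes h :: "real \<Rightarrow> complex"
  assumes "continuous_on UNIV h" "\<And>\<xi>. \<bar>\<xi>\<bar> > R \<Longrightarrow> h \<xi> = 0"
  shows "integrable lborel h"
proof -
  have "set_integrable lborel {-R..R} h"
    by (rule borel_integrable_atLeastAtMost') (rule continuous_on_subset[OF assms(1)], simp)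
  then have "integrable lborel (\<lambda>x. indicator {-R..R} x *\<^sub>R h x)" by (simp add: set_integrable_def)
  also have "(\<lambda>x. indicator {-R..R} x *\<^sub>R h x) = h"
    using assms(2) by (auto simp: indicator_def fun_eq_iff abs_if split: if_splits)
  finally show ?thesis .
qed

lemma integrable_osc_mult:
  assumes "integrable lborel h"
  shows "integrable lborel (\<lambda>\<xi>. osc z \<xi> * h \<xi>)"
proof (rule Bochner_Integration.integrable_bound[OF assms])
  have [measurable]: "h \<in> borel_measurable borel" using assms by auto
  show "(\<lambda>\<xi>. osc z \<xi> * h \<xi>) \<in> borel_measurable lborel" by measurable
qed (simp add: norm_mult)

lemma norm_osc_int_le: "cmod (osc_int h z) \<le> (LINT \<xi>|lborel. cmod (h \<xi>))"
proof -
  have "cmod (osc_int h z) \<le> (LINT \<xi>|lborel. cmod (osc z \<xi> * h \<xi>))"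
    unfolding osc_int_def by (rule integral_norm_bound)
  then show ?thesis by (simp add: norm_mult)
qed

lemma osc_int_has_integral:
  assumes c: "continuous_on UNIV h" and z: "\<And>\<xi>. \<bar>\<xi>\<bar> > R \<Longrightarrow> h \<xi> = 0"
  shows "((\<lambda>\<xi>. osc z \<xi> * h \<xi>) has_integral osc_int h z) {-R..R}"
proof -
  have "((\<lambda>\<xi>. osc z \<xi> * h \<xi>) has_integral osc_int h z) UNIV"
    unfolding osc_int_def by (intro has_integral_integral_lborel integrable_osc_mult integrable_compact_support[OF assms])
  moreover have "(\<lambda>\<xi>. osc z \<xi> * h \<xi>) = (\<lambda>\<xi>. if \<xi> \<in> {-R..R} then osc z \<xi> * h \<xi> else 0)"
    using z by (auto simp: fun_eq_iff abs_if split: if_splits)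
  ultimately show ?thesis by (metis has_integral_restrict_UNIV)
qed

text \<open>Integration by parts without boundary terms, as \<open>h\<close> vanishes at
  \<open>-R\<close> and \<open>R\<close>. Each derivative of \<open>h\<close> thus pays for one
  power of decay in \<open>z\<close>.\<close>

lemma osc_int_deriv:
  assumes d: "\<And>\<xi>. (h has_vector_derivative h' \<xi>) (at \<xi>)" and c': "continuous_on UNIV h'"
    and R: "0 \<le> R" "\<And>\<xi>. \<bar>\<xi>\<bar> \<ge> R \<Longrightarrow> h \<xi> = 0" and R': "\<And>\<xi>. \<bar>\<xi>\<bar> > R \<Longrightarrow> h' \<xi> = 0"
  shows "complex_of_real z * osc_int h z = \<i> * osc_int h' z"
proof -
  have c: "continuous_on UNIV h"
    using d by (intro continuous_at_imp_continuous_on ballI) (auto intro: has_vector_derivative_continuous)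
  have "((\<lambda>\<xi>. osc z \<xi> * h' \<xi> + \<i> * complex_of_real z * osc z \<xi> * h \<xi>) has_integral
      (osc z R * h R - osc z (-R) * h (-R))) {-R..R}"
  proof (rule fundamental_theorem_of_calculus)
    fix \<xi>
    show "((\<lambda>\<xi>. osc z \<xi> * h \<xi>) has_vector_derivative (osc z \<xi> * h' \<xi> + \<i> * complex_of_real z * osc z \<xi> * h \<xi>)) (at \<xi> within {-R..R})"
      by (intro has_vector_derivative_mult osc_has_vector_derivative has_vector_derivative_at_within[OF d])
  qed (use R in simp)
  then have 1: "((\<lambda>\<xi>. osc z \<xi> * h' \<xi> + \<i> * complex_of_real z * (osc z \<xi> * h \<xi>)) has_integral 0) {-R..R}"
    using R by (simp add: mult.assoc)
  have 2: "((\<lambda>\<xi>. osc z \<xi> * h' \<xi> + \<i> * complex_of_real z * (osc z \<xi> * h \<xi>)) has_integral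
      osc_int h' z + \<i> * complex_of_real z * osc_int h z) {-R..R}"
    by (intro has_integral_add has_integral_mult_right osc_int_has_integral c c' R') (use R in auto)
  have "osc_int h' z + \<i> * complex_of_real z * osc_int h z = 0"
    using has_integral_unique[OF 2 1] .
  then have "\<i> * (osc_int h' z + \<i> * complex_of_real z * osc_int h z) = 0" by simp
  then show ?thesis by (simp add: distrib_left mult.assoc[symmetric])
qed

text \<open>Bounded support reduces the integral to a compact interval, where differentiation under
  the integral sign needs only joint continuity.\<close>

lemma osc_int_has_vector_derivative:
  assumes c: "continuous_on UNIV h" and z: "\<And>\<xi>. \<bar>\<xi>\<bar> > R \<Longrightarrow> h \<xi> = 0"
  shows "(osc_int h has_vector_derivative \<i> * osc_int (\<lambda>\<xi>. complex_of_real \<xi> * h \<xi>) z) (at z)"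
proof -
  have eq: "osc_int h z = integral (cbox (-R) R) (\<lambda>\<xi>. osc z \<xi> * h \<xi>)" for z
    using osc_int_has_integral[of h R z, OF c z] by (simp add: integral_unique)
  have c2: "continuous_on UNIV (\<lambda>\<xi>. complex_of_real \<xi> * h \<xi>)"
    by (intro continuous_intros c)
  have eq2: "\<i> * osc_int (\<lambda>\<xi>. complex_of_real \<xi> * h \<xi>) z = integral (cbox (-R) R) (\<lambda>\<xi>. \<i> * complex_of_real \<xi> * osc z \<xi> * h \<xi>)"
    by (rule integral_unique[symmetric])
      (use has_integral_mult_right[OF osc_int_has_integral[OF c2, of R z], of \<i>] z in \<open>simp add: mult.assoc mult.left_commute\<close>)
  have "((\<lambda>z. integral (cbox (-R) R) (\<lambda>\<xi>. osc z \<xi> * h \<xi>)) has_vector_derivative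
     integral (cbox (-R) R) (\<lambda>\<xi>. \<i> * complex_of_real \<xi> * osc z \<xi> * h \<xi>)) (at z within UNIV)"
  proof (rule leibniz_rule_vector_derivative)
    fix x t
    show "((\<lambda>x. osc x t * h t) has_vector_derivative \<i> * complex_of_real t * osc x t * h t) (at x within UNIV)"
      using has_vector_derivative_mult_left[OF osc_has_vector_derivative[of t x UNIV], of "h t"]
      by (simp add: osc_commute[of _ t])
    show "(\<lambda>\<xi>. osc x \<xi> * h \<xi>) integrable_on cbox (-R) R"
      using osc_int_has_integral[of h R x, OF c z] by auto
    show "continuous_on (UNIV \<times> cbox (-R) R) (\<lambda>(x, t). \<i> * complex_of_real t * osc x t * h t)"
      unfolding split_beta by (intro continuous_intros continuous_on_compose2[OF c]) auto
  qed auto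
  then show ?thesis unfolding eq[symmetric] eq2[symmetric] by simp
qed

section \<open>Iterated derivatives and the kernels of the resolution\<close>

lemma nth_deriv_0 [simp]: "nth_deriv 0 f = f"
  by (simp add: nth_deriv_def)

lemma nth_deriv_Suc: "nth_deriv (Suc m) f = (\<lambda>x. vector_derivative (nth_deriv m f) (at x))"
  by (simp add: nth_deriv_def)

lemma smooth_has_vector_derivative:
  "smooth f \<Longrightarrow> (nth_deriv m f has_vector_derivative nth_deriv (Suc m) f x) (at x)"
  by (simp add: smooth_def nth_deriv_Suc vector_derivative_works)

lemma smooth_continuous: "smooth f \<Longrightarrow> continuous_on A (nth_deriv m f)"
  by (intro continuous_at_imp_continuous_on ballI)
     (blast intro: has_vector_derivative_continuous smooth_has_vector_derivative)

lemma nth_deriv_eq_0: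
  assumes "\<And>t. \<bar>t\<bar> > R \<Longrightarrow> f t = 0" "\<bar>t\<bar> > R"
  shows "nth_deriv m f t = 0"
  using assms(2)
proof (induction m arbitrary: t)
  case 0
  then show ?case using assms by simp
next
  case (Suc m)
  have "((\<lambda>_. 0) has_vector_derivative 0) (at t)" by simp
  then have "(nth_deriv m f has_vector_derivative 0) (at t)"
    by (rule has_vector_derivative_transform_within_open[where S = "{t. R < \<bar>t\<bar>}"])
      (use Suc in \<open>auto intro!: open_Collect_less continuous_intros\<close>)
  then show ?case by (simp add: nth_deriv_Suc vector_derivative_at)
qed

text \<open>The factor \<open>1 / (2 * pi)\<close> is the product of the normalizations of the
  Fourier transform and its inverse, so that convolution with this kernel is exactly the Fourier
  multiplier \<open>resolution \<phi>0 d\<close>.\<close>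

definition resolution_kernel :: "(real \<Rightarrow> complex) \<Rightarrow> nat \<Rightarrow> real \<Rightarrow> complex" where
  "resolution_kernel \<phi>0 d z = complex_of_real (1 / (2 * pi)) * osc_int (resolution \<phi>0 d) z"

section \<open>Integrability, dilation and differences of kernels\<close>

lemma decay_finite_integral:
  fixes f :: "real \<Rightarrow> real"
  assumes f: "\<And>z. 0 \<le> f z" "\<And>z. f z * (1 + z\<^sup>2) \<le> B"
  shows "(\<integral>\<^sup>+z. ennreal (f z) \<partial>lborel) < \<infinity>"
proof -
  have i: "integrable lborel (\<lambda>x::real. inverse (1 + x\<^sup>2))"
    using integrable_inverse_1_plus_square by (simp add: set_integrable_def)
  have "(\<integral>\<^sup>+z. ennreal (f z) \<partial>lborel) \<le> (\<integral>\<^sup>+z. ennreal (norm (B * inverse (1 + z\<^sup>2))) \<partial>lborel)"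
  proof (intro nn_integral_mono ennreal_leI)
    fix z :: real
    have p: "0 < 1 + z\<^sup>2" by (simp add: add_pos_nonneg)
    have "f z = f z * (1 + z\<^sup>2) * inverse (1 + z\<^sup>2)" using p by simp
    also have "\<dots> \<le> B * inverse (1 + z\<^sup>2)" using f p by (intro mult_right_mono) auto
    finally show "f z \<le> norm (B * inverse (1 + z\<^sup>2))" by simp
  qed
  also have "\<dots> < \<infinity>"
    using integrable_mult_right[of B, OF i] unfolding integrable_iff_bounded by blast
  finally show ?thesis .
qed

lemma osc_int_affine:
  assumes l: "l > 0"
  shows "osc_int (\<lambda>\<xi>. h (\<xi> / l)) z = complex_of_real l * osc_int h (l * z)"
  using lborel_integral_real_affine[of "l" "\<lambda>\<xi>. osc z \<xi> * h (\<xi> / l)" 0] l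
  by (simp add: osc_int_def osc_def scaleR_conv_of_real ac_simps)

text \<open>The size conditions of \<open>kernel\<close> at scale \<open>1 / l\<close> without the
  mean-zero alternative: this part is inherited by dilations, and mean zero arises only on taking a
  difference.\<close>

definition kernel_seed :: "(real \<Rightarrow> complex) \<Rightarrow> (real \<Rightarrow> complex) \<Rightarrow> real \<Rightarrow> real \<Rightarrow> bool" where
  "kernel_seed K K' m l \<longleftrightarrow>
     (\<forall>z. (K has_vector_derivative K' z) (at z)) \<and> continuous_on UNIV K' \<and>
     (\<integral>\<^sup>+z. ennreal (cmod (K z)) \<partial>lborel) \<le> ennreal m \<and>
     (\<integral>\<^sup>+z. ennreal (cmod (K' z)) \<partial>lborel) \<le> ennreal (m * l) \<and>
     (\<integral>\<^sup>+z. ennreal (\<bar>z\<bar> * cmod (K z)) \<partial>lborel) \<le> ennreal (m / l)"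

lemma kernel_seed_measurable:
  assumes "kernel_seed K K' m l"
  shows "K \<in> borel_measurable borel" "K' \<in> borel_measurable borel"
proof -
  have "continuous_on UNIV K"
    using assms by (intro continuous_at_imp_continuous_on ballI)
      (auto simp: kernel_seed_def intro: has_vector_derivative_continuous)
  then show "K \<in> borel_measurable borel" "K' \<in> borel_measurable borel"
    using assms by (auto simp: kernel_seed_def intro: borel_measurable_continuous_onI)
qed

text \<open>The amplitude \<open>l\<close> preserves the integral; a derivative gains a factor
  \<open>l\<close> and a moment loses one.\<close>

lemma kernel_seed_scale:
  assumes K: "kernel_seed K K' m 1" and m: "m > 0" and l: "l > 0"
  shows "kernel_seed (\<lambda>z. complex_of_real l * K (l * z)) (\<lambda>z. complex_of_real (l\<^sup>2) * K' (l * z)) m l"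
  unfolding kernel_seed_def
proof (intro conjI allI)
  note [measurable] = kernel_seed_measurable[OF K]
  fix z
  have "((\<lambda>z. l * z) has_vector_derivative l) (at z)"
    by (auto intro!: derivative_eq_intros simp: has_real_derivative_iff_has_vector_derivative[symmetric])
  moreover have "(K has_vector_derivative K' (l * z)) (at (l * z))" using K by (simp add: kernel_seed_def)
  ultimately have "((\<lambda>z. K (l * z)) has_vector_derivative l *\<^sub>R K' (l * z)) (at z)"
    using vector_diff_chain_at by (fastforce simp: o_def)
  from has_vector_derivative_mult_right[OF this, of "complex_of_real l"]
  show "((\<lambda>z. complex_of_real l * K (l * z)) has_vector_derivative complex_of_real (l\<^sup>2) * K' (l * z)) (at z)"
    by (simp add: scaleR_conv_of_real power2_eq_square mult.assoc)
  have "continuous_on UNIV K'" using K by (simp add: kernel_seed_def)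
  then have "continuous_on UNIV (\<lambda>z. K' (l * z))"
    by (rule continuous_on_compose2) (intro continuous_on_mult continuous_on_const continuous_on_id, simp)
  then show "continuous_on UNIV (\<lambda>z. complex_of_real (l\<^sup>2) * K' (l * z))"
    by (rule continuous_on_mult[OF continuous_on_const])
  have "(\<integral>\<^sup>+z. ennreal (cmod (complex_of_real l * K (l * z))) \<partial>lborel) = (\<integral>\<^sup>+z. ennreal (cmod (K z)) \<partial>lborel)"
    using nn_integral_real_affine[of "\<lambda>z. ennreal (cmod (K z))" "l" 0] l
    by (simp add: norm_mult ennreal_mult nn_integral_cmult)
  then show "(\<integral>\<^sup>+z. ennreal (cmod (complex_of_real l * K (l * z))) \<partial>lborel) \<le> ennreal m"
    using K by (simp add: kernel_seed_def)
  have "(\<integral>\<^sup>+z. ennreal (cmod (complex_of_real (l\<^sup>2) * K' (l * z))) \<partial>lborel) =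
      ennreal l * (ennreal l * (\<integral>\<^sup>+z. ennreal (cmod (K' (l * z))) \<partial>lborel))"
    using l by (simp add: norm_mult norm_power ennreal_mult nn_integral_cmult power2_eq_square mult.assoc)
  also have "ennreal l * (\<integral>\<^sup>+z. ennreal (cmod (K' (l * z))) \<partial>lborel) = (\<integral>\<^sup>+z. ennreal (cmod (K' z)) \<partial>lborel)"
    using nn_integral_real_affine[of "\<lambda>z. ennreal (cmod (K' z))" "l" 0] l by simp
  also have "ennreal l * \<dots> \<le> ennreal l * ennreal (m * 1)"
    using K unfolding kernel_seed_def by (intro mult_left_mono) auto
  finally show "(\<integral>\<^sup>+z. ennreal (cmod (complex_of_real (l\<^sup>2) * K' (l * z))) \<partial>lborel) \<le> ennreal (m * l)"
    using l m by (simp add: ennreal_mult[symmetric] mult.commute)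
  have "(\<integral>\<^sup>+z. ennreal (\<bar>z\<bar> * cmod (complex_of_real l * K (l * z))) \<partial>lborel) =
     ennreal (1 / l) * (\<integral>\<^sup>+z. ennreal (\<bar>z\<bar> * cmod (K z)) \<partial>lborel)"
  proof -
    have "(\<integral>\<^sup>+z. ennreal (\<bar>z\<bar> * cmod (K z)) \<partial>lborel) = ennreal l * (\<integral>\<^sup>+z. ennreal (\<bar>l * z\<bar> * cmod (K (l * z))) \<partial>lborel)"
      using nn_integral_real_affine[of "\<lambda>z. ennreal (\<bar>z\<bar> * cmod (K z))" "l" 0] l by simp
    moreover have "ennreal (1 / l) * ennreal l = 1" using l by (simp add: ennreal_mult[symmetric])
    moreover have "\<bar>l * z\<bar> * cmod (K (l * z)) = \<bar>z\<bar> * cmod (complex_of_real l * K (l * z))" for z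
      by (simp add: norm_mult abs_mult)
    ultimately show ?thesis by (simp only: mult.assoc[symmetric] mult_1_left)
  qed
  also have "\<dots> \<le> ennreal (1 / l) * ennreal (m / 1)"
    using K unfolding kernel_seed_def by (intro mult_left_mono) auto
  also have "\<dots> = ennreal (m / l)" using m l by (simp add: ennreal_mult[symmetric])
  finally show "(\<integral>\<^sup>+z. ennreal (\<bar>z\<bar> * cmod (complex_of_real l * K (l * z))) \<partial>lborel) \<le> ennreal (m / l)" .
qed

text \<open>Both dilates have the integral of \<open>K\<close>, so the difference has mean zero. The
  factor 3 is forced by the moments: \<open>m / D\<close> for one dilate and
  \<open>2 * m / D\<close> for the other.\<close>

lemma kernel_difference:
  assumes K: "kernel_seed K K' m 1" and m: "m > 0" and D: "D \<ge> 2"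
  shows "kernel (\<lambda>z. complex_of_real D * K (D * z) - complex_of_real (D / 2) * K (D / 2 * z))
    (\<lambda>z. complex_of_real (D\<^sup>2) * K' (D * z) - complex_of_real ((D / 2)\<^sup>2) * K' (D / 2 * z)) (3 * m) D"
proof -
  define A where "A z = complex_of_real D * K (D * z)" for z
  define A' where "A' z = complex_of_real (D\<^sup>2) * K' (D * z)" for z
  define B where "B z = complex_of_real (D / 2) * K (D / 2 * z)" for z
  define B' where "B' z = complex_of_real ((D / 2)\<^sup>2) * K' (D / 2 * z)" for z
  have A: "kernel_seed A A' m D" unfolding A_def A'_def using kernel_seed_scale[OF K m, of D] D by simp
  have B: "kernel_seed B B' m (D / 2)" unfolding B_def B'_def using kernel_seed_scale[OF K m, of "D / 2"] D by simp
  note [measurable] = kernel_seed_measurable[OF A] kernel_seed_measurable[OF B] kernel_seed_measurable[OF K]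
  have tri: "(\<integral>\<^sup>+z. ennreal (w z * cmod (F z - G z)) \<partial>lborel) \<le> ennreal (a + b)"
    if "(\<integral>\<^sup>+z. ennreal (w z * cmod (F z)) \<partial>lborel) \<le> ennreal a" "(\<integral>\<^sup>+z. ennreal (w z * cmod (G z)) \<partial>lborel) \<le> ennreal b"
      "0 \<le> a" "0 \<le> b" and [measurable]: "F \<in> borel_measurable borel" "G \<in> borel_measurable borel" "w \<in> borel_measurable borel"
      and w: "\<And>z. 0 \<le> w z"
    for a b F G and w :: "real \<Rightarrow> real"
  proof -
    have "(\<integral>\<^sup>+z. ennreal (w z * cmod (F z - G z)) \<partial>lborel) \<le> (\<integral>\<^sup>+z. ennreal (w z * cmod (F z)) + ennreal (w z * cmod (G z)) \<partial>lborel)"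
    proof (intro nn_integral_mono)
      fix z
      have "w z * cmod (F z - G z) \<le> w z * (cmod (F z) + cmod (G z))"
        by (intro mult_left_mono w norm_triangle_ineq4)
      then show "ennreal (w z * cmod (F z - G z)) \<le> ennreal (w z * cmod (F z)) + ennreal (w z * cmod (G z))"
        using w by (simp add: distrib_left ennreal_plus[symmetric] ennreal_leI del: ennreal_plus)
    qed
    also have "\<dots> \<le> ennreal a + ennreal b" using that by (simp add: nn_integral_add add_mono)
    finally show ?thesis using that by simp
  qed
  show ?thesis
    unfolding A_def[symmetric] A'_def[symmetric] B_def[symmetric] B'_def[symmetric]
  proof
    show "0 < 3 * m" "1 \<le> D" using m D by auto
    show "((\<lambda>z. A z - B z) has_vector_derivative A' z - B' z) (at z)" for z
      using A B by (auto simp: kernel_seed_def intro!: has_vector_derivative_diff)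
    show "continuous_on UNIV (\<lambda>z. A' z - B' z)"
      using A B by (auto simp: kernel_seed_def intro!: continuous_intros)
    have "(\<integral>\<^sup>+z. ennreal (cmod (A z - B z)) \<partial>lborel) \<le> ennreal (m + m)"
      using tri[of "\<lambda>_. 1" A m B m] A B m by (simp add: kernel_seed_def)
    also have "\<dots> \<le> ennreal (3 * m)" using m by (intro ennreal_leI) auto
    finally show "(\<integral>\<^sup>+z. ennreal (cmod (A z - B z)) \<partial>lborel) \<le> ennreal (3 * m)" .
    have "(\<integral>\<^sup>+z. ennreal (cmod (A' z - B' z)) \<partial>lborel) \<le> ennreal (m * D + m * (D / 2))"
      using tri[of "\<lambda>_. 1" A' "m * D" B' "m * (D / 2)"] A B m D by (simp add: kernel_seed_def)
    also have "\<dots> \<le> ennreal (3 * m * D)" using m D by (intro ennreal_leI) (simp add: field_simps)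
    finally show "(\<integral>\<^sup>+z. ennreal (cmod (A' z - B' z)) \<partial>lborel) \<le> ennreal (3 * m * D)" .
    have "(\<integral>\<^sup>+z. ennreal (\<bar>z\<bar> * cmod (A z - B z)) \<partial>lborel) \<le> ennreal (m / D + m / (D / 2))"
      using tri[of "\<lambda>z. \<bar>z\<bar>" A "m / D" B "m / (D / 2)"] A B m D by (simp add: kernel_seed_def)
    also have "m / D + m / (D / 2) = 3 * m / D" using D by (simp add: field_simps)
    finally have mom: "(\<integral>\<^sup>+z. ennreal (\<bar>z\<bar> * cmod (A z - B z)) \<partial>lborel) \<le> ennreal (3 * m / D)" .
    have int: "integrable lborel F" if "kernel_seed F F' m' l" for F F' m' l
      using that kernel_seed_measurable[OF that]
      by (intro integrableI_bounded) (auto simp: kernel_seed_def less_top[symmetric] top_unique)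
    have i: "(LINT z|lborel. complex_of_real l * K (l * z)) = (LINT z|lborel. K z)" if "l > 0" for l
      using lborel_integral_real_affine[of l K 0] that by (simp add: scaleR_conv_of_real)
    have "(LINT z|lborel. A z - B z) = (LINT z|lborel. A z) - (LINT z|lborel. B z)"
      using int[OF A] int[OF B] by simp
    also have "\<dots> = 0" using i[of D] i[of "D / 2"] D by (simp add: A_def B_def)
    finally show "D = 1 \<or> (LINT z|lborel. A z - B z) = 0 \<and>
      (\<integral>\<^sup>+z. ennreal (\<bar>z\<bar> * cmod (A z - B z)) \<partial>lborel) \<le> ennreal (3 * m / D)"
      using mom by simp
  qed
qed

text \<open>Integrability of \<open>(1 + |z|) * |K|\<close> requires cubic decay of
  \<open>K\<close>, hence three derivatives of \<open>\<phi>0\<close>. For \<open>K'\<close>, the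
  transform of \<open>\<xi> * \<phi>0 \<xi>\<close> up to a constant, quadratic decay and two
  derivatives suffice.\<close>

lemma resolution_generator_seed:
  assumes "resolution_generator \<phi>0"
  obtains K' m where "m > 0" "kernel_seed (resolution_kernel \<phi>0 0) K' m 1"
proof -
  define f where "f j = nth_deriv j \<phi>0" for j
  have sm: "smooth \<phi>0" using assms by (simp add: resolution_generator_def schwartz_def)
  have f0: "f 0 = \<phi>0" by (simp add: f_def)
  have z: "f j \<xi> = 0" if "\<bar>\<xi>\<bar> > 3 / 2" for j \<xi>
    unfolding f_def by (rule nth_deriv_eq_0[OF _ that]) (use assms in \<open>simp add: resolution_generator_def\<close>)
  have d: "(f j has_vector_derivative f (Suc j) \<xi>) (at \<xi>)" for j \<xi>
    unfolding f_def by (rule smooth_has_vector_derivative[OF sm])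
  have c: "continuous_on UNIV (f j)" for j
    unfolding f_def by (rule smooth_continuous[OF sm])
  \<comment> \<open>The support lies in \<open>[-3/2, 3/2]\<close>; the larger radius 2 ensures
    vanishing at the endpoints themselves.\<close>
  have step: "complex_of_real t * osc_int (f j) t = \<i> * osc_int (f (Suc j)) t" for j t
    by (rule osc_int_deriv[where R = 2, OF d c]) (auto intro!: z)
  define a0 where "a0 = (LINT \<xi>|lborel. cmod (f 0 \<xi>))"
  define a3 where "a3 = (LINT \<xi>|lborel. cmod (f 3 \<xi>))"
  have r0: "cmod (osc_int (f 0) t) \<le> a0" for t unfolding a0_def by (rule norm_osc_int_le)
  have r3: "\<bar>t\<bar> ^ 3 * cmod (osc_int (f 0) t) \<le> a3" for t
  proof -
    have n: "\<bar>t\<bar> * cmod (osc_int (f j) t) = cmod (osc_int (f (Suc j)) t)" for j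
      using arg_cong[OF step[of t j], of cmod] by (simp add: norm_mult)
    have "\<bar>t\<bar> ^ 3 * cmod (osc_int (f 0) t) = \<bar>t\<bar> * (\<bar>t\<bar> * (\<bar>t\<bar> * cmod (osc_int (f 0) t)))"
      by (simp only: power3_eq_cube mult.assoc)
    also have "\<dots> = cmod (osc_int (f 3) t)" unfolding n by (simp add: numeral_3_eq_3)
    finally have "\<bar>t\<bar> ^ 3 * cmod (osc_int (f 0) t) = cmod (osc_int (f 3) t)" .
    then show ?thesis unfolding a3_def using norm_osc_int_le[of "f 3" t] by simp
  qed
  \<comment> \<open>\<open>g1\<close> and \<open>g2\<close> are the first two derivatives of
    \<open>g0\<close>.\<close>
  define g0 where "g0 \<xi> = complex_of_real \<xi> * f 0 \<xi>" for \<xi>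
  define g1 where "g1 \<xi> = f 0 \<xi> + complex_of_real \<xi> * f 1 \<xi>" for \<xi>
  define g2 where "g2 \<xi> = f 1 \<xi> + (f 1 \<xi> + complex_of_real \<xi> * f 2 \<xi>)" for \<xi>
  have dx: "(complex_of_real has_vector_derivative 1) (at \<xi>)" for \<xi>
    using has_vector_derivative_of_real[of "\<lambda>x. x" 1 "at \<xi>"] by auto
  have dg0: "(g0 has_vector_derivative g1 \<xi>) (at \<xi>)" for \<xi>
    unfolding g0_def[abs_def] g1_def using has_vector_derivative_mult[OF dx d[of 0 \<xi>]] by (simp add: add.commute)
  have dg1: "(g1 has_vector_derivative g2 \<xi>) (at \<xi>)" for \<xi>
    unfolding g1_def[abs_def] g2_def
    using has_vector_derivative_add[OF d[of 0 \<xi>] has_vector_derivative_mult[OF dx d[of 1 \<xi>]]]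
    by (simp add: add.commute numeral_2_eq_2)
  have gz: "g0 \<xi> = 0" "g1 \<xi> = 0" "g2 \<xi> = 0" if "\<bar>\<xi>\<bar> > 3 / 2" for \<xi>
    using z[OF that] by (simp_all add: g0_def g1_def g2_def)
  have cg: "continuous_on UNIV g0" "continuous_on UNIV g1" "continuous_on UNIV g2"
    unfolding g0_def[abs_def] g1_def[abs_def] g2_def[abs_def] by (intro continuous_intros c)+
  have s1: "complex_of_real t * osc_int g0 t = \<i> * osc_int g1 t" for t
    by (rule osc_int_deriv[where R = 2, OF dg0 cg(2)]) (auto intro!: gz)
  have s2: "complex_of_real t * osc_int g1 t = \<i> * osc_int g2 t" for t
    by (rule osc_int_deriv[where R = 2, OF dg1 cg(3)]) (auto intro!: gz)
  define b0 where "b0 = (LINT \<xi>|lborel. cmod (g0 \<xi>))"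
  define b2 where "b2 = (LINT \<xi>|lborel. cmod (g2 \<xi>))"
  have q0: "cmod (osc_int g0 t) \<le> b0" for t unfolding b0_def by (rule norm_osc_int_le)
  have q2: "t\<^sup>2 * cmod (osc_int g0 t) \<le> b2" for t
  proof -
    have "t\<^sup>2 * cmod (osc_int g0 t) = \<bar>t\<bar> * (\<bar>t\<bar> * cmod (osc_int g0 t))"
      by (simp only: power2_abs[symmetric, of t] power2_eq_square mult.assoc)
    also have "\<dots> = cmod (osc_int g2 t)"
      using arg_cong[OF s1[of t], of cmod] arg_cong[OF s2[of t], of cmod] by (simp add: norm_mult)
    finally have "t\<^sup>2 * cmod (osc_int g0 t) = cmod (osc_int g2 t)" .
    then show ?thesis unfolding b2_def using norm_osc_int_le[of g2 t] by simp
  qed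
  define c0 where "c0 = complex_of_real (1 / (2 * pi))"
  define K where "K = resolution_kernel \<phi>0 0"
  have Kdef: "K = (\<lambda>z. c0 * osc_int (f 0) z)"
    by (simp add: K_def resolution_kernel_def fun_eq_iff resolution_def[abs_def] f0 c0_def)
  define K' where "K' = (\<lambda>z. c0 * (\<i> * osc_int g0 z))"
  have K'd: "(K has_vector_derivative K' x) (at x)" for x
    unfolding Kdef K'_def g0_def[abs_def]
    by (intro has_vector_derivative_mult_right osc_int_has_vector_derivative[where R = 2] c) (auto intro!: z)
  have K'c: "continuous_on UNIV K'"
    unfolding K'_def
    by (intro continuous_intros continuous_at_imp_continuous_on ballI
          has_vector_derivative_continuous[OF osc_int_has_vector_derivative[where R = 2]] cg) (auto intro!: gz)
  have bd: "(1 + \<bar>t\<bar>) * cmod (K t) * (1 + t\<^sup>2) \<le> cmod c0 * (4 * (a0 + a3))" for t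
  proof -
    have "(1 + \<bar>t\<bar>) * (1 + t\<^sup>2) \<le> 4 * (1 + \<bar>t\<bar> ^ 3)"
    proof -
      \<comment> \<open>With \<open>s = |t|\<close>, the factor \<open>1 + s\<close> splits off from
        \<open>1 + s^3\<close>, and
        \<open>4 * (1 - s + s^2) - (1 + s^2) = 3 * (s - 1)^2 + 2 * s\<close>.\<close>
      have "0 \<le> (1 + \<bar>t\<bar>) * (3 * (\<bar>t\<bar> - 1)\<^sup>2 + 2 * \<bar>t\<bar>)"
        by (intro mult_nonneg_nonneg add_nonneg_nonneg) auto
      also have "\<dots> = 4 * (1 + \<bar>t\<bar> ^ 3) - (1 + \<bar>t\<bar>) * (1 + t\<^sup>2)"
        by (simp add: power2_eq_square power3_eq_cube algebra_simps)
      finally show ?thesis by simp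
    qed
    then have "((1 + \<bar>t\<bar>) * (1 + t\<^sup>2)) * cmod (osc_int (f 0) t) \<le> (4 * (1 + \<bar>t\<bar> ^ 3)) * cmod (osc_int (f 0) t)"
      by (intro mult_right_mono) auto
    also have "\<dots> = 4 * (cmod (osc_int (f 0) t) + \<bar>t\<bar> ^ 3 * cmod (osc_int (f 0) t))" by (simp add: algebra_simps)
    also have "\<dots> \<le> 4 * (a0 + a3)" using r0[of t] r3[of t] by simp
    finally have "cmod c0 * (((1 + \<bar>t\<bar>) * (1 + t\<^sup>2)) * cmod (osc_int (f 0) t)) \<le> cmod c0 * (4 * (a0 + a3))"
      by (intro mult_left_mono) auto
    then show ?thesis unfolding Kdef by (simp add: norm_mult ac_simps)
  qed
  have "(\<integral>\<^sup>+z. ennreal ((1 + \<bar>z\<bar>) * cmod (K z)) \<partial>lborel) < \<infinity>"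
    by (rule decay_finite_integral[OF _ bd]) simp
  then obtain m1 where m1: "(\<integral>\<^sup>+z. ennreal ((1 + \<bar>z\<bar>) * cmod (K z)) \<partial>lborel) = ennreal m1" "m1 \<ge> 0"
    by (metis ennreal_cases infinity_ennreal_def less_irrefl)
  have bd': "cmod (K' t) * (1 + t\<^sup>2) \<le> cmod c0 * (b0 + b2)" for t
  proof -
    have "cmod c0 * (cmod (osc_int g0 t) + t\<^sup>2 * cmod (osc_int g0 t)) \<le> cmod c0 * (b0 + b2)"
      using q0[of t] q2[of t] by (intro mult_left_mono add_mono) auto
    then show ?thesis unfolding K'_def by (simp add: norm_mult algebra_simps)
  qed
  have "(\<integral>\<^sup>+z. ennreal (cmod (K' z)) \<partial>lborel) < \<infinity>"
    by (rule decay_finite_integral[OF _ bd']) simp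
  then obtain m2 where m2: "(\<integral>\<^sup>+z. ennreal (cmod (K' z)) \<partial>lborel) = ennreal m2" "m2 \<ge> 0"
    by (metis ennreal_cases infinity_ennreal_def less_irrefl)
  \<comment> \<open>\<open>m1\<close> bounds both integrals of \<open>K\<close>, thanks to the
    weight \<open>1 + |z|\<close>, and the summand 1 makes the constant positive.\<close>
  have "kernel_seed K K' (m1 + m2 + 1) 1"
    unfolding kernel_seed_def
  proof (intro conjI allI K'd K'c)
    have le: "ennreal m1 \<le> ennreal (m1 + m2 + 1)" "ennreal m2 \<le> ennreal ((m1 + m2 + 1) * 1)"
      using m1(2) m2(2) by (auto intro!: ennreal_leI)
    show "(\<integral>\<^sup>+z. ennreal (cmod (K z)) \<partial>lborel) \<le> ennreal (m1 + m2 + 1)"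
      by (rule order_trans[OF _ le(1)], unfold m1(1)[symmetric])
        (auto intro!: nn_integral_mono ennreal_leI simp: distrib_right)
    show "(\<integral>\<^sup>+z. ennreal (\<bar>z\<bar> * cmod (K z)) \<partial>lborel) \<le> ennreal ((m1 + m2 + 1) / 1)"
      unfolding div_by_1
      by (rule order_trans[OF _ le(1)], unfold m1(1)[symmetric])
        (auto intro!: nn_integral_mono ennreal_leI simp: distrib_right)
    show "(\<integral>\<^sup>+z. ennreal (cmod (K' z)) \<partial>lborel) \<le> ennreal ((m1 + m2 + 1) * 1)"
      using le(2) m2(1) by simp
  qed
  moreover have "m1 + m2 + 1 > 0" using m1(2) m2(2) by linarith
  ultimately show ?thesis using that unfolding K_def by blast
qed

lemma resolution_continuous:
  assumes "resolution_generator \<phi>0"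
  shows "continuous_on UNIV (resolution \<phi>0 d)"
proof -
  have "smooth \<phi>0" using assms by (simp add: resolution_generator_def schwartz_def)
  then have c: "continuous_on UNIV \<phi>0" using smooth_continuous[of \<phi>0 UNIV 0] by simp
  show ?thesis
    unfolding resolution_def[abs_def]
    by (cases "d = 0") (auto intro!: continuous_intros continuous_on_compose2[OF c])
qed

lemma resolution_eq_0:
  assumes "resolution_generator \<phi>0" "\<bar>t\<bar> > 2 ^ (d + 1)"
  shows "resolution \<phi>0 d t = 0"
proof -
  have z: "\<phi>0 t = 0" if "\<bar>t\<bar> \<ge> 2" for t using assms that by (simp add: resolution_generator_def)
  show ?thesis
  proof (cases "d = 0")
    case True
    then show ?thesis using assms z by (simp add: resolution_def)
  next
    case False
    have p: "2 powr (- real d) * 2 ^ (d + 1) = 2"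
      by (simp add: powr_minus powr_realpow field_simps)
    have "2 = 2 powr (- real d) * 2 ^ (d + 1)" using p by simp
    also have "\<dots> \<le> 2 powr (- real d) * \<bar>t\<bar>" using assms by (intro mult_left_mono) auto
    finally have 1: "2 \<le> 2 powr (- real d) * \<bar>t\<bar>" .
    have "2 powr (- real d + 1) = 2 * 2 powr (- real d)" using powr_add[of 2 "- real d" 1] by simp
    then have 2: "2 \<le> 2 powr (- real d + 1) * \<bar>t\<bar>" using 1 by simp
    show ?thesis using 1 2 False by (simp add: resolution_def z abs_mult)
  qed
qed

lemma integrable_resolution:
  assumes "resolution_generator \<phi>0"
  shows "integrable lborel (resolution \<phi>0 d)"
  by (rule integrable_compact_support[OF resolution_continuous resolution_eq_0]) (use assms in auto)

text \<open>By definition \<open>resolution \<phi>0 d\<close> is the difference of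
  \<open>\<phi>0\<close> stretched by \<open>2 ^ d\<close> and by \<open>2 ^ d / 2\<close>;
  stretching in frequency is compression in space.\<close>

lemma resolution_kernel_pos:
  assumes \<phi>0: "resolution_generator \<phi>0" and d: "d > 0"
  shows "resolution_kernel \<phi>0 d z =
    complex_of_real (2 ^ d) * resolution_kernel \<phi>0 0 (2 ^ d * z) -
    complex_of_real (2 ^ d / 2) * resolution_kernel \<phi>0 0 (2 ^ d / 2 * z)"
proof -
  have r0: "resolution \<phi>0 0 = \<phi>0" by (simp add: resolution_def fun_eq_iff)
  have p: "2 powr (- real d) = 1 / 2 ^ d" by (simp add: powr_minus powr_realpow field_simps)
  then have p': "2 powr (- real d + 1) = 1 / (2 ^ d / 2)" using powr_add[of 2 "- real d" 1] by simp
  have e: "resolution \<phi>0 d = (\<lambda>t. \<phi>0 (t / 2 ^ d) - \<phi>0 (t / (2 ^ d / 2)))"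
    unfolding resolution_def[abs_def] p p' using d by (simp add: fun_eq_iff mult.commute)
  have int: "integrable lborel \<phi>0" using integrable_resolution[OF \<phi>0, of 0] by (simp add: r0)
  have i: "integrable lborel (\<lambda>t. osc z t * \<phi>0 (t / l))" if "l > 0" for l
    by (intro integrable_osc_mult) (use lborel_integrable_real_affine[OF int, of "1 / l" 0] that in simp)
  have "osc_int (resolution \<phi>0 d) z = osc_int (\<lambda>t. \<phi>0 (t / 2 ^ d)) z - osc_int (\<lambda>t. \<phi>0 (t / (2 ^ d / 2))) z"
    unfolding e osc_int_def right_diff_distrib
    by (rule Bochner_Integration.integral_diff; rule i; simp)
  also have "\<dots> = complex_of_real (2 ^ d) * osc_int \<phi>0 (2 ^ d * z) - complex_of_real (2 ^ d / 2) * osc_int \<phi>0 (2 ^ d / 2 * z)"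
    using osc_int_affine[of "2 ^ d" \<phi>0 z] osc_int_affine[of "2 ^ d / 2" \<phi>0 z] by simp
  finally show ?thesis
    by (simp add: resolution_kernel_def r0 right_diff_distrib mult.left_commute)
qed

text \<open>One \<open>C\<close> has to serve all levels, since the estimates are later combined
  over \<open>d\<close>.\<close>

lemma resolution_kernel_kernel:
  assumes \<phi>0: "resolution_generator \<phi>0"
  obtains C where "C > 0" "\<And>d. \<exists>K'. kernel (resolution_kernel \<phi>0 d) K' C (2 ^ d)"
proof -
  obtain K' m where m: "m > 0" and K: "kernel_seed (resolution_kernel \<phi>0 0) K' m 1"
    using resolution_generator_seed[OF \<phi>0] .
  have "\<exists>K'. kernel (resolution_kernel \<phi>0 d) K' (3 * m) (2 ^ d)" for d
  proof (cases "d = 0")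
    case True
    have le: "ennreal m \<le> ennreal (3 * m)" using m by (intro ennreal_leI) auto
    have "kernel (resolution_kernel \<phi>0 0) K' (3 * m) 1"
      using K m unfolding kernel_seed_def by unfold_locales (auto intro: order_trans[OF _ le])
    then show ?thesis using True by auto
  next
    case False
    then have "(2::real) ^ 1 \<le> 2 ^ d" by (intro power_increasing) auto
    then have "kernel (\<lambda>z. complex_of_real (2 ^ d) * resolution_kernel \<phi>0 0 (2 ^ d * z) -
         complex_of_real (2 ^ d / 2) * resolution_kernel \<phi>0 0 (2 ^ d / 2 * z))
      (\<lambda>z. complex_of_real ((2 ^ d)\<^sup>2) * K' (2 ^ d * z) - complex_of_real ((2 ^ d / 2)\<^sup>2) * K' (2 ^ d / 2 * z)) (3 * m) (2 ^ d)"
      by (intro kernel_difference[OF K m]) simp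
    moreover have "(\<lambda>z. complex_of_real (2 ^ d) * resolution_kernel \<phi>0 0 (2 ^ d * z) -
         complex_of_real (2 ^ d / 2) * resolution_kernel \<phi>0 0 (2 ^ d / 2 * z)) = resolution_kernel \<phi>0 d"
      using False by (intro ext resolution_kernel_pos[OF \<phi>0, symmetric]) simp
    ultimately show ?thesis by metis
  qed
  with m show ?thesis by (intro that[of "3 * m"]) auto
qed

subsection \<open>Fourier multipliers on regular distributions\<close>

text \<open>The product of two integrable functions of separate variables dominates the integrand up
  to the factor \<open>B\<close>. This is used once between space and frequency and once to move a
  convolution from the test function to the distribution.\<close>

lemma Fubini_bounded_kernel:
  fixes f g :: "real \<Rightarrow> complex" and k :: "real \<Rightarrow> real \<Rightarrow> complex"
  assumes f: "integrable lborel f" and g: "integrable lborel g"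
    and k: "(\<lambda>z. k (fst z) (snd z)) \<in> borel_measurable (borel \<Otimes>\<^sub>M borel)"
    and B: "\<And>x y. cmod (k x y) \<le> B"
  shows "(LINT x|lborel. f x * (LINT y|lborel. g y * k x y)) = (LINT y|lborel. g y * (LINT x|lborel. f x * k x y))"
proof -
  note [measurable] = borel_measurable_integrable[OF f] borel_measurable_integrable[OF g]
  have k2[measurable]: "(\<lambda>z. k (fst z) (snd z)) \<in> borel_measurable (lborel \<Otimes>\<^sub>M lborel)"
    using k by (simp cong: measurable_cong_sets)
  have B0: "B \<ge> 0" using B[of 0 0] norm_ge_zero order_trans by blast
  have "integrable (lborel \<Otimes>\<^sub>M lborel) (\<lambda>z. f (fst z) * (g (snd z) * k (fst z) (snd z)))"
  proof (rule integrableI_bounded)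
    show "(\<lambda>z. f (fst z) * (g (snd z) * k (fst z) (snd z))) \<in> borel_measurable (lborel \<Otimes>\<^sub>M lborel)"
      by measurable
    have "(\<integral>\<^sup>+z. ennreal (norm (f (fst z) * (g (snd z) * k (fst z) (snd z)))) \<partial>(lborel \<Otimes>\<^sub>M lborel)) \<le>
       (\<integral>\<^sup>+z. ennreal (cmod (f (fst z))) * (ennreal (cmod (g (snd z))) * ennreal B) \<partial>(lborel \<Otimes>\<^sub>M lborel))"
      using B0 B by (intro nn_integral_mono)
        (auto simp: norm_mult ennreal_mult[symmetric] intro!: ennreal_leI mult_left_mono)
    also have "\<dots> = (\<integral>\<^sup>+x. \<integral>\<^sup>+y. ennreal (cmod (f x)) * (ennreal (cmod (g y)) * ennreal B) \<partial>lborel \<partial>lborel)"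
      using lborel.nn_integral_fst[of "\<lambda>z. ennreal (cmod (f (fst z))) * (ennreal (cmod (g (snd z))) * ennreal B)" lborel] by simp
    also have "\<dots> = (\<integral>\<^sup>+x. ennreal (cmod (f x)) \<partial>lborel) * ((\<integral>\<^sup>+y. ennreal (cmod (g y)) \<partial>lborel) * ennreal B)"
      by (simp add: nn_integral_cmult nn_integral_multc)
    also have "\<dots> < \<infinity>"
      using f g unfolding integrable_iff_bounded by (simp add: ennreal_mult_less_top)
    finally show "(\<integral>\<^sup>+z. ennreal (norm (f (fst z) * (g (snd z) * k (fst z) (snd z)))) \<partial>(lborel \<Otimes>\<^sub>M lborel)) < \<infinity>" .
  qed
  then have "integrable (lborel \<Otimes>\<^sub>M lborel) (case_prod (\<lambda>x y. f x * (g y * k x y)))"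
    by (simp add: case_prod_unfold)
  moreover have "(LINT x|lborel. f x * (g y * k x y)) = g y * (LINT x|lborel. f x * k x y)" for y
    unfolding mult.left_commute[of "f _"] by (rule integral_mult_right_zero)
  ultimately show ?thesis using lborel_pair.Fubini_integral[of "\<lambda>x y. f x * (g y * k x y)"] by simp
qed

lemma schwartz_continuous: "f \<in> schwartz \<Longrightarrow> continuous_on A f"
  using smooth_continuous[of f A 0] by (simp add: schwartz_def)

lemma schwartz_measurable: "f \<in> schwartz \<Longrightarrow> f \<in> borel_measurable borel"
  by (intro borel_measurable_continuous_onI schwartz_continuous)

lemma schwartz_seminorm_ge:
  assumes "f \<in> schwartz"
  shows "norm (x ^ k *\<^sub>R nth_deriv m f x) \<le> schwartz_seminorm k m f"
  unfolding schwartz_seminorm_def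
proof (rule cSUP_upper)
  have "bounded (range (\<lambda>x. x ^ k *\<^sub>R nth_deriv m f x))" using assms by (simp add: schwartz_def)
  then show "bdd_above (range (\<lambda>x. norm (x ^ k *\<^sub>R nth_deriv m f x)))"
    by (auto simp: bounded_iff bdd_above_def)
qed simp

lemma schwartz_integrable:
  assumes f: "f \<in> schwartz"
  shows "integrable lborel f"
proof (rule integrableI_bounded)
  show "f \<in> borel_measurable lborel" using schwartz_measurable[OF f] by simp
  show "(\<integral>\<^sup>+x. ennreal (norm (f x)) \<partial>lborel) < \<infinity>"
  proof (rule decay_finite_integral)
    fix z
    show "norm (f z) * (1 + z\<^sup>2) \<le> schwartz_seminorm 0 0 f + schwartz_seminorm 2 0 f"
      using schwartz_seminorm_ge[OF f, of z 0 0] schwartz_seminorm_ge[OF f, of z 2 0]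
      by (simp add: algebra_simps)
  qed simp
qed

lemma inv_sqrt_2pi_squared: "complex_of_real (1 / sqrt (2 * pi)) * (complex_of_real (1 / sqrt (2 * pi)) * w) = complex_of_real (1 / (2 * pi)) * w"
proof -
  have "sqrt (2 * pi) * sqrt (2 * pi) = 2 * pi" by (subst real_sqrt_mult_self) simp
  then have "1 / sqrt (2 * pi) * (1 / sqrt (2 * pi)) = 1 / (2 * pi)"
    by (simp only: times_divide_times_eq mult_1)
  then show ?thesis by (metis mult.assoc of_real_mult)
qed

text \<open>Every operation on a distribution is carried out on the test function, in reverse order.
  The outcome is the transpose of convolution with the kernel, hence the argument
  \<open>x - y\<close> with integration over \<open>x\<close>.\<close>

lemma fourier_multiplier:
  assumes \<phi>0: "resolution_generator \<phi>0" and f: "integrable lborel f"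
  shows "fourier (\<lambda>\<xi>. resolution \<phi>0 d \<xi> * inv_fourier f \<xi>) y = (LINT x|lborel. f x * resolution_kernel \<phi>0 d (x - y))"
proof -
  define c where "c = complex_of_real (1 / sqrt (2 * pi))"
  define h where "h = resolution \<phi>0 d"
  have h: "integrable lborel h" unfolding h_def by (rule integrable_resolution[OF \<phi>0])
  have osc: "exp (- (\<i> * complex_of_real (\<xi> * y))) * exp (\<i> * complex_of_real (\<xi> * x)) = osc (x - y) \<xi>" for \<xi> x
    by (simp add: osc_def exp_add[symmetric] algebra_simps)
  have "fourier (\<lambda>\<xi>. h \<xi> * inv_fourier f \<xi>) y =
      c * (LINT \<xi>|lborel. exp (- (\<i> * complex_of_real (\<xi> * y))) * (h \<xi> * (c * (LINT x|lborel. exp (\<i> * complex_of_real (\<xi> * x)) * f x))))"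
    by (simp only: fourier_def inv_fourier_def c_def)
  also have "\<dots> = c * (LINT \<xi>|lborel. c * (h \<xi> * (LINT x|lborel. f x * osc (x - y) \<xi>)))"
  proof -
    have eq: "exp (- (\<i> * complex_of_real (\<xi> * y))) * (h \<xi> * (c * (LINT x|lborel. exp (\<i> * complex_of_real (\<xi> * x)) * f x))) =
        c * (h \<xi> * (LINT x|lborel. f x * osc (x - y) \<xi>))" for \<xi>
    proof -
      have "(LINT x|lborel. f x * osc (x - y) \<xi>) = (LINT x|lborel. exp (- (\<i> * complex_of_real (\<xi> * y))) * (exp (\<i> * complex_of_real (\<xi> * x)) * f x))"
        unfolding osc[symmetric] by (simp add: ac_simps)
      also have "\<dots> = exp (- (\<i> * complex_of_real (\<xi> * y))) * (LINT x|lborel. exp (\<i> * complex_of_real (\<xi> * x)) * f x)"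
        by (rule integral_mult_right_zero)
      finally show ?thesis by (simp only: ac_simps)
    qed
    show ?thesis by (simp only: eq)
  qed
  also have "\<dots> = c * (c * (LINT \<xi>|lborel. h \<xi> * (LINT x|lborel. f x * osc (x - y) \<xi>)))"
    by simp
  also have "(LINT \<xi>|lborel. h \<xi> * (LINT x|lborel. f x * osc (x - y) \<xi>)) = (LINT x|lborel. f x * (LINT \<xi>|lborel. h \<xi> * osc (x - y) \<xi>))"
    by (rule Fubini_bounded_kernel[OF h f, where B = 1]) simp_all
  also have "c * (c * \<dots>) = complex_of_real (1 / (2 * pi)) * \<dots>"
    unfolding c_def by (rule inv_sqrt_2pi_squared)
  also have "\<dots> = (LINT x|lborel. f x * resolution_kernel \<phi>0 d (x - y))"
    unfolding resolution_kernel_def osc_int_def h_def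
    by (subst integral_mult_right_zero[symmetric]) (simp add: ac_simps)
  finally show ?thesis by (simp only: h_def)
qed

section \<open>Regular distributions of bounded functions supported in the unit interval\<close>

definition regular_distr :: "(real \<Rightarrow> real) \<Rightarrow> distr" where
  "regular_distr g = (\<lambda>\<psi>. LINT t|lborel. complex_of_real (g t) * \<psi> t)"

context
  fixes g :: "real \<Rightarrow> real" and B :: real
  assumes g_measurable [measurable]: "g \<in> borel_measurable borel"
    and g_bound: "\<And>t. \<bar>g t\<bar> \<le> B * indicator {0..1} t"
begin

lemma g_bound': "\<bar>g t\<bar> \<le> B"
proof -
  have "0 \<le> B" using g_bound[of 0] by simp
  then show ?thesis using g_bound[of t] by (cases "t \<in> {0..1}") auto
qed

lemma integrable_g: "integrable lborel (\<lambda>t. complex_of_real (g t))"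
proof (rule Bochner_Integration.integrable_bound)
  show "integrable lborel (\<lambda>t. B * indicator {0..1::real} t)"
    by (intro integrable_mult_right) simp
  show "AE t in lborel. norm (complex_of_real (g t)) \<le> norm (B * indicator {0..1} t)"
    using g_bound by (intro always_eventually allI) (auto intro: order_trans[OF _ abs_ge_self])
qed measurable

lemma integrable_g_mult:
  assumes [measurable]: "f \<in> borel_measurable borel" and M: "\<And>t. cmod (f t) \<le> M"
  shows "integrable lborel (\<lambda>t. complex_of_real (g t) * f t)"
proof (rule Bochner_Integration.integrable_bound)
  show "integrable lborel (\<lambda>t. complex_of_real M * complex_of_real (g t))"
    by (intro integrable_mult_right integrable_g)
  show "AE t in lborel. norm (complex_of_real (g t) * f t) \<le> norm (complex_of_real M * complex_of_real (g t))"
    using order_trans[OF M abs_ge_self] by (intro always_eventually allI) (auto simp: norm_mult mult.commute[of "\<bar>M\<bar>"] intro!: mult_left_mono)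
qed measurable

lemma integrable_g_schwartz:
  assumes f: "f \<in> schwartz"
  shows "integrable lborel (\<lambda>t. complex_of_real (g t) * f t)"
  using schwartz_seminorm_ge[OF f, of _ 0 0] by (intro integrable_g_mult[OF schwartz_measurable[OF f]]) auto

text \<open>Continuity holds with the seminorm of order zero alone, the constant being the integral
  of \<open>|g|\<close>.\<close>

lemma tempered_regular_distr: "tempered (regular_distr g)"
  unfolding tempered_def regular_distr_def
proof (intro conjI ballI allI exI[of _ "LINT t|lborel. \<bar>g t\<bar>"] exI[of _ 0])
  fix f h :: "real \<Rightarrow> complex" assume "f \<in> schwartz" "h \<in> schwartz"
  then show "(LINT t|lborel. complex_of_real (g t) * (f t + h t)) =
      (LINT t|lborel. complex_of_real (g t) * f t) + (LINT t|lborel. complex_of_real (g t) * h t)"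
    by (simp add: distrib_left integrable_g_schwartz)
next
  fix c and f :: "real \<Rightarrow> complex"
  show "(LINT t|lborel. complex_of_real (g t) * (c * f t)) = c * (LINT t|lborel. complex_of_real (g t) * f t)"
    by (simp add: mult.left_commute[of _ c])
next
  fix f :: "real \<Rightarrow> complex" assume f: "f \<in> schwartz"
  have "cmod (LINT t|lborel. complex_of_real (g t) * f t) \<le> (LINT t|lborel. cmod (complex_of_real (g t) * f t))"
    by (rule integral_norm_bound)
  also have "\<dots> \<le> (LINT t|lborel. \<bar>g t\<bar> * schwartz_seminorm 0 0 f)"
  proof (rule integral_mono)
    show "integrable lborel (\<lambda>t. cmod (complex_of_real (g t) * f t))"
      by (intro integrable_norm integrable_g_schwartz f)
    show "integrable lborel (\<lambda>t. \<bar>g t\<bar> * schwartz_seminorm 0 0 f)"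
      using integrable_norm[OF integrable_g] by (intro integrable_mult_left) simp
    fix t show "cmod (complex_of_real (g t) * f t) \<le> \<bar>g t\<bar> * schwartz_seminorm 0 0 f"
      using schwartz_seminorm_ge[OF f, of t 0 0] by (simp add: norm_mult mult_left_mono)
  qed
  finally show "cmod (LINT t|lborel. complex_of_real (g t) * f t) \<le>
     (LINT t|lborel. \<bar>g t\<bar>) * (\<Sum>k\<le>0. \<Sum>m\<le>0. schwartz_seminorm k m f)" by simp
qed

text \<open>The convolution is an admissible representing function in the infimum that defines the
  norm of the distribution.\<close>

lemma Lp_norm_distr_regular_le:
  assumes \<phi>0: "resolution_generator \<phi>0" and K: "kernel (resolution_kernel \<phi>0 d) K' C D"
  shows "Lp_norm_distr p (inv_fourier_distr (mult_distr (resolution \<phi>0 d) (fourier_distr (regular_distr g))))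
     \<le> Lp_norm p (conv (resolution_kernel \<phi>0 d) g)"
  unfolding Lp_norm_distr_def
proof (rule Inf_lower, rule CollectI, intro exI conjI ballI)
  interpret kernel "resolution_kernel \<phi>0 d" K' C D by (rule K)
  have m: "conv (resolution_kernel \<phi>0 d) g \<in> borel_measurable borel" by measurable
  then show "conv (resolution_kernel \<phi>0 d) g \<in> borel_measurable lborel" by simp
  fix f assume f: "f \<in> schwartz"
  show "integrable lborel (\<lambda>x. conv (resolution_kernel \<phi>0 d) g x * f x)"
  proof (rule Bochner_Integration.integrable_bound)
    show "integrable lborel (\<lambda>x. complex_of_real (B * C) * f x)"
      by (intro integrable_mult_right schwartz_integrable f)
    show "(\<lambda>x. conv (resolution_kernel \<phi>0 d) g x * f x) \<in> borel_measurable lborel"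
      using m schwartz_measurable[OF f] by measurable
    show "AE x in lborel. norm (conv (resolution_kernel \<phi>0 d) g x * f x) \<le> norm (complex_of_real (B * C) * f x)"
      using order_trans[OF norm_conv_le[OF g_measurable g_bound'] abs_ge_self]
      by (intro always_eventually allI) (auto simp: norm_mult abs_mult intro!: mult_right_mono)
  qed
  \<comment> \<open>The kernel is the transform of an integrable function and therefore bounded, as
    the exchange of integrals requires.\<close>
  define M where "M = cmod (complex_of_real (1 / (2 * pi))) * (LINT \<xi>|lborel. cmod (resolution \<phi>0 d \<xi>))"
  have M: "cmod (resolution_kernel \<phi>0 d z) \<le> M" for z
    unfolding resolution_kernel_def M_def norm_mult by (intro mult_left_mono norm_osc_int_le) auto
  have "inv_fourier_distr (mult_distr (resolution \<phi>0 d) (fourier_distr (regular_distr g))) f =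
     (LINT y|lborel. complex_of_real (g y) * (LINT x|lborel. f x * resolution_kernel \<phi>0 d (x - y)))"
    unfolding inv_fourier_distr_def mult_distr_def fourier_distr_def regular_distr_def
    by (simp only: fourier_multiplier[OF \<phi>0 schwartz_integrable[OF f]])
  also have "\<dots> = (LINT x|lborel. f x * (LINT y|lborel. complex_of_real (g y) * resolution_kernel \<phi>0 d (x - y)))"
    by (rule Fubini_bounded_kernel[OF integrable_g schwartz_integrable[OF f], where B = M and k = "\<lambda>y x. resolution_kernel \<phi>0 d (x - y)"])
      (auto simp: M)
  also have "\<dots> = (LINT x|lborel. conv (resolution_kernel \<phi>0 d) g x * f x)"
    by (simp add: conv_def mult.commute)
  finally show "inv_fourier_distr (mult_distr (resolution \<phi>0 d) (fourier_distr (regular_distr g))) f =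
     (LINT x|lborel. conv (resolution_kernel \<phi>0 d) g x * f x)" .
qed (rule refl)

end

subsection \<open>Littlewood-Paley pieces of the discrepancy\<close>

lemma sum_powers_inj_le:
  fixes \<rho> :: real
  assumes "finite S" "inj_on \<sigma> S" "0 \<le> \<rho>" "\<rho> < 1"
  shows "(\<Sum>j\<in>S. \<rho> ^ \<sigma> j) \<le> 1 / (1 - \<rho>)"
proof -
  have "(\<Sum>j\<in>S. \<rho> ^ \<sigma> j) = (\<Sum>i\<in>\<sigma> ` S. \<rho> ^ i)"
    using assms by (simp add: sum.reindex)
  also have "\<dots> \<le> (\<Sum>i. \<rho> ^ i)"
    using assms by (intro sum_le_suminf) (auto simp: summable_geometric)
  also have "\<dots> = 1 / (1 - \<rho>)" using assms by (intro suminf_geometric) auto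
  finally show ?thesis .
qed

text \<open>The largest term dominates: counted downwards from \<open>Max S\<close> the terms
  decrease at least geometrically with ratio \<open>b powr (-\<alpha>)\<close>.\<close>

lemma sum_powers_below:
  fixes \<alpha> X :: real
  assumes b: "b \<ge> (2::nat)" and \<alpha>: "\<alpha> > 0" and S: "finite S" "\<And>j. j \<in> S \<Longrightarrow> real (b ^ j) \<le> X"
  shows "(\<Sum>j\<in>S. real (b ^ j) powr \<alpha>) \<le> X powr \<alpha> * (1 / (1 - b powr (-\<alpha>)))"
proof (cases "S = {}")
  case False
  define m where "m = Max S"
  have m: "m \<in> S" "\<And>j. j \<in> S \<Longrightarrow> j \<le> m" using S False by (auto simp: m_def)
  have \<rho>: "b powr (-\<alpha>) < 1" using b \<alpha> by (simp add: powr_less_one)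
  have "(\<Sum>j\<in>S. real (b ^ j) powr \<alpha>) \<le> (\<Sum>j\<in>S. X powr \<alpha> * (b powr (-\<alpha>)) ^ (m - j))"
  proof (intro sum_mono)
    fix j assume j: "j \<in> S"
    have "real (b ^ j) = real (b ^ m) * (1 / b) ^ (m - j)"
      using b m(2)[OF j] by (simp add: power_divide power_diff)
    then have "real (b ^ j) powr \<alpha> = real (b ^ m) powr \<alpha> * ((1 / b) ^ (m - j)) powr \<alpha>"
      by (simp add: powr_mult)
    also have "((1 / b) ^ (m - j)) powr \<alpha> = (b powr (-\<alpha>)) ^ (m - j)"
      using b by (simp add: powr_realpow[symmetric] powr_powr powr_minus powr_divide powr_one mult.commute power_divide inverse_eq_divide)
    also have "real (b ^ m) powr \<alpha> * (b powr (-\<alpha>)) ^ (m - j) \<le> X powr \<alpha> * (b powr (-\<alpha>)) ^ (m - j)"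
      using S(2)[OF m(1)] \<alpha> by (intro mult_right_mono powr_mono2) auto
    finally show "real (b ^ j) powr \<alpha> \<le> X powr \<alpha> * (b powr (-\<alpha>)) ^ (m - j)" .
  qed
  also have "\<dots> = X powr \<alpha> * (\<Sum>j\<in>S. (b powr (-\<alpha>)) ^ (m - j))" by (simp add: sum_distrib_left)
  also have "\<dots> \<le> X powr \<alpha> * (1 / (1 - b powr (-\<alpha>)))"
  proof (intro mult_left_mono sum_powers_inj_le S(1) \<rho>)
    show "inj_on ((-) m) S" using m(2) by (intro inj_onI) (metis diff_diff_cancel)
  qed auto
  finally show ?thesis .
next
  case True
  have "b powr (-\<alpha>) < 1" using b \<alpha> by (simp add: powr_less_one)
  then show ?thesis using True by simp
qed

text \<open>The smallest position dominates; the ratio \<open>1 / b\<close> is at most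
  \<open>1 / 2\<close>, which gives the bound 2.\<close>

lemma sum_inverse_powers_above:
  fixes X :: real
  assumes b: "b \<ge> (2::nat)" and S: "finite S" "\<And>j. j \<in> S \<Longrightarrow> X \<le> real (b ^ j)"
  shows "(\<Sum>j\<in>S. X / real (b ^ j)) \<le> 2"
proof (cases "S = {}")
  case False
  define m where "m = Min S"
  have m: "m \<in> S" "\<And>j. j \<in> S \<Longrightarrow> m \<le> j" using S False by (auto simp: m_def)
  have "(\<Sum>j\<in>S. X / real (b ^ j)) \<le> (\<Sum>j\<in>S. (1 / 2) ^ (j - m))"
  proof (intro sum_mono)
    fix j assume j: "j \<in> S"
    have "X / real (b ^ j) \<le> real (b ^ m) / real (b ^ j)"
      using S(2)[OF m(1)] by (intro divide_right_mono) auto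
    also have "\<dots> = (1 / b) ^ (j - m)" using b m(2)[OF j] by (simp add: power_divide power_diff)
    also have "\<dots> \<le> (1 / 2) ^ (j - m)" using b by (intro power_mono) (auto simp: field_simps)
    finally show "X / real (b ^ j) \<le> (1 / 2) ^ (j - m)" .
  qed
  also have "\<dots> \<le> 1 / (1 - 1 / 2)"
  proof (intro sum_powers_inj_le S(1))
    show "inj_on (\<lambda>j. j - m) S" using m(2) by (intro inj_onI) (metis le_add_diff_inverse2)
  qed auto
  finally show ?thesis by simp
qed simp

text \<open>Both regimes peak at \<open>b ^ j ~ D\<close> and fall off geometrically away from it,
  so the sum is bounded even though the number of positions is not. If \<open>X < D\<close>, the
  peak is out of reach and the largest position decides.\<close>

lemma sum_block_bounds:
  fixes \<alpha> D X :: real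
  assumes b: "b \<ge> (2::nat)" and \<alpha>: "\<alpha> > 0" and D: "D \<ge> 1" and S: "finite S" "\<And>j. j \<in> S \<Longrightarrow> real (b ^ j) \<le> X"
  shows "(\<Sum>j\<in>S. if D \<le> real (b ^ j) then D / real (b ^ j) else (real (b ^ j) / D) powr \<alpha>)
    \<le> (2 + 1 / (1 - b powr (-\<alpha>))) * min 1 ((X / D) powr \<alpha>)"
proof -
  define c where "c = 1 / (1 - b powr (-\<alpha>))"
  have "b powr (-\<alpha>) < 1" using b \<alpha> by (simp add: powr_less_one)
  then have c: "c \<ge> 0" by (simp add: c_def)
  define S1 where "S1 = {j \<in> S. D \<le> real (b ^ j)}"
  define S2 where "S2 = {j \<in> S. \<not> D \<le> real (b ^ j)}"
  have split: "(\<Sum>j\<in>S. if D \<le> real (b ^ j) then D / real (b ^ j) else (real (b ^ j) / D) powr \<alpha>) =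
      (\<Sum>j\<in>S1. D / real (b ^ j)) + (\<Sum>j\<in>S2. (real (b ^ j) / D) powr \<alpha>)"
    unfolding S1_def S2_def using S(1) by (simp add: sum.If_cases Int_def)
  have s1: "(\<Sum>j\<in>S1. D / real (b ^ j)) \<le> 2"
    by (rule sum_inverse_powers_above[OF b]) (use S in \<open>auto simp: S1_def\<close>)
  \<comment> \<open>\<open>Y\<close> is left open: it becomes \<open>D\<close> when positions beyond
    the peak are allowed and \<open>X\<close> when they are not.\<close>
  have s2: "(\<Sum>j\<in>S2. (real (b ^ j) / D) powr \<alpha>) \<le> c * (Y / D) powr \<alpha>"
    if "\<And>j. j \<in> S2 \<Longrightarrow> real (b ^ j) \<le> Y" "Y \<ge> 0" for Y
  proof -
    have "(\<Sum>j\<in>S2. (real (b ^ j) / D) powr \<alpha>) = (\<Sum>j\<in>S2. real (b ^ j) powr \<alpha>) / D powr \<alpha>"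
      using D by (simp add: powr_divide sum_divide_distrib)
    also have "\<dots> \<le> (Y powr \<alpha> * c) / D powr \<alpha>"
      unfolding c_def using S that by (intro divide_right_mono sum_powers_below[OF b \<alpha>]) (auto simp: S2_def)
    also have "\<dots> = c * (Y / D) powr \<alpha>" using D that by (simp add: powr_divide)
    finally show ?thesis .
  qed
  show ?thesis
  proof (cases "X \<ge> D")
    case True
    then have "(X / D) powr \<alpha> \<ge> 1" using D \<alpha> by (intro ge_one_powr_ge_zero) auto
    moreover have "(\<Sum>j\<in>S2. (real (b ^ j) / D) powr \<alpha>) \<le> c * (D / D) powr \<alpha>"
      by (rule s2) (use D in \<open>auto simp: S2_def\<close>)
    ultimately show ?thesis unfolding split c_def[symmetric] using s1 D by simp
  next
    case False
    show ?thesis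
    proof (cases "S = {}")
      case True
      then show ?thesis using c unfolding c_def[symmetric] by simp
    next
      case ne: False
      then have X: "X \<ge> 0" using S(2) by (metis all_not_in_conv of_nat_0_le_iff order_trans)
      have "S1 = {}" using S(2) False by (fastforce simp: S1_def)
      moreover have "(\<Sum>j\<in>S2. (real (b ^ j) / D) powr \<alpha>) \<le> c * (X / D) powr \<alpha>"
        by (rule s2) (use S X in \<open>auto simp: S2_def\<close>)
      moreover have "(X / D) powr \<alpha> \<le> 1" using False D X \<alpha> by (intro powr_le1) auto
      moreover have "0 \<le> (X / D) powr \<alpha>" by simp
      ultimately show ?thesis unfolding split c_def[symmetric] by (simp add: distrib_right del: powr_ge_zero)
    qed
  qed
qed

section \<open>From points and blocks to the symmetrized sequence\<close>

lemma sum_sym_van_der_Corput: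
  fixes F :: "real \<Rightarrow> 'a::comm_monoid_add"
  shows "(\<Sum>n<N. F (sym_van_der_Corput b n)) =
    (\<Sum>m<N div 2. F (radical_inverse b m) + F (1 - radical_inverse b m)) +
    (if odd N then F (radical_inverse b (N div 2)) else 0)"
proof -
  have even: "(\<Sum>n<2 * M. F (sym_van_der_Corput b n)) =
      (\<Sum>m<M. F (radical_inverse b m) + F (1 - radical_inverse b m))" for M
    by (induction M) (simp_all add: sym_van_der_Corput_def add.assoc)
  show ?thesis
  proof (cases "odd N")
    case True
    then have "N = Suc (2 * (N div 2))" by presburger
    then have "(\<Sum>n<N. F (sym_van_der_Corput b n)) = (\<Sum>n<Suc (2 * (N div 2)). F (sym_van_der_Corput b n))" by simp
    also have "\<dots> = (\<Sum>n<2 * (N div 2). F (sym_van_der_Corput b n)) + F (sym_van_der_Corput b (2 * (N div 2)))" by simp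
    also have "sym_van_der_Corput b (2 * (N div 2)) = radical_inverse b (N div 2)"
      unfolding sym_van_der_Corput_def by simp
    finally show ?thesis using True unfolding even by simp
  next
    case False
    then have "N = 2 * (N div 2)" by presburger
    then show ?thesis using even[of "N div 2"] False by simp
  qed
qed

lemma sym_van_der_Corput_bounds:
  assumes "b \<ge> 2"
  shows "0 \<le> sym_van_der_Corput b n \<and> sym_van_der_Corput b n \<le> 1"
  using radical_inverse_bounds[OF assms, of "n div 2"] by (auto simp: sym_van_der_Corput_def)

lemma local_discrepancy_eq_sum:
  assumes N: "N > 0" and x: "\<And>n. 0 \<le> x n"
  shows "indicator {0<..<1} t * local_discrepancy N x t = (\<Sum>n<N. point_disc (x n) t) / N"
proof -
  have "(indicator {0..<t} (x n) :: real) = of_bool (x n < t)" for n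
    using x by (simp add: indicator_def)
  then have "(\<Sum>n<N. point_disc (x n) t) = indicator {0<..<1} t * ((\<Sum>n<N. indicator {0..<t} (x n)) - N * t)"
    by (simp add: point_disc_def sum_distrib_left[symmetric] sum_subtractf)
  then show ?thesis using N by (simp add: local_discrepancy_def field_simps)
qed

lemma discrepancy_on_unit:
  assumes N: "N > 0" and x: "\<And>n. 0 \<le> x n"
  defines "g \<equiv> \<lambda>t. indicator {0<..<1} t * local_discrepancy N x t"
  shows discrepancy_on_unit_measurable: "g \<in> borel_measurable borel"
    and discrepancy_on_unit_bound: "\<bar>g t\<bar> \<le> 1 * indicator {0..1} t"
proof -
  have g: "g t = (\<Sum>n<N. point_disc (x n) t) / N" for t
    unfolding g_def by (rule local_discrepancy_eq_sum[OF N x])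
  show "g \<in> borel_measurable borel" unfolding g[abs_def] by measurable
  have "\<bar>\<Sum>n<N. point_disc (x n) t\<bar> \<le> (\<Sum>n<N. indicator {0..1} t)"
    by (intro order_trans[OF sum_abs] sum_mono point_disc_bound)
  then show "\<bar>g t\<bar> \<le> 1 * indicator {0..1} t"
    unfolding g using N by (simp add: abs_divide field_simps)
qed

context kernel
begin

text \<open>In the constant, 8 is the cost of a block, \<open>b\<close> bounds the number of blocks
  for each digit position, \<open>c\<close> comes from the sum over positions, and 4 belongs to the
  unpaired point of an odd \<open>N\<close>.\<close>

lemma Lp_le_conv_sym_van_der_Corput:
  assumes b: "b \<ge> 2" and N: "N \<ge> 2" and p: "p \<ge> 1"
  defines "c \<equiv> 2 + 1 / (1 - b powr (- (1 / p)))"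
  shows "Lp_le p (\<lambda>x. \<Sum>n<N. conv K (point_disc (sym_van_der_Corput b n)) x)
    (C * (8 * real b * c + 4) * min 1 ((N / D) powr (1 / p)))"
proof -
  define \<alpha> where "\<alpha> = 1 / p"
  have \<alpha>: "\<alpha> > 0" using p by (simp add: \<alpha>_def)
  define M where "M = N div 2"
  have M: "M \<le> N" "M > 0" using N by (auto simp: M_def)
  define \<beta> where "\<beta> j = (if D \<le> real (b ^ j) then D / real (b ^ j) else (real (b ^ j) / D) powr \<alpha>)" for j
  have \<beta>: "\<beta> j > 0" for j using D_ge_1 b by (simp add: \<beta>_def)
  define \<mu> where "\<mu> = min 1 ((N / D) powr \<alpha>)"
  have \<mu>: "\<mu> > 0" using N D_ge_1 by (simp add: \<mu>_def)
  have "b powr (-\<alpha>) < 1" using b \<alpha> by (simp add: powr_less_one)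
  then have "0 < 1 / (1 - b powr (-\<alpha>))" by simp
  then have c: "c > 0" unfolding c_def \<alpha>_def[symmetric] by linarith
  define r where "r j k = radical_inverse b (M div b ^ Suc j * b + k)" for j k
  have r: "0 \<le> r j k" "r j k \<le> 1" for j k using radical_inverse_bounds[OF b] by (auto simp: r_def less_imp_le)
  \<comment> \<open>Pairs of a digit position of \<open>M\<close> and a block belonging to it. All
    digits are reached because \<open>M < b ^ M\<close>.\<close>
  define I where "I = (SIGMA j:{..<M}. {..<M div b ^ j mod b})"
  have finI: "finite I" by (simp add: I_def)
  define v where "v a x = conv K (point_disc a) x" for a x
  have blocks: "(\<Sum>m<M. v (radical_inverse b m) x + v (1 - radical_inverse b m) x) =
      (\<Sum>(j, k)\<in>I. conv K (block_disc (b ^ j) (r j k)) x)" for x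
  proof -
    define H where "H a = v a x + v (1 - a) x" for a
    have "M < b ^ M" using b by (intro less_exp[THEN order.strict_trans2] power_mono) auto
    then have z: "M div b ^ M = 0" by simp
    have "(\<Sum>m<M. H (radical_inverse b m)) =
        (\<Sum>j<M. \<Sum>k<M div b ^ j mod b. \<Sum>i<b ^ j. H (radical_inverse b ((M div b ^ Suc j * b + k) * b ^ j + i)))"
      using sum_digit_blocks[of "\<lambda>m. H (radical_inverse b m)" M b M] unfolding z by simp
    also have "\<dots> = (\<Sum>j<M. \<Sum>k<M div b ^ j mod b. \<Sum>i<b ^ j. H ((real i + r j k) / real (b ^ j)))"
      unfolding sum_radical_inverse_block[OF b] r_def ..
    also have "\<dots> = (\<Sum>j<M. \<Sum>k<M div b ^ j mod b. conv K (block_disc (b ^ j) (r j k)) x)"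
      by (simp only: conv_block_disc H_def v_def)
    also have "\<dots> = (\<Sum>(j, k)\<in>I. conv K (block_disc (b ^ j) (r j k)) x)"
      unfolding I_def by (rule sum.Sigma) auto
    finally show ?thesis by (simp add: H_def)
  qed
  have s1: "Lp_le p (\<lambda>x. \<Sum>(j, k)\<in>I. conv K (block_disc (b ^ j) (r j k)) x) (\<Sum>(j, k)\<in>I. 8 * C * \<beta> j)"
  proof -
    have "Lp_le p (\<lambda>x. \<Sum>i\<in>I. conv K (block_disc (b ^ fst i) (r (fst i) (snd i))) x) (\<Sum>i\<in>I. 8 * C * \<beta> (fst i))"
    proof (rule Lp_le_sum[OF p finI])
      fix i assume "i \<in> I"
      show "0 < 8 * C * \<beta> (fst i)" using C_pos \<beta> by simp
      show "Lp_le p (conv K (block_disc (b ^ fst i) (r (fst i) (snd i)))) (8 * C * \<beta> (fst i))"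
        unfolding \<beta>_def \<alpha>_def by (rule Lp_le_conv_block_disc) (use b p r in auto)
    qed
    then show ?thesis by (simp add: case_prod_unfold)
  qed
  have s2: "(\<Sum>(j, k)\<in>I. 8 * C * \<beta> j) \<le> 8 * C * b * c * \<mu>"
  proof -
    \<comment> \<open>Only positions with \<open>b ^ j \<le> M\<close> carry a nonzero digit; this
      supplies the upper limit needed in \<open>sum_block_bounds\<close>.\<close>
    define S where "S = {j \<in> {..<M}. b ^ j \<le> M}"
    have "(\<Sum>(j, k)\<in>I. 8 * C * \<beta> j) = (\<Sum>j<M. \<Sum>k<M div b ^ j mod b. 8 * C * \<beta> j)"
      unfolding I_def by (rule sum.Sigma[symmetric]) auto
    also have "\<dots> = (\<Sum>j<M. real (M div b ^ j mod b) * (8 * C * \<beta> j))" by simp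
    also have "\<dots> = (\<Sum>j\<in>S. real (M div b ^ j mod b) * (8 * C * \<beta> j))"
    proof -
      have "b ^ j \<le> M" if "0 < M div b ^ j mod b" for j using that by (cases "b ^ j \<le> M") auto
      then show ?thesis unfolding S_def by (intro sum.mono_neutral_right) auto
    qed
    also have "\<dots> \<le> (\<Sum>j\<in>S. real b * (8 * C * \<beta> j))"
      using b C_pos \<beta> by (intro sum_mono mult_right_mono) (auto simp: less_imp_le)
    also have "\<dots> = 8 * C * b * (\<Sum>j\<in>S. \<beta> j)"
      unfolding sum_distrib_left by (intro sum.cong refl) simp
    also have "\<dots> \<le> 8 * C * b * (c * \<mu>)"
    proof (intro mult_left_mono)
      show "(\<Sum>j\<in>S. \<beta> j) \<le> c * \<mu>"
        unfolding \<beta>_def c_def \<mu>_def \<alpha>_def[symmetric]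
        by (rule sum_block_bounds[OF b \<alpha> D_ge_1]) (use M in \<open>auto simp: S_def of_nat_power[symmetric] simp del: of_nat_power\<close>)
    qed (use C_pos in auto)
    finally show ?thesis by simp
  qed
  have bl: "Lp_le p (\<lambda>x. \<Sum>(j, k)\<in>I. conv K (block_disc (b ^ j) (r j k)) x) (8 * C * b * c * \<mu>)"
    by (rule Lp_le_mono[OF s1 _ s2]) (use C_pos \<beta> p in \<open>auto intro!: sum_nonneg simp: less_imp_le\<close>)
  have pos: "8 * C * b * c * \<mu> > 0" using C_pos b c \<mu> by simp
  have "Lp_le p (\<lambda>x. (\<Sum>(j, k)\<in>I. conv K (block_disc (b ^ j) (r j k)) x) + (if odd N then v (radical_inverse b M) x else 0))
     (C * (8 * real b * c + 4) * \<mu>)"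
  proof (cases "odd N")
    case True
    have "Lp_le p (v (radical_inverse b M)) (4 * C * (1 / D) powr \<alpha>)"
      unfolding v_def[abs_def] \<alpha>_def
      by (rule Lp_le_conv_point_disc) (use radical_inverse_bounds[OF b, of M] p in auto)
    then have 1: "Lp_le p (v (radical_inverse b M)) (4 * C * \<mu>)"
    proof (rule Lp_le_mono)
      \<comment> \<open>A single point costs no more than the blocks, since \<open>1 / D\<close> is
        at most both 1 and \<open>N / D\<close>.\<close>
      have "(1 / D) powr \<alpha> \<le> 1" using D_ge_1 \<alpha> by (intro powr_le1) auto
      moreover have "(1 / D) powr \<alpha> \<le> (N / D) powr \<alpha>"
        using D_ge_1 \<alpha> N by (intro powr_mono2 divide_right_mono) auto
      ultimately show "4 * C * (1 / D) powr \<alpha> \<le> 4 * C * \<mu>"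
        unfolding \<mu>_def using C_pos by (intro mult_left_mono) auto
    qed (use C_pos p in auto)
    have "Lp_le p (\<lambda>x. (\<Sum>(j, k)\<in>I. conv K (block_disc (b ^ j) (r j k)) x) + v (radical_inverse b M) x)
       (8 * C * b * c * \<mu> + 4 * C * \<mu>)"
      by (rule Lp_le_add[OF p pos _ bl 1]) (use C_pos \<mu> in simp)
    also have "8 * C * b * c * \<mu> + 4 * C * \<mu> = C * (8 * real b * c + 4) * \<mu>" by (simp add: algebra_simps)
    finally show ?thesis using True by simp
  next
    case False
    have "Lp_le p (\<lambda>x. \<Sum>(j, k)\<in>I. conv K (block_disc (b ^ j) (r j k)) x) (C * (8 * real b * c + 4) * \<mu>)"
      by (rule Lp_le_mono[OF bl]) (use pos C_pos p \<mu> in \<open>auto simp: algebra_simps\<close>)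
    then show ?thesis using False by simp
  qed
  then show ?thesis
    unfolding v_def[symmetric] sum_sym_van_der_Corput[of "\<lambda>a. v a _"] M_def[symmetric] blocks \<mu>_def \<alpha>_def .
qed

end

subsection \<open>The Besov norm\<close>

lemma ennpowr_le:
  assumes "x \<le> ennreal y" "0 \<le> y" "0 \<le> a"
  shows "ennpowr x a \<le> ennreal (y powr a)"
proof -
  have "x \<noteq> \<infinity>" using assms(1) by (auto simp: top_unique)
  moreover have "enn2real x \<le> y" using assms by (simp add: enn2real_leI)
  ultimately show ?thesis using assms by (auto simp: ennpowr_def intro!: ennreal_leI powr_mono2)
qed

text \<open>The case \<open>q = \<infinity>\<close> of the summation. Above \<open>N\<close> the
  exponent \<open>\<alpha>\<close> is lowered to \<open>r\<close>, after which the powers of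
  \<open>2 ^ d\<close> cancel exactly.\<close>

lemma dyadic_weight_le:
  fixes N r \<alpha> :: real
  assumes "0 < N" "0 \<le> r" "r \<le> \<alpha>"
  shows "2 powr (r * d) * min 1 ((N / 2 ^ d) powr \<alpha>) \<le> N powr r"
proof -
  have e: "2 powr (r * d) = (2 ^ d) powr r" by (simp add: powr_realpow[symmetric] powr_powr mult.commute)
  show ?thesis
  proof (cases "2 ^ d \<le> N")
    case True
    then have "(2 ^ d) powr r \<le> N powr r" using assms by (intro powr_mono2) auto
    moreover have "2 powr (r * d) * min 1 ((N / 2 ^ d) powr \<alpha>) \<le> 2 powr (r * d) * 1"
      by (intro mult_left_mono) auto
    ultimately show ?thesis unfolding e by linarith
  next
    case False
    have "2 powr (r * d) * min 1 ((N / 2 ^ d) powr \<alpha>) \<le> 2 powr (r * d) * (N / 2 ^ d) powr r"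
    proof (intro mult_left_mono)
      have "(N / 2 ^ d) powr \<alpha> \<le> (N / 2 ^ d) powr r"
        using False assms by (intro powr_mono') auto
      then show "min 1 ((N / 2 ^ d) powr \<alpha>) \<le> (N / 2 ^ d) powr r" by simp
    qed auto
    also have "\<dots> = N powr r" using assms by (simp add: e powr_divide)
    finally show ?thesis .
  qed
qed

text \<open>The levels split at \<open>2 ^ n \<le> N < 2 ^ (n + 1)\<close>. Below, the terms
  decrease towards small \<open>d\<close> with ratio \<open>\<rho>\<close>, which is 1 exactly when
  \<open>r = 0\<close> and then costs a logarithm; above, they decrease with ratio
  \<open>\<tau> < 1\<close> because \<open>r < \<alpha>\<close>.\<close>

lemma sum_dyadic_weights:
  fixes r \<alpha> q :: real
  assumes r: "0 \<le> r" "r < \<alpha>" and q: "q > 0"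
  obtains c where "c > 0" "\<And>N k :: nat. N \<ge> (2::nat) \<Longrightarrow>
    (\<Sum>d<k. (2 powr (r * real d) * min 1 ((N / 2 ^ d) powr \<alpha>)) powr q) \<le>
    c * N powr (r * q) * (if r = 0 then ln N else 1)"
proof -
  define \<rho> where "\<rho> = 2 powr (- (r * q))"
  define \<tau> where "\<tau> = 2 powr (- ((\<alpha> - r) * q))"
  have \<tau>: "0 \<le> \<tau>" "\<tau> < 1" using r q by (auto simp: \<tau>_def powr_less_one)
  have \<rho>: "0 \<le> \<rho>" "\<rho> < 1 \<or> r = 0" using r q by (auto simp: \<rho>_def powr_less_one)
  define c1 where "c1 = (if r = 0 then 2 / ln 2 else 1 / (1 - \<rho>))"
  \<comment> \<open>The tail constant appears twice: divided by \<open>ln 2\<close> it is absorbed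
    by \<open>ln N \<ge> ln 2\<close> when \<open>r = 0\<close>, and alone it covers
    \<open>r > 0\<close>.\<close>
  define c where "c = c1 + 1 / (1 - \<tau>) * (1 / ln 2) + 1 / (1 - \<tau>)"
  have c1: "c1 > 0" using \<rho> by (auto simp: c1_def)
  have t1: "1 / (1 - \<tau>) > 0" using \<tau> by simp
  have ln2: "0 < ln (2::real)" by simp
  have "c > 0" unfolding c_def using c1 t1 ln2 by (intro add_pos_pos mult_pos_pos) auto
  moreover have "(\<Sum>d<k. (2 powr (r * real d) * min 1 ((N / 2 ^ d) powr \<alpha>)) powr q) \<le>
    c * N powr (r * q) * (if r = 0 then ln N else 1)" if N: "N \<ge> 2" for N k :: nat
  proof -
    obtain n where n: "2 ^ n \<le> N" "N < 2 ^ (n + 1)"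
      using ex_power_ivl1[of 2 N] N by auto
    then have n': "2 ^ n \<le> real N" "real N < 2 ^ (n + 1)" by (metis of_nat_le_iff of_nat_numeral of_nat_power, metis of_nat_less_iff of_nat_numeral of_nat_power)
    have N0: "real N > 0" using N by simp
    define w where "w d = (2 powr (r * real d) * min 1 ((N / 2 ^ d) powr \<alpha>)) powr q" for d
    have e: "2 powr (r * real d) = (2 ^ d) powr r" for d by (simp add: powr_realpow[symmetric] powr_powr mult.commute)
    have low: "w d \<le> N powr (r * q) * \<rho> ^ (n - d)" if "d \<le> n" for d
    proof -
      have "2 powr (r * real d) = (2 ^ n) powr r * 2 powr (- (r * real (n - d)))"
        using that by (simp add: powr_realpow[symmetric] powr_powr powr_add[symmetric] of_nat_diff algebra_simps)
      also have "\<dots> \<le> N powr r * 2 powr (- (r * real (n - d)))"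
        using n' r by (intro mult_right_mono powr_mono2) auto
      finally have "2 powr (r * real d) * min 1 ((N / 2 ^ d) powr \<alpha>) \<le> (N powr r * 2 powr (- (r * real (n - d)))) * 1"
        by (intro mult_mono) auto
      then have "w d \<le> (N powr r * 2 powr (- (r * real (n - d))) * 1) powr q"
        unfolding w_def using q by (intro powr_mono2) auto
      also have "\<dots> = N powr (r * q) * \<rho> ^ (n - d)"
        by (simp add: \<rho>_def powr_mult powr_powr powr_realpow[symmetric] ac_simps)
      finally show ?thesis .
    qed
    have high: "w d \<le> N powr (r * q) * \<tau> ^ (d - (n + 1))" if "n < d" for d
    proof -
      have p: "N / 2 ^ d > 0" using N0 by simp
      have "2 powr (r * real d) * min 1 ((N / 2 ^ d) powr \<alpha>) \<le> 2 powr (r * real d) * (N / 2 ^ d) powr \<alpha>"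
        by (intro mult_left_mono) auto
      also have "\<dots> = 2 powr (r * real d) * ((N / 2 ^ d) powr r * (N / 2 ^ d) powr (\<alpha> - r))"
        by (simp add: powr_add[symmetric])
      also have "\<dots> = N powr r * (N / 2 ^ d) powr (\<alpha> - r)"
        using N0 by (simp add: e powr_divide)
      also have "\<dots> \<le> N powr r * (2 ^ (n + 1) / 2 ^ d) powr (\<alpha> - r)"
        using n' r by (intro mult_left_mono powr_mono2 divide_right_mono) auto
      also have "(2::real) ^ (n + 1) / 2 ^ d = 2 powr (- real (d - (n + 1)))"
        using that by (simp add: powr_realpow[symmetric] powr_diff powr_add of_nat_diff)
      finally have "w d \<le> (N powr r * (2 powr (- real (d - (n + 1)))) powr (\<alpha> - r)) powr q"
        unfolding w_def using q by (intro powr_mono2) auto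
      also have "\<dots> = N powr (r * q) * \<tau> ^ (d - (n + 1))"
        by (simp add: \<tau>_def powr_mult powr_powr powr_realpow[symmetric] ac_simps)
      finally show ?thesis .
    qed
    have nn: "(\<Sum>d\<in>{d. d < k \<and> d \<le> n}. \<rho> ^ (n - d)) \<le> c1 * (if r = 0 then ln N else 1)"
    proof (cases "r = 0")
      case False
      then have "\<rho> < 1" using \<rho> by auto
      then have "(\<Sum>d\<in>{d. d < k \<and> d \<le> n}. \<rho> ^ (n - d)) \<le> 1 / (1 - \<rho>)"
        using \<rho> by (intro sum_powers_inj_le) (auto simp: inj_on_def)
      then show ?thesis using False by (simp add: c1_def)
    next
      case True
      have "(\<Sum>d\<in>{d. d < k \<and> d \<le> n}. \<rho> ^ (n - d)) \<le> (\<Sum>d\<in>{..n}. \<rho> ^ (n - d))"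
        using \<rho> by (intro sum_mono2) auto
      also have "\<dots> = real n + 1" using True by (simp add: \<rho>_def)
      \<comment> \<open>Both \<open>n\<close> and 1 are at most the binary logarithm of
        \<open>N\<close>.\<close>
      also have "\<dots> \<le> 2 * (ln N / ln 2)"
      proof -
        have "ln (2 ^ n) \<le> ln (real N)" using n' N0 by (subst ln_le_cancel_iff) auto
        then have "real n \<le> ln N / ln 2" by (simp add: ln_realpow field_simps)
        moreover have "ln 2 \<le> ln (real N)" using N by (subst ln_le_cancel_iff) auto
        then have "1 \<le> ln N / ln 2" by (simp add: field_simps)
        ultimately show ?thesis by linarith
      qed
      finally show ?thesis using True by (simp add: c1_def)
    qed
    have mm: "(\<Sum>d\<in>{d. d < k \<and> n < d}. \<tau> ^ (d - (n + 1))) \<le> 1 / (1 - \<tau>)"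
      using \<tau> by (intro sum_powers_inj_le) (auto simp: inj_on_def)
    have "(\<Sum>d<k. w d) = (\<Sum>d\<in>{d. d < k \<and> d \<le> n}. w d) + (\<Sum>d\<in>{d. d < k \<and> n < d}. w d)"
      by (subst sum.union_disjoint[symmetric]) (auto intro!: sum.cong)
    also have "\<dots> \<le> (\<Sum>d\<in>{d. d < k \<and> d \<le> n}. N powr (r * q) * \<rho> ^ (n - d)) +
        (\<Sum>d\<in>{d. d < k \<and> n < d}. N powr (r * q) * \<tau> ^ (d - (n + 1)))"
      by (intro add_mono sum_mono low high) auto
    also have "\<dots> = N powr (r * q) * ((\<Sum>d\<in>{d. d < k \<and> d \<le> n}. \<rho> ^ (n - d)) + (\<Sum>d\<in>{d. d < k \<and> n < d}. \<tau> ^ (d - (n + 1))))"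
      by (simp add: sum_distrib_left distrib_left)
    also have "\<dots> \<le> N powr (r * q) * (c * (if r = 0 then ln N else 1))"
    proof (intro mult_left_mono)
      have "1 / (1 - \<tau>) \<le> (1 / (1 - \<tau>) * (1 / ln 2) + 1 / (1 - \<tau>)) * (if r = 0 then ln N else 1)"
      proof (cases "r = 0")
        case True
        have "ln 2 \<le> ln (real N)" using N by (subst ln_le_cancel_iff) auto
        then have l: "1 \<le> 1 / ln 2 * ln N" "0 \<le> ln (real N)" using ln2 by (simp add: field_simps, linarith)
        have "1 / (1 - \<tau>) * 1 \<le> 1 / (1 - \<tau>) * (1 / ln 2 * ln N)" using l t1 by (intro mult_left_mono) auto
        moreover have "0 \<le> 1 / (1 - \<tau>) * ln N" using l t1 by (intro mult_nonneg_nonneg) auto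
        ultimately show ?thesis using True by (simp add: distrib_right)
      next
        case False
        have "0 \<le> 1 / (1 - \<tau>) * (1 / ln 2)" using t1 ln2 by (intro mult_nonneg_nonneg) auto
        then show ?thesis using False by simp
      qed
      then show "(\<Sum>d\<in>{d. d < k \<and> d \<le> n}. \<rho> ^ (n - d)) + (\<Sum>d\<in>{d. d < k \<and> n < d}. \<tau> ^ (d - (n + 1)))
          \<le> c * (if r = 0 then ln N else 1)"
        using add_mono[OF nn mm] unfolding c_def add.assoc distrib_right by linarith
    qed auto
    finally show ?thesis unfolding w_def by (simp only: ac_simps)
  qed
  ultimately show ?thesis by (rule that)
qed

lemma besov_norm_sym_van_der_Corput:
  fixes p r :: real and q :: ereal
  assumes p: "1 \<le> p" and q: "1 \<le> q" and r: "0 \<le> r" "r < 1 / p" and b: "b \<ge> 2"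
    and \<phi>0: "resolution_generator \<phi>0"
  obtains C where "C > 0" "\<And>N. N \<ge> 2 \<Longrightarrow>
    besov_norm \<phi>0 (ereal p) q r (regular_distr (\<lambda>t. indicator {0<..<1} t * local_discrepancy N (sym_van_der_Corput b) t))
    \<le> ennreal (C * real N powr (r - 1) * (if r = 0 then ln (real N) powr real_of_ereal (1 / q) else 1))"
proof -
  define L where "L N d = Lp_norm_distr (ereal p) (inv_fourier_distr (mult_distr (resolution \<phi>0 d) (fourier_distr
    (regular_distr (\<lambda>t. indicator {0<..<1} t * local_discrepancy N (sym_van_der_Corput b) t)))))" for N d
  define \<mu> where "\<mu> N d = min 1 ((real N / 2 ^ d) powr (1 / p))" for N d :: nat
  have \<mu>0: "\<mu> N d \<ge> 0" for N d by (simp add: \<mu>_def)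
  obtain C0 where C0: "C0 > 0" and ker: "\<And>d. \<exists>K'. kernel (resolution_kernel \<phi>0 d) K' C0 (2 ^ d)"
    using resolution_kernel_kernel[OF \<phi>0] by blast
  define E where "E = C0 * (8 * real b * (2 + 1 / (1 - b powr (- (1 / p)))) + 4)"
  have "b powr (- (1 / p)) < 1" using b p by (intro powr_less_one) auto
  then have "0 \<le> 1 / (1 - b powr (- (1 / p)))" by simp
  then have "0 \<le> 8 * real b * (2 + 1 / (1 - b powr (- (1 / p))))" by (intro mult_nonneg_nonneg add_nonneg_nonneg) auto
  then have E: "E > 0" unfolding E_def using C0 by (intro mult_pos_pos) auto
  have L: "L N d \<le> ennreal (E / N * \<mu> N d)" if N: "N \<ge> 2" for N d
  proof -
    obtain K' where "kernel (resolution_kernel \<phi>0 d) K' C0 (2 ^ d)" using ker by blast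
    then interpret kernel "resolution_kernel \<phi>0 d" K' C0 "2 ^ d" .
    define g where "g t = indicator {0<..<1} t * local_discrepancy N (sym_van_der_Corput b) t" for t
    have g: "g t = (\<Sum>n<N. point_disc (sym_van_der_Corput b n) t) / N" for t
      unfolding g_def using N sym_van_der_Corput_bounds[OF b] by (intro local_discrepancy_eq_sum) auto
    have nonneg: "0 \<le> sym_van_der_Corput b n" for n using sym_van_der_Corput_bounds[OF b] by simp
    have N0: "N > 0" using N by simp
    note gm = discrepancy_on_unit_measurable[of N "sym_van_der_Corput b", OF N0 nonneg, folded g_def[abs_def]]
    note gb = discrepancy_on_unit_bound[of N "sym_van_der_Corput b", OF N0 nonneg, folded g_def]
    have pd: "\<bar>point_disc a y\<bar> \<le> 1" for a y
      by (rule order_trans[OF point_disc_bound]) (simp add: indicator_le_1)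
    have cg: "conv (resolution_kernel \<phi>0 d) g x = complex_of_real (1 / N) *
        (\<Sum>n<N. conv (resolution_kernel \<phi>0 d) (point_disc (sym_van_der_Corput b n)) x)" for x
    proof -
      have "conv (resolution_kernel \<phi>0 d) g x = complex_of_real (1 / N) *
          conv (resolution_kernel \<phi>0 d) (\<lambda>t. \<Sum>n<N. point_disc (sym_van_der_Corput b n) t) x"
        unfolding conv_def g integral_mult_right_zero[symmetric] by (intro Bochner_Integration.integral_cong) auto
      also have "conv (resolution_kernel \<phi>0 d) (\<lambda>t. \<Sum>n<N. point_disc (sym_van_der_Corput b n) t) x =
          (\<Sum>n<N. conv (resolution_kernel \<phi>0 d) (point_disc (sym_van_der_Corput b n)) x)"
        by (rule conv_sum[where B = "\<lambda>_. 1"]) (auto simp: pd)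
      finally show ?thesis .
    qed
    have "Lp_le p (\<lambda>x. \<Sum>n<N. conv (resolution_kernel \<phi>0 d) (point_disc (sym_van_der_Corput b n)) x) (E * \<mu> N d)"
      using Lp_le_conv_sym_van_der_Corput[OF b N p] unfolding E_def \<mu>_def .
    then have "Lp_le p (conv (resolution_kernel \<phi>0 d) g) (cmod (complex_of_real (1 / N)) * (E * \<mu> N d))"
      unfolding cg[abs_def] by (rule Lp_le_cmult) (use E \<mu>0 in simp)
    then have "Lp_norm (ereal p) (conv (resolution_kernel \<phi>0 d) g) \<le> ennreal (cmod (complex_of_real (1 / N)) * (E * \<mu> N d))"
      by (rule Lp_norm_le) (use E \<mu>0 p in auto)
    moreover have "L N d \<le> Lp_norm (ereal p) (conv (resolution_kernel \<phi>0 d) g)"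
      unfolding L_def g_def[abs_def, symmetric]
      by (rule Lp_norm_distr_regular_le[OF gm gb \<phi>0]) (rule kernel_axioms)
    ultimately show ?thesis by (simp add: norm_divide)
  qed
  show ?thesis
  proof (cases "q = \<infinity>")
    case True
    show ?thesis
    proof (rule that[OF E])
      fix N :: nat assume N: "N \<ge> 2"
      have "besov_norm \<phi>0 (ereal p) q r (regular_distr (\<lambda>t. indicator {0<..<1} t * local_discrepancy N (sym_van_der_Corput b) t))
         = (SUP d. ennreal (2 powr (r * real d)) * L N d)"
        using True by (simp add: besov_norm_def L_def)
      also have "\<dots> \<le> ennreal (E * real N powr (r - 1))"
      proof (rule SUP_least)
        fix d
        have "ennreal (2 powr (r * real d)) * L N d \<le> ennreal (2 powr (r * real d)) * ennreal (E / N * \<mu> N d)"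
          by (intro mult_left_mono L N) auto
        also have "\<dots> = ennreal (E / N * (2 powr (r * real d) * \<mu> N d))"
          using E \<mu>0 by (simp add: ennreal_mult[symmetric] ac_simps)
        also have "\<dots> \<le> ennreal (E / N * N powr r)"
          unfolding \<mu>_def using r N E by (intro ennreal_leI mult_left_mono dyadic_weight_le) auto
        also have "E / N * N powr r = E * real N powr (r - 1)" using N by (simp add: powr_diff)
        finally show "ennreal (2 powr (r * real d)) * L N d \<le> ennreal (E * real N powr (r - 1))" .
      qed
      \<comment> \<open>For \<open>q = \<infinity>\<close> the exponent \<open>1 / q\<close> is 0,
        and a positive number to the power 0 is 1.\<close>
      also have "(E * real N powr (r - 1)) = E * real N powr (r - 1) * (if r = 0 then ln (real N) powr real_of_ereal (1 / q) else 1)"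
        using True N by simp
      finally show "besov_norm \<phi>0 (ereal p) q r (regular_distr (\<lambda>t. indicator {0<..<1} t * local_discrepancy N (sym_van_der_Corput b) t))
        \<le> ennreal (E * real N powr (r - 1) * (if r = 0 then ln (real N) powr real_of_ereal (1 / q) else 1))" .
    qed
  next
    case False
    then obtain q' where q': "q = ereal q'" "q' \<ge> 1" using q by (cases q) auto
    obtain c where c: "c > 0" and W: "\<And>N k :: nat. N \<ge> (2::nat) \<Longrightarrow>
      (\<Sum>d<k. (2 powr (r * real d) * min 1 ((N / 2 ^ d) powr (1 / p))) powr q') \<le>
      c * N powr (r * q') * (if r = 0 then ln N else 1)"
      using sum_dyadic_weights[OF r, of q'] q' by auto
    show ?thesis
    proof (rule that[of "E * c powr (1 / q')"])
      show "0 < E * c powr (1 / q')" using E c by simp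
      fix N :: nat assume N: "N \<ge> 2"
      have lnN: "ln (real N) > 0" using N by simp
      define U where "U = c * N powr (r * q') * (if r = 0 then ln N else 1)"
      have U: "U \<ge> 0" using c lnN by (simp add: U_def)
      have term_le: "ennreal (2 powr (r * real d * q')) * ennpowr (L N d) q' \<le>
          ennreal ((E / N) powr q' * (2 powr (r * real d) * \<mu> N d) powr q')" for d
      proof -
        have "ennpowr (L N d) q' \<le> ennreal ((E / N * \<mu> N d) powr q')"
          using E \<mu>0 q' N by (intro ennpowr_le L) auto
        then have "ennreal (2 powr (r * real d * q')) * ennpowr (L N d) q' \<le>
            ennreal (2 powr (r * real d * q')) * ennreal ((E / N * \<mu> N d) powr q')"
          by (intro mult_left_mono) auto
        also have "\<dots> = ennreal ((E / N) powr q' * (2 powr (r * real d) * \<mu> N d) powr q')"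
          unfolding powr_mult by (simp add: ennreal_mult[symmetric] powr_powr ac_simps)
        finally show ?thesis .
      qed
      have "(\<Sum>d. ennreal (2 powr (r * real d * q')) * ennpowr (L N d) q') \<le> ennreal ((E / N) powr q' * U)"
      proof (rule suminf_le_const)
        fix k
        have "(\<Sum>d<k. ennreal (2 powr (r * real d * q')) * ennpowr (L N d) q') \<le>
          (\<Sum>d<k. ennreal ((E / N) powr q' * (2 powr (r * real d) * \<mu> N d) powr q'))"
          by (intro sum_mono term_le)
        also have "\<dots> = ennreal ((E / N) powr q' * (\<Sum>d<k. (2 powr (r * real d) * \<mu> N d) powr q'))"
          by (subst sum_ennreal) (auto simp: sum_distrib_left)
        also have "\<dots> \<le> ennreal ((E / N) powr q' * U)"
          unfolding U_def \<mu>_def by (intro ennreal_leI mult_left_mono W[OF N]) auto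
        finally show "(\<Sum>d<k. ennreal (2 powr (r * real d * q')) * ennpowr (L N d) q') \<le> ennreal ((E / N) powr q' * U)" .
      qed simp
      then have "ennpowr (\<Sum>d. ennreal (2 powr (r * real d * q')) * ennpowr (L N d) q') (1 / q') \<le>
          ennreal (((E / N) powr q' * U) powr (1 / q'))"
        using U q' by (intro ennpowr_le) auto
      also have "((E / N) powr q' * U) powr (1 / q') = E / N * U powr (1 / q')"
        using E q' N by (simp add: powr_mult powr_powr)
      also have "U powr (1 / q') = c powr (1 / q') * N powr r * (if r = 0 then ln N powr (1 / q') else 1)"
        unfolding U_def using q' by (simp add: powr_mult powr_powr)
      also have "E / N * \<dots> = E * c powr (1 / q') * real N powr (r - 1) * (if r = 0 then ln (real N) powr real_of_ereal (1 / q) else 1)"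
        using N q' by (simp add: powr_diff one_ereal_def)
      finally show "besov_norm \<phi>0 (ereal p) q r (regular_distr (\<lambda>t. indicator {0<..<1} t * local_discrepancy N (sym_van_der_Corput b) t))
        \<le> ennreal (E * c powr (1 / q') * real N powr (r - 1) * (if r = 0 then ln (real N) powr real_of_ereal (1 / q) else 1))"
        using False q' by (simp add: besov_norm_def L_def[symmetric])
    qed
  qed
qed

theorem theorem1:
  fixes p q :: ereal and r :: real and b :: nat and \<phi>0 :: "real \<Rightarrow> complex"
  assumes "1 \<le> p" and "1 \<le> q"
    and "0 \<le> r" and "ereal r < 1 / p"
    and "b \<ge> 2"
    and "resolution_generator \<phi>0"
  shows "\<exists>C::real. C > 0 \<and> (\<forall>N::nat. N \<ge> 2 \<longrightarrow>
    (r = 0 \<longrightarrow>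
      besov_norm_unit \<phi>0 p q r (distr_unit (local_discrepancy N (sym_van_der_Corput b)))
        \<le> ennreal (C * real N powr (-1) * ln (real N) powr real_of_ereal (1 / q))) \<and>
    (0 < r \<and> ereal r < 1 / p \<longrightarrow>
      besov_norm_unit \<phi>0 p q r (distr_unit (local_discrepancy N (sym_van_der_Corput b)))
        \<le> ennreal (C * real N powr (r - 1))))"
proof -
  \<comment> \<open>For \<open>p = \<infinity>\<close> the quotient \<open>1 / p\<close> is 0, and
    no \<open>r\<close> satisfies both \<open>0 \<le> r\<close> and
    \<open>r < 1 / p\<close>.\<close>
  have "p \<noteq> \<infinity>" using assms(3,4) by auto
  then obtain p' where p': "p = ereal p'" "1 \<le> p'" using assms(1) by (cases p) auto
  then have r: "r < 1 / p'" using assms(4) by (simp add: one_ereal_def)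
  define g where "g N t = indicator {0<..<1} t * local_discrepancy N (sym_van_der_Corput b) t" for N t
  obtain C where C: "C > 0" and bd: "\<And>N. N \<ge> 2 \<Longrightarrow> besov_norm \<phi>0 p q r (regular_distr (g N))
    \<le> ennreal (C * real N powr (r - 1) * (if r = 0 then ln (real N) powr real_of_ereal (1 / q) else 1))"
    using besov_norm_sym_van_der_Corput[OF p'(2) assms(2,3) r assms(5,6)] unfolding p' g_def[abs_def] by blast
  \<comment> \<open>The extension by zero competes in the infimum; it induces the same distribution
    on the interval, and \<open>bd\<close> places it in the Besov space.\<close>
  have unit: "besov_norm_unit \<phi>0 p q r (distr_unit (local_discrepancy N (sym_van_der_Corput b))) \<le>
      besov_norm \<phi>0 p q r (regular_distr (g N))" if N: "N \<ge> 2" for N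
    unfolding besov_norm_unit_def
  proof (rule Inf_lower, rule CollectI, intro exI conjI ballI)
    have nonneg: "0 \<le> sym_van_der_Corput b n" for n using sym_van_der_Corput_bounds[OF assms(5)] by simp
    have N0: "N > 0" using N by simp
    have gm: "g N \<in> borel_measurable borel"
      unfolding g_def[abs_def] by (rule discrepancy_on_unit_measurable[OF N0 nonneg])
    have gb: "\<bar>g N t\<bar> \<le> 1 * indicator {0..1} t" for t
      unfolding g_def by (rule discrepancy_on_unit_bound[OF N0 nonneg])
    have "besov_norm \<phi>0 p q r (regular_distr (g N)) < \<infinity>"
      using bd[OF N] by (rule order.strict_trans1) simp
    then show "regular_distr (g N) \<in> besov_space \<phi>0 p q r"
      unfolding besov_space_def using tempered_regular_distr[OF gm gb] by simp
    fix \<psi>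
    have "complex_of_real (g N t) * \<psi> t = indicator {0<..<1} t *\<^sub>R (complex_of_real (local_discrepancy N (sym_van_der_Corput b) t) * \<psi> t)" for t
      by (simp add: g_def scaleR_conv_of_real)
    then show "regular_distr (g N) \<psi> = distr_unit (local_discrepancy N (sym_van_der_Corput b)) \<psi>"
      unfolding regular_distr_def distr_unit_def set_lebesgue_integral_def by simp
  qed (rule refl)
  show ?thesis
  proof (intro exI[of _ C] conjI allI impI C)
    fix N :: nat assume N: "N \<ge> 2"
    note le = order_trans[OF unit[OF N] bd[OF N]]
    show "besov_norm_unit \<phi>0 p q r (distr_unit (local_discrepancy N (sym_van_der_Corput b)))
        \<le> ennreal (C * real N powr (-1) * ln (real N) powr real_of_ereal (1 / q))" if "r = 0"
      using le that by simp
    show "besov_norm_unit \<phi>0 p q r (distr_unit (local_discrepancy N (sym_van_der_Corput b)))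
        \<le> ennreal (C * real N powr (r - 1))" if "0 < r \<and> ereal r < 1 / p"
      using le that by simp
  qed
qed

end
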